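(* Let $\Phi$ be a unit norm tight frame in $\mathbb{R}^d$ with $K$ atoms, frame constant $A=K/d$, coherence $\mu$ and lower isometry constant $\delta_S\le\mu S$, where $1\le S\le K$. Let $y_n=\Phi x_n$, $n=1,\dots,N$, with $x_n$ i.i.d. drawn from a symmetric probability distribution $\nu$ on $S^{K-1}$, and assume there is $\kappa>0$ with $$\nu\Big(\min_{p,\sigma}\Big(\|P_{I_p}(\Phi)\Phi c_{p,\sigma}(x)\|_2-\max_{|I|\le S,\ I\ne I_p}\|P_I(\Phi)\Phi c_{p,\sigma}(x)\|_2\Big)\ge2\kappa\Big)=1,\quad I_p:=p^{-1}(\{1,\dots,S\}).$$ Let $\gamma_S^2:=\mathbb{E}_x(c_1^2(x)+\dots+c_S^2(x))$, $\lambda:=\frac{\gamma_S^2}{S}-\frac{1-\gamma_S^2}{K-S}$ and $C_S:=\big(1-\frac{S}{d(1-\delta_S)}\big)^2$. If for some $0<q<1/4$, $$N^{-q}+N^{-2q}/K\le\frac{\kappa^2(1-\delta_S)}{68\sqrt S\log(5AK^S/\lambda)},$$ then, except with probability $\exp\Big(-\frac{N^{1-4q}\lambda^2S^2C_S}{4K^2A}+Kd\log\big(\frac{NKA}{\lambda S}\big)\Big)$, there is a local maximum $\tilde\Psi$ of $$\max_{\Psi\in\mathcal D}\frac1N\sum_{n=1}^N\max_{|I|\le S}\|P_I(\Psi)y_n\|_2^2$$ (equivalently a local minimum of $\min_{\Psi\in\mathcal D,X\in\mathcal X_S}\|Y-\Psi X\|_F^2$) with $\max_k\|\tilde\psi_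k-\phi_k\|_2\le2N^{-q}$.
   Context: $\mathcal D$ is the set of dictionaries $\Psi=(\psi_1,\dots,\psi_K)$, $\psi_i\in\mathbb{R}^d$, $\|\psi_i\|_2=1$; $P_I(\Psi)=\Psi_I\Psi_I^\dagger$ is the orthogonal projection onto the span of $(\psi_i)_{i\in I}$. $Y=(y_1,\dots,y_N)$; $\mathcal X_S$ is the set of $K\times N$ matrices with at most $S$ nonzeros per column. The lower isometry constant is $\delta_S=\max_{|I|\le S}\big(1-\lambda_{\min}(\Phi_I^\star\Phi_I)\big)$. Unit norm tight frame: $\sum_i|\langle\phi_i,v\rangle|^2=A\|v\|_2^2$; coherence $\mu=\max_{i\ne j}|\langle\phi_i,\phi_j\rangle|$. Symmetric measure on $S^{K-1}$: invariant under coordinate sign flips and permutations. $c(x)$ is the non-increasing rearrangement of $(|x_i|)_i$, $c_{p,\sigma}(x)(i)=\sigma_ic_{p(i)}(x)$. *)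

theory Defs
  imports "HOL-Analysis.Analysis" "HOL-Probability.Probability"
begin

text \<open>Atoms of a dictionary are indexed by a finite type 'k (K = CARD('k)),
 signal space is real^'d (d = CARD('d)).\<close>

definition synth :: "('k::finite \<Rightarrow> real^'d) \<Rightarrow> real^'k \<Rightarrow> real^'d" where
  "synth \<Phi> x = (\<Sum>i\<in>UNIV. (x $ i) *\<^sub>R \<Phi> i)"

definition dict_set :: "('k::finite \<Rightarrow> real^'d) set" where
  "dict_set = {\<Psi>. \<forall>i. norm (\<Psi> i) = 1}"

definition orth_proj :: "'a::euclidean_space set \<Rightarrow> 'a \<Rightarrow> 'a" where
  "orth_proj V y = (THE z. z \<in> V \<and> (\<forall>w\<in>V. (y - z) \<bullet> w = 0))"

definition proj_I :: "('k \<Rightarrow> real^'d) \<Rightarrow> 'k set \<Rightarrow> real^'d \<Rightarrow> real^'d" where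
  "proj_I \<Psi> I y = orth_proj (span (\<Psi> ` I)) y"

definition unit_norm_tight_frame :: "('k::finite \<Rightarrow> real^'d) \<Rightarrow> real \<Rightarrow> bool" where
  "unit_norm_tight_frame \<Phi> A \<longleftrightarrow> (\<forall>i. norm (\<Phi> i) = 1) \<and>
     (\<forall>v. (\<Sum>i\<in>UNIV. (\<Phi> i \<bullet> v)^2) = A * (norm v)^2)"

definition coherence :: "('k::finite \<Rightarrow> real^'d) \<Rightarrow> real" where
  "coherence \<Phi> = Max {\<bar>\<Phi> i \<bullet> \<Phi> j\<bar> | i j. i \<noteq> j}"

text \<open>Smallest eigenvalue of the Gram matrix Phi_I^* Phi_I (Rayleigh quotient).\<close>
definition lambda_min :: "('k \<Rightarrow> real^'d) \<Rightarrow> 'k set \<Rightarrow> real" where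
  "lambda_min \<Phi> I = Inf {(norm (\<Sum>i\<in>I. v i *\<^sub>R \<Phi> i))^2 | v. (\<Sum>i\<in>I. (v i)^2) = 1}"

definition lower_isometry_const :: "('k::finite \<Rightarrow> real^'d) \<Rightarrow> nat \<Rightarrow> real" where
  "lower_isometry_const \<Phi> S = Max {1 - lambda_min \<Phi> I | I. I \<noteq> {} \<and> card I \<le> S}"

definition symmetric_sphere_measure :: "(real^'k::finite) measure \<Rightarrow> bool" where
  "symmetric_sphere_measure \<nu> \<longleftrightarrow> prob_space \<nu> \<and> sets \<nu> = sets borel \<and>
     emeasure \<nu> (sphere 0 1) = 1 \<and>
     (\<forall>\<pi>. \<pi> permutes (UNIV::'k set) \<longrightarrow> distr \<nu> borel (\<lambda>x. \<chi> i. x $ \<pi> i) = \<nu>) \<and>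
     (\<forall>s. (\<forall>i. s i \<in> {-1, 1}) \<longrightarrow> distr \<nu> borel (\<lambda>x. \<chi> i. s i * x $ i) = \<nu>)"

text \<open>Non-increasing rearrangement c(x) of (|x_i|)_i, indexed by 1..K.\<close>
definition rearr :: "real^'k::finite \<Rightarrow> nat \<Rightarrow> real" where
  "rearr x j = rev (sort (map (\<lambda>i. \<bar>x $ i\<bar>) (SOME xs. distinct xs \<and> set xs = (UNIV::'k set)))) ! (j - 1)"

definition rearr_ps :: "('k::finite \<Rightarrow> nat) \<Rightarrow> ('k \<Rightarrow> real) \<Rightarrow> real^'k \<Rightarrow> real^'k" where
  "rearr_ps p \<sigma> x = (\<chi> i. \<sigma> i * rearr x (p i))"

definition obj :: "nat \<Rightarrow> nat \<Rightarrow> (nat \<Rightarrow> real^'d) \<Rightarrow> ('k::finite \<Rightarrow> real^'d) \<Rightarrow> real" where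
  "obj S N y \<Psi> = (1 / real N) * (\<Sum>n=1..N. Max ((\<lambda>I. (norm (proj_I \<Psi> I (y n)))^2) ` {I. card I \<le> S}))"

definition local_max_on :: "('a \<Rightarrow> 'b::metric_space) set \<Rightarrow> (('a \<Rightarrow> 'b) \<Rightarrow> real) \<Rightarrow> ('a \<Rightarrow> 'b) \<Rightarrow> bool" where
  "local_max_on D F \<Psi>0 \<longleftrightarrow> \<Psi>0 \<in> D \<and>
     (\<exists>\<epsilon>>0. \<forall>\<Psi>\<in>D. (\<forall>k. dist (\<Psi> k) (\<Psi>0 k) < \<epsilon>) \<longrightarrow> F \<Psi> \<le> F \<Psi>0)"

end

theory Submission
  imports Defs
begin

text \<open>
  Let \<open>r = 2 N\<^sup>-\<^sup>q\<close>. Near \<open>\<Phi>\<close> the objective is continuous, so it suffices that with high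
  probability it is smaller than its value at \<open>\<Phi>\<close> for every dictionary \<open>\<Psi>\<close> with
  \<open>max\<^sub>k \<parallel>\<psi>\<^sub>k - \<phi>\<^sub>k\<parallel> = r\<close>: then its maximum over the ball of radius \<open>r\<close> is a local maximum.

  For a fixed such \<open>\<Psi>\<close>, the gap condition makes the best support of \<open>\<Phi> x\<close> for \<open>\<Psi>\<close> the set \<open>I\<close> of
  the \<open>S\<close> largest entries of \<open>x\<close>, unless \<open>\<parallel>\<Phi> x\<parallel>\<close> is exceptionally large. By symmetry of \<open>\<nu>\<close> and
  tightness of the frame the expected drop of the objective is then \<open>\<lambda>\<close> times the average over \<open>I\<close>
  of \<open>D\<^sub>I = \<parallel>(1 - P\<^sub>I(\<Psi>)) \<Phi>\<^sub>I\<parallel>\<^sub>F\<^sup>2\<close>. The drop on \<open>I\<close> is bounded by \<open>\<surd>(D\<^sub>I / (1 - \<delta>\<^sub>S)) \<parallel>\<Phi> x\<parallel>\<^sup>2\<close>, and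
  random signs give \<open>\<parallel>\<Phi> x\<parallel>\<^sup>2\<close> a bounded exponential moment; so the variance of the drop is controlled
  by its mean and a Bernstein-type bound holds with exponent linear in the mean. This gains a factor
  \<open>r\<^sup>-\<^sup>2\<close> over Hoeffding's inequality, which covers all constants of the theorem, including the regime
  \<open>S > d (1 - \<delta>\<^sub>S)\<close>. There the average of \<open>D\<^sub>I\<close> is bounded below by the gap condition alone: averaging
  it over signs and comparing two rankings that differ by a transposition shows that the atoms of any
  \<open>S + 1\<close> element set are quantitatively independent. A grid and a union bound over the grid points
  make the estimate uniform in \<open>\<Psi>\<close>. If \<open>S = K\<close> the frame is an orthonormal basis, \<open>C\<^sub>S = 0\<close>, and the
  probability bound is trivial.
\<close>

section \<open>Orthogonal projections\<close>

text \<open>The gap condition enters in two unrelated ways. As an almost sure property of the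
  samples it fixes the optimal support. Evaluated at one single point of the sphere it becomes a
  deterministic statement about \<open>\<Phi>\<close>, and this yields
  \<open>4 * \<kappa>\<^sup>2 * S \<le> 1\<close>, the lower bound
  \<open>4 * \<kappa>\<^sup>2 / (S + 3)\<close> for \<open>1 - \<delta>\<close> and the lower bound
  for the averaged residual. The factor \<open>C\<close> of the claimed exponent does not come out
  of these estimates. The exponent obtained here is of order \<open>\<epsilon>\<^sup>2\<close>
  instead of \<open>\<epsilon> ^ 4\<close>, and an upper bound for \<open>C\<close> in terms of the
  gap shows that it is the stronger one. The size of the grid is the other obstacle: it is compared
  with \<open>N * K * A / (lam * S)\<close> per coordinate, and \<open>N\<close> has to be large for
  that. The comparison is made only when the claimed probability bound is below 1, because this
  already forces \<open>d * S \<le> N * \<epsilon>\<^sup>2\<close>; in the remaining case the whole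
  space is a legitimate exceptional set.\<close>

lemma orth_proj_exists:
  fixes V :: "'a::euclidean_space set"
  assumes "subspace V"
  shows "\<exists>!z. z \<in> V \<and> (\<forall>w\<in>V. (y - z) \<bullet> w = 0)"
proof -
  obtain z u where zu: "z \<in> span V" "\<And>w. w \<in> span V \<Longrightarrow> orthogonal u w" "y = z + u"
    using orthogonal_subspace_decomp_exists[of V y] by metis
  have sp: "span V = V" using assms by (simp add: span_eq_iff)
  have "z \<in> V \<and> (\<forall>w\<in>V. (y - z) \<bullet> w = 0)"
    using zu sp by (auto simp: orthogonal_def)
  moreover have "z' = z" if "z' \<in> V \<and> (\<forall>w\<in>V. (y - z') \<bullet> w = 0)" for z'
  proof -
    have "z - z' \<in> V" using that calculation assms by (simp add: subspace_diff)
    then have "(y - z') \<bullet> (z - z') = 0" "(y - z) \<bullet> (z - z') = 0" using that calculation by auto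
    then have "(z - z') \<bullet> (z - z') = 0" by (simp add: inner_diff_left)
    then show ?thesis by simp
  qed
  ultimately show ?thesis by blast
qed

lemma
  fixes V :: "'a::euclidean_space set"
  assumes "subspace V"
  shows orth_proj_in: "orth_proj V y \<in> V"
    and orth_proj_orth: "w \<in> V \<Longrightarrow> (y - orth_proj V y) \<bullet> w = 0"
  using theI'[OF orth_proj_exists[OF assms, of y]] unfolding orth_proj_def by auto

lemma orth_proj_unique:
  fixes V :: "'a::euclidean_space set"
  assumes "subspace V" "z \<in> V" "\<And>w. w \<in> V \<Longrightarrow> (y - z) \<bullet> w = 0"
  shows "orth_proj V y = z"
  unfolding orth_proj_def using assms orth_proj_exists[OF assms(1), of y]
  by (intro the1_equality) auto

lemma orth_proj_id: "subspace V \<Longrightarrow> y \<in> V \<Longrightarrow> orth_proj V y = y"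
  by (rule orth_proj_unique) auto

lemma linear_orth_proj:
  fixes V :: "'a::euclidean_space set"
  assumes "subspace V"
  shows "linear (orth_proj V)"
proof (rule linearI)
  fix x y :: 'a and c :: real
  show "orth_proj V (x + y) = orth_proj V x + orth_proj V y"
  proof (rule orth_proj_unique[OF assms])
    fix w assume "w \<in> V"
    then have "(x - orth_proj V x) \<bullet> w = 0" "(y - orth_proj V y) \<bullet> w = 0"
      using orth_proj_orth[OF assms] by auto
    then show "(x + y - (orth_proj V x + orth_proj V y)) \<bullet> w = 0"
      by (simp add: inner_diff_left inner_add_left)
  qed (intro subspace_add assms orth_proj_in)
  show "orth_proj V (c *\<^sub>R x) = c *\<^sub>R orth_proj V x"
  proof (rule orth_proj_unique[OF assms])
    fix w assume "w \<in> V"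
    then have "(x - orth_proj V x) \<bullet> w = 0"
      using orth_proj_orth[OF assms] by auto
    then show "(c *\<^sub>R x - c *\<^sub>R orth_proj V x) \<bullet> w = 0"
      by (simp flip: scaleR_diff_right)
  qed (intro subspace_scale assms orth_proj_in)
qed

lemma orth_proj_adjoint:
  fixes V :: "'a::euclidean_space set"
  assumes "subspace V"
  shows "orth_proj V x \<bullet> y = x \<bullet> orth_proj V y"
proof -
  have "(x - orth_proj V x) \<bullet> orth_proj V y = 0" "(y - orth_proj V y) \<bullet> orth_proj V x = 0"
    using orth_proj_in[OF assms] orth_proj_orth[OF assms] by auto
  then have "x \<bullet> orth_proj V y = orth_proj V x \<bullet> orth_proj V y"
    "y \<bullet> orth_proj V x = orth_proj V y \<bullet> orth_proj V x"
    unfolding inner_diff_left by linarith+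
  then show ?thesis by (metis inner_commute)
qed

lemma norm_orth_proj_sq:
  fixes V :: "'a::euclidean_space set"
  assumes "subspace V"
  shows "(norm (orth_proj V y))\<^sup>2 = orth_proj V y \<bullet> y"
proof -
  have "orth_proj V y \<bullet> y = orth_proj V (orth_proj V y) \<bullet> y"
    by (simp add: orth_proj_id[OF assms orth_proj_in[OF assms]])
  then show ?thesis by (simp add: orth_proj_adjoint[OF assms] power2_norm_eq_inner)
qed

lemma orth_proj_pythagoras:
  fixes V :: "'a::euclidean_space set"
  assumes "subspace V"
  shows "(norm y)\<^sup>2 = (norm (orth_proj V y))\<^sup>2 + (norm (y - orth_proj V y))\<^sup>2"
proof -
  have "(norm (y - orth_proj V y))\<^sup>2 = y \<bullet> y - 2 * (orth_proj V y \<bullet> y) + orth_proj V y \<bullet> orth_proj V y"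
    by (simp add: power2_norm_eq_inner inner_diff_left inner_diff_right inner_commute)
  then show ?thesis using norm_orth_proj_sq[OF assms, of y] by (simp add: power2_norm_eq_inner)
qed

lemma norm_orth_proj_le:
  fixes V :: "'a::euclidean_space set"
  assumes "subspace V"
  shows "norm (orth_proj V y) \<le> norm y" "norm (y - orth_proj V y) \<le> norm y"
  by (rule power2_le_imp_le; use orth_proj_pythagoras[OF assms, of y] in simp)+

lemma orth_proj_nearest:
  fixes V :: "'a::euclidean_space set"
  assumes "subspace V" "w \<in> V"
  shows "norm (y - orth_proj V y) \<le> norm (y - w)"
proof -
  have "(y - w) - orth_proj V (y - w) = y - orth_proj V y"
    by (simp add: linear_diff[OF linear_orth_proj[OF assms(1)]] orth_proj_id[OF assms])
  then show ?thesis using norm_orth_proj_le(2)[OF assms(1), of "y - w"] by metis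
qed

lemma orth_proj_nested:
  fixes V :: "'a::euclidean_space set"
  assumes "subspace V" "subspace W" "V \<subseteq> W"
  shows "orth_proj V (orth_proj W y) = orth_proj V y"
proof (rule orth_proj_unique[OF assms(1) orth_proj_in[OF assms(1)]])
  fix w assume "w \<in> V"
  then have "(y - orth_proj W y) \<bullet> w = 0" "(y - orth_proj V y) \<bullet> w = 0"
    using assms orth_proj_orth[OF assms(1)] orth_proj_orth[OF assms(2)] by auto
  then show "(orth_proj W y - orth_proj V y) \<bullet> w = 0" by (simp add: inner_diff_left)
qed

lemma orth_proj_residual_nested:
  fixes V :: "'a::euclidean_space set"
  assumes "subspace V" "subspace W" "V \<subseteq> W"
  shows "(norm (y - orth_proj V y))\<^sup>2 =
    (norm (orth_proj W y - orth_proj V (orth_proj W y)))\<^sup>2 + (norm (y - orth_proj W y))\<^sup>2"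
  using orth_proj_pythagoras[OF assms(1), of y] orth_proj_pythagoras[OF assms(2), of y]
    orth_proj_pythagoras[OF assms(1), of "orth_proj W y"]
  unfolding orth_proj_nested[OF assms] by linarith

lemma orth_proj_orthonormal:
  fixes V :: "'a::euclidean_space set"
  assumes "subspace V" "span B = V" "pairwise orthogonal B" "\<And>b. b \<in> B \<Longrightarrow> norm b = 1"
    "finite B"
  shows "(norm (orth_proj V x))\<^sup>2 = (\<Sum>b\<in>B. (b \<bullet> x)\<^sup>2)"
proof -
  let ?z = "\<Sum>b\<in>B. (b \<bullet> x) *\<^sub>R b"
  have bb: "?z \<bullet> c = c \<bullet> x" if "c \<in> B" for c
  proof -
    have "?z \<bullet> c = (\<Sum>b\<in>B. (b \<bullet> x) * (b \<bullet> c))" by (simp add: inner_sum_left)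
    also have "\<dots> = (\<Sum>b\<in>B. if b = c then c \<bullet> x else 0)"
      using assms(3,4) that
      by (intro sum.cong) (auto simp: pairwise_def orthogonal_def power2_norm_eq_inner[symmetric])
    also have "\<dots> = c \<bullet> x" using assms(5) that by simp
    finally show ?thesis .
  qed
  have "?z \<in> V" unfolding assms(2)[symmetric] by (intro span_sum span_scale span_base)
  have "orth_proj V x = ?z"
  proof (rule orth_proj_unique[OF assms(1) \<open>?z \<in> V\<close>])
    fix w assume "w \<in> V"
    then have "w \<in> span B" using assms by simp
    then show "(x - ?z) \<bullet> w = 0"
    proof (induction rule: span_induct)
      case base
      show ?case by (auto simp: subspace_def inner_add_right)
    next
      case (step c)
      then show ?case using bb[of c] by (simp add: inner_diff_left inner_commute[of x c])
    qed
  qed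
  then show ?thesis
    unfolding norm_orth_proj_sq[OF assms(1)]
    by (simp add: inner_sum_left power2_eq_square)
qed

text \<open>For subspaces of equal dimension the two one-sided gaps coincide: the projection onto
  \<open>V\<close> restricted to \<open>U\<close> is injective, hence onto.\<close>

lemma subspace_gap_sym:
  fixes U V :: "'a::euclidean_space set"
  assumes "subspace U" "subspace V" "dim V \<le> dim U" "0 \<le> \<theta>" "\<theta> < 1"
    and gap: "\<And>u. u \<in> U \<Longrightarrow> norm (u - orth_proj V u) \<le> \<theta> * norm u"
    and "v \<in> V"
  shows "norm (v - orth_proj U v) \<le> \<theta> * norm v"
proof -
  have low: "(1 - \<theta>\<^sup>2) * (norm u)\<^sup>2 \<le> (norm (orth_proj V u))\<^sup>2" if "u \<in> U" for u
    using orth_proj_pythagoras[OF assms(2), of u] power_mono[OF gap[OF that], of 2]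
    by (simp add: power_mult_distrib algebra_simps)
  have th: "\<theta>\<^sup>2 < 1" using assms by (simp add: power_less_one_iff)
  have lin: "linear (orth_proj V)" by (rule linear_orth_proj[OF assms(2)])
  have inj: "inj_on (orth_proj V) (span U)"
  proof (rule inj_onI)
    fix x y assume "x \<in> span U" "y \<in> span U" and e: "orth_proj V x = orth_proj V y"
    then have d: "x - y \<in> U" using assms(1) by (metis span_eq_iff subspace_diff)
    have "orth_proj V (x - y) = 0" using e by (simp add: linear_diff[OF lin])
    with low[OF d] have "(1 - \<theta>\<^sup>2) * (norm (x - y))\<^sup>2 \<le> 0" by simp
    then have "(norm (x - y))\<^sup>2 \<le> 0" using th by (simp add: mult_le_0_iff)
    then show "x = y" by simp
  qed
  have "dim (orth_proj V ` U) = dim U"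
    by (rule dim_image_eq[OF lin inj])
  then have "orth_proj V ` U = V"
    using assms orth_proj_in[OF assms(2)]
    by (intro subspace_dim_equal linear_subspace_image lin) auto
  then obtain u where u: "u \<in> U" "v = orth_proj V u" using \<open>v \<in> V\<close> by blast
  \<comment> \<open>Testing \<open>v\<close> against its preimage \<open>u\<close> gives the full
    squared norm of \<open>v\<close>, while \<open>u\<close> only sees the component of
    \<open>v\<close> in \<open>U\<close>; hence that component cannot be small.\<close>
  have vu: "v \<bullet> u = (norm v)\<^sup>2" using norm_orth_proj_sq[OF assms(2), of u] u by simp
  have "v \<bullet> u = orth_proj U v \<bullet> u"
    using orth_proj_orth[OF assms(1) u(1), of v] by (simp add: inner_diff_left)
  then have "(norm v)\<^sup>2 \<le> norm (orth_proj U v) * norm u"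
    using vu norm_cauchy_schwarz[of "orth_proj U v" u] by simp
  then have "((norm v)\<^sup>2)\<^sup>2 \<le> (norm (orth_proj U v))\<^sup>2 * (norm u)\<^sup>2"
    by (metis power_mono power_mult_distrib zero_le_power2)
  then have "(1 - \<theta>\<^sup>2) * ((norm v)\<^sup>2)\<^sup>2 \<le> (norm (orth_proj U v))\<^sup>2 * ((1 - \<theta>\<^sup>2) * (norm u)\<^sup>2)"
    using th mult_left_mono[of "((norm v)\<^sup>2)\<^sup>2" _ "1 - \<theta>\<^sup>2"] by (simp add: mult_ac)
  also have "\<dots> \<le> (norm (orth_proj U v))\<^sup>2 * (norm v)\<^sup>2"
    using low[OF u(1)] u(2) by (intro mult_left_mono) auto
  finally have "(1 - \<theta>\<^sup>2) * (norm v)\<^sup>2 \<le> (norm (orth_proj U v))\<^sup>2"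
    by (cases "v = 0") (simp_all add: power2_eq_square)
  then have "(norm (v - orth_proj U v))\<^sup>2 \<le> (\<theta> * norm v)\<^sup>2"
    using orth_proj_pythagoras[OF assms(1), of v] by (simp add: power_mult_distrib algebra_simps)
  then show ?thesis by (rule power2_le_imp_le) (use assms in simp)
qed

text \<open>With \<open>P\<close>, \<open>R\<close> the projections onto \<open>U\<close>,
  \<open>V\<close>, the difference splits into \<open>P (y - R y)\<close> and
  \<open>R y - P (R y)\<close>. These are orthogonal and are controlled by the orthogonal pieces
  \<open>y - R y\<close> and \<open>R y\<close> of \<open>y\<close>, so Pythagoras keeps the
  constant \<open>\<theta>\<close>, where the triangle inequality would lose a factor. The second
  piece needs the gap in the reverse direction, hence the condition on dimensions.\<close>

lemma orth_proj_diff_le: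
  fixes U V :: "'a::euclidean_space set"
  assumes "subspace U" "subspace V" "dim V \<le> dim U" "0 \<le> \<theta>" "\<theta> < 1"
    and gap: "\<And>u. u \<in> U \<Longrightarrow> norm (u - orth_proj V u) \<le> \<theta> * norm u"
  shows "norm (orth_proj U y - orth_proj V y) \<le> \<theta> * norm y"
proof -
  let ?P = "orth_proj U" and ?R = "orth_proj V"
  note lin = linear_orth_proj[OF assms(1)] linear_orth_proj[OF assms(2)]
  let ?a = "?P (y - ?R y)" and ?b = "?R y - ?P (?R y)"
  have ab: "?P y - ?R y = ?a - ?b" by (simp add: linear_diff[OF lin(1)])
  have orth: "?b \<bullet> ?a = 0" by (rule orth_proj_orth[OF assms(1) orth_proj_in[OF assms(1)]])
  have "(norm (?a - ?b))\<^sup>2 = (norm ?a)\<^sup>2 + (norm ?b)\<^sup>2"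
    using orth by (simp add: power2_norm_eq_inner inner_diff_left inner_diff_right inner_commute)
  have b: "norm ?b \<le> \<theta> * norm (?R y)"
    by (rule subspace_gap_sym[OF assms]) (use orth_proj_in[OF assms(2)] in auto)
  have "norm ?a * norm ?a = ?a \<bullet> (y - ?R y)"
    using norm_orth_proj_sq[OF assms(1), of "y - ?R y"] by (simp add: power2_eq_square)
  also have "\<dots> = (?a - ?R ?a) \<bullet> (y - ?R y)"
    using orth_proj_orth[OF assms(2) orth_proj_in[OF assms(2)], of y ?a]
    by (simp add: inner_diff_left inner_diff_right inner_commute)
  also have "\<dots> \<le> norm (?a - ?R ?a) * norm (y - ?R y)" by (rule norm_cauchy_schwarz)
  also have "\<dots> \<le> (\<theta> * norm ?a) * norm (y - ?R y)"
    by (intro mult_right_mono gap orth_proj_in[OF assms(1)]) auto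
  finally have "norm ?a * norm ?a \<le> norm ?a * (\<theta> * norm (y - ?R y))" by (simp add: mult_ac)
  then have a: "norm ?a \<le> \<theta> * norm (y - ?R y)"
    using \<open>0 \<le> \<theta>\<close> by (cases "norm ?a = 0") auto
  have "(norm (?a - ?b))\<^sup>2 \<le> (\<theta> * norm (y - ?R y))\<^sup>2 + (\<theta> * norm (?R y))\<^sup>2"
    unfolding \<open>(norm (?a - ?b))\<^sup>2 = _\<close> using a b by (intro add_mono power_mono) auto
  also have "\<dots> = (\<theta> * norm y)\<^sup>2"
    using orth_proj_pythagoras[OF assms(2), of y] by (simp add: power_mult_distrib algebra_simps)
  finally show ?thesis unfolding ab by (rule power2_le_imp_le) (use assms in simp)
qed

section \<open>Perturbation of spans of atoms\<close>

lemma subspace_span_image [simp]: "subspace (span (\<Psi> ` I))"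
  by simp

lemma span_image_sum:
  fixes \<Phi> :: "'k \<Rightarrow> 'a::real_vector"
  assumes "finite J" "u \<in> span (\<Phi> ` J)"
  obtains v where "u = (\<Sum>j\<in>J. v j *\<^sub>R \<Phi> j)"
proof -
  let ?T = "{u. \<exists>v. u = (\<Sum>j\<in>J. v j *\<^sub>R \<Phi> j)}"
  have "subspace ?T"
  proof (rule subspaceI)
    show "0 \<in> ?T" by (auto intro!: exI[of _ "\<lambda>_. 0"])
    fix x y :: 'a and c :: real
    assume "x \<in> ?T"
    then obtain v where v: "x = (\<Sum>j\<in>J. v j *\<^sub>R \<Phi> j)" by auto
    show "c *\<^sub>R x \<in> ?T" using v by (auto intro!: exI[of _ "\<lambda>j. c * v j"] simp: scaleR_sum_right)
    assume "y \<in> ?T"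
    then obtain w where "y = (\<Sum>j\<in>J. w j *\<^sub>R \<Phi> j)" by auto
    with v show "x + y \<in> ?T"
      by (auto intro!: exI[of _ "\<lambda>j. v j + w j"] simp: scaleR_add_left sum.distrib)
  qed
  moreover have "\<Phi> ` J \<subseteq> ?T"
  proof
    fix x assume "x \<in> \<Phi> ` J"
    then obtain i where i: "i \<in> J" "x = \<Phi> i" by auto
    have "(\<Sum>j\<in>J. (if j = i then 1 else 0) *\<^sub>R \<Phi> j) = (\<Sum>j\<in>J. if j = i then \<Phi> i else 0)"
      by (rule sum.cong) auto
    also have "\<dots> = x" using i assms(1) by simp
    finally show "x \<in> ?T" by (auto intro!: exI[of _ "\<lambda>j. if j = i then 1 else 0"])
  qed
  ultimately have "span (\<Phi> ` J) \<subseteq> ?T" by (intro span_minimal)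
  then show thesis using assms(2) that by blast
qed

lemma norm_sum_scaleR_le:
  fixes w :: "'k \<Rightarrow> 'a::real_normed_vector"
  shows "(norm (\<Sum>j\<in>J. v j *\<^sub>R w j))\<^sup>2 \<le> (\<Sum>j\<in>J. (v j)\<^sup>2) * (\<Sum>j\<in>J. (norm (w j))\<^sup>2)"
proof -
  have "norm (\<Sum>j\<in>J. v j *\<^sub>R w j) \<le> (\<Sum>j\<in>J. \<bar>v j\<bar> * \<bar>norm (w j)\<bar>)"
    by (rule order_trans[OF norm_sum]) simp
  also have "\<dots> \<le> L2_set v J * L2_set (\<lambda>j. norm (w j)) J" by (rule L2_set_mult_ineq)
  finally have "(norm (\<Sum>j\<in>J. v j *\<^sub>R w j))\<^sup>2 \<le> (L2_set v J * L2_set (\<lambda>j. norm (w j)) J)\<^sup>2"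
    by (intro power_mono) auto
  then show ?thesis by (simp add: power_mult_distrib L2_set_def sum_nonneg)
qed

lemma dim_span_image_eq_card:
  fixes \<Phi> :: "'k \<Rightarrow> 'a::euclidean_space"
  assumes "finite J" "\<eta> > 0"
    and low: "\<And>v. \<eta> * (\<Sum>j\<in>J. (v j)\<^sup>2) \<le> (norm (\<Sum>j\<in>J. v j *\<^sub>R \<Phi> j))\<^sup>2"
  shows "dim (span (\<Phi> ` J)) = card J"
proof -
  have zero: "v i = 0" if "(\<Sum>j\<in>J. v j *\<^sub>R \<Phi> j) = 0" "i \<in> J" for v i
  proof -
    have "\<eta> * (\<Sum>j\<in>J. (v j)\<^sup>2) \<le> 0" using low[of v] that by simp
    then have "(\<Sum>j\<in>J. (v j)\<^sup>2) \<le> 0" using assms(2) by (simp add: mult_le_0_iff)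
    then have "(\<Sum>j\<in>J. (v j)\<^sup>2) = 0" by (intro antisym sum_nonneg) auto
    then show ?thesis using that assms(1) by (auto simp: sum_nonneg_eq_0_iff)
  qed
  have inj: "inj_on \<Phi> J"
  proof (rule inj_onI, rule ccontr)
    fix i j assume ij: "i \<in> J" "j \<in> J" "\<Phi> i = \<Phi> j" "i \<noteq> j"
    let ?v = "\<lambda>l. (if l = i then 1 else 0) - (if l = j then 1 else (0::real))"
    have "(\<Sum>l\<in>J. ?v l *\<^sub>R \<Phi> l) = (\<Sum>l\<in>J. if l = i then \<Phi> i else 0) - (\<Sum>l\<in>J. if l = j then \<Phi> j else 0)"
      by (subst sum_subtractf[symmetric], rule sum.cong) (use ij(4) in auto)
    also have "\<dots> = 0" using ij assms(1) by simp
    finally have "?v i = 0" using ij(1) by (rule zero)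
    then show False using ij(4) by simp
  qed
  have "independent (\<Phi> ` J)"
  proof (rule independent_if_scalars_zero)
    fix f x assume "(\<Sum>x\<in>\<Phi> ` J. f x *\<^sub>R x) = 0" "x \<in> \<Phi> ` J"
    then show "f x = 0" using zero[of "f \<circ> \<Phi>"] inj by (auto simp: sum.reindex)
  qed (use assms in auto)
  then show ?thesis using inj by (simp add: dim_eq_card_independent card_image)
qed

text \<open>A unit vector in the span of the \<open>\<Phi>\<close> atoms has coefficients of squared
  norm at most \<open>1 / \<eta>\<close>, so by Cauchy-Schwarz its distance to the other span is
  governed by the sum of squared residuals. Residuals, rather than distances between atoms, are kept
  because the expected drop of the objective is expressed by them as well.\<close>

lemma proj_I_close_residual:
  fixes \<Phi> \<Psi> :: "'k \<Rightarrow> real^'d"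
  assumes "finite J" "\<eta> > 0" "0 \<le> \<theta>" "\<theta> < 1"
    and low: "\<And>v. \<eta> * (\<Sum>j\<in>J. (v j)\<^sup>2) \<le> (norm (\<Sum>j\<in>J. v j *\<^sub>R \<Phi> j))\<^sup>2"
    and res: "(\<Sum>j\<in>J. (norm (\<Phi> j - proj_I \<Psi> J (\<Phi> j)))\<^sup>2) \<le> \<eta> * \<theta>\<^sup>2"
  shows "norm (proj_I \<Phi> J y - proj_I \<Psi> J y) \<le> \<theta> * norm y"
  unfolding proj_I_def
proof (rule orth_proj_diff_le)
  have "dim (span (\<Psi> ` J)) \<le> card (\<Psi> ` J)" using assms(1) by (simp add: dim_le_card')
  also have "\<dots> \<le> card J" using assms(1) by (rule card_image_le)
  also have "\<dots> = dim (span (\<Phi> ` J))" using dim_span_image_eq_card[OF assms(1,2) low] by simp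
  finally show "dim (span (\<Psi> ` J)) \<le> dim (span (\<Phi> ` J))" .
  let ?R = "orth_proj (span (\<Psi> ` J))"
  fix u assume "u \<in> span (\<Phi> ` J)"
  then obtain v where v: "u = (\<Sum>j\<in>J. v j *\<^sub>R \<Phi> j)" using span_image_sum[OF assms(1)] by metis
  have lin: "linear ?R" by (rule linear_orth_proj) simp
  have "u - ?R u = (\<Sum>j\<in>J. v j *\<^sub>R (\<Phi> j - ?R (\<Phi> j)))"
    by (simp add: v linear_sum[OF lin] linear_cmul[OF lin] scaleR_diff_right sum_subtractf)
  then have "(norm (u - ?R u))\<^sup>2 \<le> (\<Sum>j\<in>J. (v j)\<^sup>2) * (\<Sum>j\<in>J. (norm (\<Phi> j - ?R (\<Phi> j)))\<^sup>2)"
    using norm_sum_scaleR_le by metis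
  also have "\<dots> \<le> (\<Sum>j\<in>J. (v j)\<^sup>2) * (\<eta> * \<theta>\<^sup>2)"
    using res unfolding proj_I_def by (intro mult_left_mono sum_nonneg) auto
  also have "\<dots> = (\<eta> * (\<Sum>j\<in>J. (v j)\<^sup>2)) * \<theta>\<^sup>2" by simp
  also have "\<dots> \<le> (norm u)\<^sup>2 * \<theta>\<^sup>2" using low[of v] v by (intro mult_right_mono) auto
  finally have "(norm (u - ?R u))\<^sup>2 \<le> (\<theta> * norm u)\<^sup>2" by (simp add: power_mult_distrib mult_ac)
  then show "norm (u - ?R u) \<le> \<theta> * norm u" by (rule power2_le_imp_le) (use assms in simp)
qed (use assms in auto)

lemma proj_I_residual_le:
  fixes \<Psi> :: "'k \<Rightarrow> real^'d"
  assumes "j \<in> J"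
  shows "norm (y - proj_I \<Psi> J y) \<le> norm (y - \<Psi> j)"
  unfolding proj_I_def by (rule orth_proj_nearest) (use assms in \<open>auto intro: span_base\<close>)

lemma proj_I_close:
  fixes \<Phi> \<Psi> :: "'k \<Rightarrow> real^'d"
  assumes "finite J" "\<eta> > 0" "0 \<le> \<theta>" "\<theta> < 1" "card J \<le> S" "0 \<le> \<rho>"
    and low: "\<And>v. \<eta> * (\<Sum>j\<in>J. (v j)\<^sup>2) \<le> (norm (\<Sum>j\<in>J. v j *\<^sub>R \<Phi> j))\<^sup>2"
    and d: "\<And>j. j \<in> J \<Longrightarrow> norm (\<Phi> j - \<Psi> j) \<le> \<rho>" and t: "real S * \<rho>\<^sup>2 \<le> \<eta> * \<theta>\<^sup>2"
  shows "norm (proj_I \<Phi> J y - proj_I \<Psi> J y) \<le> \<theta> * norm y"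
proof (rule proj_I_close_residual[OF assms(1-4) low])
  have "(\<Sum>j\<in>J. (norm (\<Phi> j - proj_I \<Psi> J (\<Phi> j)))\<^sup>2) \<le> (\<Sum>j\<in>J. \<rho>\<^sup>2)"
    using d proj_I_residual_le[of _ J] by (intro sum_mono power_mono) (blast intro: order_trans, simp)
  also have "\<dots> = real (card J) * \<rho>\<^sup>2" by simp
  also have "\<dots> \<le> real S * \<rho>\<^sup>2" using assms(5) by (intro mult_right_mono) auto
  finally show "(\<Sum>j\<in>J. (norm (\<Phi> j - proj_I \<Psi> J (\<Phi> j)))\<^sup>2) \<le> \<eta> * \<theta>\<^sup>2" using t by simp
qed

lemma proj_I_norm_sq_close:
  fixes \<Phi> \<Psi> :: "'k \<Rightarrow> real^'d"
  assumes "norm (proj_I \<Phi> J y - proj_I \<Psi> J y) \<le> \<theta> * norm y"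
  shows "\<bar>(norm (proj_I \<Phi> J y))\<^sup>2 - (norm (proj_I \<Psi> J y))\<^sup>2\<bar> \<le> \<theta> * (norm y)\<^sup>2"
proof -
  have "(norm (proj_I \<Phi> J y))\<^sup>2 - (norm (proj_I \<Psi> J y))\<^sup>2 = (proj_I \<Phi> J y - proj_I \<Psi> J y) \<bullet> y"
    unfolding proj_I_def by (simp add: norm_orth_proj_sq inner_diff_left)
  also have "\<bar>\<dots>\<bar> \<le> norm (proj_I \<Phi> J y - proj_I \<Psi> J y) * norm y" by (rule Cauchy_Schwarz_ineq2)
  also have "\<dots> \<le> (\<theta> * norm y) * norm y" using assms by (intro mult_right_mono) auto
  finally show ?thesis by (simp add: power2_eq_square)
qed

text \<open>A coefficient vector of norm one is moved by at most \<open>sqrt S * \<rho>\<close>, so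
  half of the smallest singular value survives. This makes the perturbation bounds available between
  two dictionaries that are both merely close to \<open>\<Phi>\<close>.\<close>

lemma norm_lower_bound_perturb:
  fixes \<Phi> \<Psi> :: "'k \<Rightarrow> 'a::real_normed_vector"
  assumes "finite J" "0 \<le> \<alpha>" "card J \<le> S" "0 \<le> \<rho>" "sqrt (real S) * \<rho> \<le> \<alpha> / 2"
    and low: "\<And>v. \<alpha>\<^sup>2 * (\<Sum>j\<in>J. (v j)\<^sup>2) \<le> (norm (\<Sum>j\<in>J. v j *\<^sub>R \<Phi> j))\<^sup>2"
    and d: "\<And>j. j \<in> J \<Longrightarrow> norm (\<Phi> j - \<Psi> j) \<le> \<rho>"
  shows "(\<alpha> / 2)\<^sup>2 * (\<Sum>j\<in>J. (v j)\<^sup>2) \<le> (norm (\<Sum>j\<in>J. v j *\<^sub>R \<Psi> j))\<^sup>2"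
proof -
  let ?n = "sqrt (\<Sum>j\<in>J. (v j)\<^sup>2)"
  have n: "?n\<^sup>2 = (\<Sum>j\<in>J. (v j)\<^sup>2)" by (simp add: sum_nonneg)
  have n0: "0 \<le> ?n" by (simp add: sum_nonneg)
  have 1: "\<alpha> * ?n \<le> norm (\<Sum>j\<in>J. v j *\<^sub>R \<Phi> j)"
    by (rule power2_le_imp_le) (use low[of v] n in \<open>simp_all add: power_mult_distrib\<close>)
  have "(norm (\<Sum>j\<in>J. v j *\<^sub>R (\<Phi> j - \<Psi> j)))\<^sup>2 \<le> ?n\<^sup>2 * (\<Sum>j\<in>J. (norm (\<Phi> j - \<Psi> j))\<^sup>2)"
    unfolding n by (rule norm_sum_scaleR_le)
  also have "\<dots> \<le> ?n\<^sup>2 * (\<Sum>j\<in>J. \<rho>\<^sup>2)" using d by (intro mult_left_mono sum_mono power_mono) auto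
  also have "\<dots> \<le> ?n\<^sup>2 * (real S * \<rho>\<^sup>2)" using assms(3) by (intro mult_left_mono) (auto intro: mult_right_mono)
  also have "\<dots> = (sqrt (real S) * \<rho> * ?n)\<^sup>2" by (simp add: power_mult_distrib)
  finally have "norm (\<Sum>j\<in>J. v j *\<^sub>R (\<Phi> j - \<Psi> j)) \<le> sqrt (real S) * \<rho> * ?n"
    by (rule power2_le_imp_le) (use assms n0 in simp)
  also have "\<dots> \<le> \<alpha> / 2 * ?n" using assms(5) n0 by (rule mult_right_mono)
  finally have 2: "norm (\<Sum>j\<in>J. v j *\<^sub>R (\<Phi> j - \<Psi> j)) \<le> \<alpha> / 2 * ?n" .
  have "(\<Sum>j\<in>J. v j *\<^sub>R \<Phi> j) = (\<Sum>j\<in>J. v j *\<^sub>R \<Psi> j) + (\<Sum>j\<in>J. v j *\<^sub>R (\<Phi> j - \<Psi> j))"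
    by (simp add: scaleR_diff_right sum_subtractf)
  then have "norm (\<Sum>j\<in>J. v j *\<^sub>R \<Phi> j) \<le> norm (\<Sum>j\<in>J. v j *\<^sub>R \<Psi> j) + norm (\<Sum>j\<in>J. v j *\<^sub>R (\<Phi> j - \<Psi> j))"
    by (metis norm_triangle_ineq)
  with 1 2 have "\<alpha> / 2 * ?n \<le> norm (\<Sum>j\<in>J. v j *\<^sub>R \<Psi> j)" by simp
  then have "(\<alpha> / 2 * ?n)\<^sup>2 \<le> (norm (\<Sum>j\<in>J. v j *\<^sub>R \<Psi> j))\<^sup>2"
    using assms n0 by (intro power_mono) auto
  then show ?thesis unfolding power_mult_distrib n .
qed

section \<open>Tight frames and the lower isometry constant\<close>

lemma tight_frame_trace:
  fixes \<Phi> :: "'k::finite \<Rightarrow> real^'d"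
  assumes "unit_norm_tight_frame \<Phi> A" "subspace V"
  shows "(\<Sum>i\<in>UNIV. (norm (orth_proj V (\<Phi> i)))\<^sup>2) = A * real (dim V)"
proof -
  obtain B where B: "B \<subseteq> V" "pairwise orthogonal B" "\<And>x. x \<in> B \<Longrightarrow> norm x = 1"
    "independent B" "card B = dim V" "span B = V"
    using orthonormal_basis_subspace[OF assms(2)] by metis
  then have fin: "finite B" by (simp add: independent_imp_finite)
  \<comment> \<open>This is the trace of the projection composed with the frame operator, which is
    \<open>A\<close> times the identity; an orthonormal basis of \<open>V\<close> evaluates
    it.\<close>
  have "(\<Sum>i\<in>UNIV. (norm (orth_proj V (\<Phi> i)))\<^sup>2) = (\<Sum>i\<in>UNIV. \<Sum>b\<in>B. (b \<bullet> \<Phi> i)\<^sup>2)"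
    using orth_proj_orthonormal[OF assms(2) B(6,2,3) fin] by simp
  also have "\<dots> = (\<Sum>b\<in>B. \<Sum>i\<in>UNIV. (\<Phi> i \<bullet> b)\<^sup>2)"
    by (subst sum.swap) (simp add: inner_commute)
  also have "\<dots> = (\<Sum>b\<in>B. A)"
    using assms(1) B(3) unfolding unit_norm_tight_frame_def by (intro sum.cong) auto
  finally show ?thesis using B(5) by simp
qed

lemma tight_frame_synth_le:
  fixes \<Phi> :: "'k::finite \<Rightarrow> real^'d"
  assumes "unit_norm_tight_frame \<Phi> A" "0 \<le> A"
  shows "(norm (synth \<Phi> x))\<^sup>2 \<le> A * (norm x)\<^sup>2"
proof -
  let ?y = "synth \<Phi> x"
  have "(norm ?y)\<^sup>2 = (\<Sum>i\<in>UNIV. x $ i * (\<Phi> i \<bullet> ?y))"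
    by (subst (2) synth_def) (simp add: power2_norm_eq_inner inner_sum_left synth_def)
  also have "\<dots> \<le> (\<Sum>i\<in>UNIV. \<bar>x $ i\<bar> * \<bar>\<Phi> i \<bullet> ?y\<bar>)"
    by (intro sum_mono) (metis abs_ge_self abs_mult)
  also have "\<dots> \<le> L2_set (($) x) UNIV * L2_set (\<lambda>i. \<Phi> i \<bullet> ?y) UNIV" by (rule L2_set_mult_ineq)
  also have "L2_set (\<lambda>i. \<Phi> i \<bullet> ?y) UNIV = sqrt A * norm ?y"
    using assms unfolding unit_norm_tight_frame_def L2_set_def by (simp add: real_sqrt_mult)
  also have "L2_set (($) x) UNIV = norm x" by (simp add: norm_vec_def L2_set_def)
  finally have "norm ?y * norm ?y \<le> (norm x * sqrt A) * norm ?y" by (simp add: power2_eq_square)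
  then have "norm ?y \<le> norm x * sqrt A"
    using assms(2) by (cases "norm ?y = 0") auto
  then have "(norm ?y)\<^sup>2 \<le> (norm x * sqrt A)\<^sup>2" by (intro power_mono) auto
  then show ?thesis using assms(2) by (simp add: power_mult_distrib mult_ac)
qed

lemma tight_frame_const_ge_1:
  fixes \<Phi> :: "'k::finite \<Rightarrow> real^'d"
  assumes "unit_norm_tight_frame \<Phi> A"
  shows "1 \<le> A"
proof -
  fix k :: 'k
  have "(\<Phi> k \<bullet> \<Phi> k)\<^sup>2 \<le> (\<Sum>i\<in>UNIV. (\<Phi> i \<bullet> \<Phi> k)\<^sup>2)"
    by (rule member_le_sum[of k UNIV "\<lambda>i. (\<Phi> i \<bullet> \<Phi> k)\<^sup>2"]) auto
  then show ?thesis
    using assms by (simp add: unit_norm_tight_frame_def power2_norm_eq_inner[symmetric])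
qed

lemma lower_isometry_bound:
  fixes \<Phi> :: "'k::finite \<Rightarrow> real^'d"
  assumes "card J \<le> S"
  shows "(1 - lower_isometry_const \<Phi> S) * (\<Sum>j\<in>J. (v j)\<^sup>2) \<le> (norm (\<Sum>j\<in>J. v j *\<^sub>R \<Phi> j))\<^sup>2"
proof (cases "(\<Sum>j\<in>J. (v j)\<^sup>2) = 0")
  case False
  let ?n = "\<Sum>j\<in>J. (v j)\<^sup>2"
  have n: "?n > 0" using False sum_nonneg[of J "\<lambda>j. (v j)\<^sup>2"] by (simp add: less_le)
  then have "J \<noteq> {}" by auto
  have "1 - lambda_min \<Phi> J \<le> lower_isometry_const \<Phi> S"
    unfolding lower_isometry_const_def
  proof (rule Max_ge)
    have "{1 - lambda_min \<Phi> I | I. I \<noteq> {} \<and> card I \<le> S} \<subseteq> (\<lambda>I. 1 - lambda_min \<Phi> I) ` UNIV" by auto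
    then show "finite {1 - lambda_min \<Phi> I | I. I \<noteq> {} \<and> card I \<le> S}" by (rule finite_subset) simp
  qed (use assms \<open>J \<noteq> {}\<close> in auto)
  moreover have "lambda_min \<Phi> J \<le> (norm (\<Sum>j\<in>J. (v j / sqrt ?n) *\<^sub>R \<Phi> j))\<^sup>2"
    unfolding lambda_min_def
  proof (rule cInf_lower)
    have "(\<Sum>j\<in>J. (v j / sqrt ?n)\<^sup>2) = (\<Sum>j\<in>J. (v j)\<^sup>2 / ?n)"
      using n by (intro sum.cong) (auto simp: power_divide)
    also have "\<dots> = 1" using n by (simp flip: sum_divide_distrib)
    finally show "(norm (\<Sum>j\<in>J. (v j / sqrt ?n) *\<^sub>R \<Phi> j))\<^sup>2 \<in>
        {(norm (\<Sum>i\<in>J. v i *\<^sub>R \<Phi> i))\<^sup>2 |v. (\<Sum>i\<in>J. (v i)\<^sup>2) = 1}" by (intro CollectI exI conjI) auto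
  qed (auto intro!: bdd_belowI[of _ 0])
  moreover have "(\<Sum>j\<in>J. (v j / sqrt ?n) *\<^sub>R \<Phi> j) = (1 / sqrt ?n) *\<^sub>R (\<Sum>j\<in>J. v j *\<^sub>R \<Phi> j)"
    by (simp add: scaleR_sum_right)
  ultimately have "1 - lower_isometry_const \<Phi> S \<le> (norm (\<Sum>j\<in>J. v j *\<^sub>R \<Phi> j))\<^sup>2 / ?n"
    using n by (simp add: power_divide)
  then show ?thesis using n by (simp add: field_simps)
qed simp

lemma lower_isometry_const_le:
  fixes \<Phi> :: "'k::finite \<Rightarrow> real^'d"
  assumes "1 \<le> S"
    and low: "\<And>J v. J \<noteq> {} \<Longrightarrow> card J \<le> S \<Longrightarrow> \<eta> * (\<Sum>j\<in>J. (v j)\<^sup>2) \<le> (norm (\<Sum>j\<in>J. v j *\<^sub>R \<Phi> j))\<^sup>2"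
  shows "\<eta> \<le> 1 - lower_isometry_const \<Phi> S"
proof -
  let ?L = "{1 - lambda_min \<Phi> I | I. I \<noteq> {} \<and> card I \<le> S}"
  have "?L \<subseteq> (\<lambda>I. 1 - lambda_min \<Phi> I) ` UNIV" by auto
  then have fin: "finite ?L" by (rule finite_subset) simp
  \<comment> \<open>A singleton index set, admissible because \<open>1 \<le> S\<close>, keeps
    \<open>Max\<close> from being applied to the empty set.\<close>
  have "card {undefined::'k} \<le> S" using assms by simp
  then have ne: "?L \<noteq> {}" by blast
  have "lower_isometry_const \<Phi> S \<in> ?L"
    unfolding lower_isometry_const_def by (rule Max_in[OF fin ne])
  then obtain J where J: "J \<noteq> {}" "card J \<le> S" "lower_isometry_const \<Phi> S = 1 - lambda_min \<Phi> J"
    by auto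
  have "\<eta> \<le> lambda_min \<Phi> J"
    unfolding lambda_min_def
  proof (rule cInf_greatest)
    obtain i where "i \<in> J" using J by auto
    then have "(\<Sum>j\<in>J. (if j = i then 1 else (0::real))\<^sup>2) = 1"
      by (subst sum.remove[of _ i]) auto
    then show "{(norm (\<Sum>i\<in>J. v i *\<^sub>R \<Phi> i))\<^sup>2 |v. (\<Sum>i\<in>J. (v i)\<^sup>2) = 1} \<noteq> {}"
      unfolding ex_in_conv[symmetric] mem_Collect_eq
      by (intro exI[of _ "\<lambda>j. if j = i then 1 else 0"] exI conjI) (rule refl)
  next
    fix x assume "x \<in> {(norm (\<Sum>i\<in>J. v i *\<^sub>R \<Phi> i))\<^sup>2 |v. (\<Sum>i\<in>J. (v i)\<^sup>2) = 1}"
    then obtain v where "x = (norm (\<Sum>i\<in>J. v i *\<^sub>R \<Phi> i))\<^sup>2" "(\<Sum>i\<in>J. (v i)\<^sup>2) = 1" by auto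
    then show "\<eta> \<le> x" using low[OF J(1,2), of v] by simp
  qed
  then show ?thesis using J by simp
qed

lemma lower_isometry_const_bounds:
  fixes \<Phi> :: "'k::finite \<Rightarrow> real^'d"
  assumes "1 \<le> S" "\<And>i. norm (\<Phi> i) = 1"
  shows "0 \<le> lower_isometry_const \<Phi> S" "lower_isometry_const \<Phi> S \<le> 1"
proof -
  fix i :: 'k
  show "0 \<le> lower_isometry_const \<Phi> S"
    using lower_isometry_bound[of "{i}" S \<Phi> "\<lambda>_. 1"] assms by simp
  show "lower_isometry_const \<Phi> S \<le> 1"
    using lower_isometry_const_le[OF assms(1), of 0 \<Phi>] by simp
qed

section \<open>Random signs\<close>

text \<open>A sign pattern is encoded by the set of its negative positions, so that averages over
  signs are sums over a power set and yield to induction on finite sets.\<close>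

definition flip :: "'k set \<Rightarrow> 'k \<Rightarrow> real" where
  "flip U i = (if i \<in> U then -1 else 1)"

lemma sum_Pow_insert:
  assumes "finite T" "b \<notin> T"
  shows "(\<Sum>U\<in>Pow (insert b T). f U) = (\<Sum>U\<in>Pow T. f U) + (\<Sum>U\<in>Pow T. f (insert b U))"
proof -
  have "Pow T \<inter> insert b ` Pow T = {}" using assms by auto
  moreover have "inj_on (insert b) (Pow T)" using assms by (auto simp: inj_on_def)
  ultimately show ?thesis
    using assms by (simp add: Pow_insert sum.union_disjoint sum.reindex)
qed

lemma sum_flip_insert:
  fixes v :: "'k \<Rightarrow> 'a::real_vector"
  assumes "finite T" "b \<notin> T" "U \<subseteq> T"
  shows "(\<Sum>j\<in>insert b T. flip U j *\<^sub>R v j) = v b + (\<Sum>j\<in>T. flip U j *\<^sub>R v j)"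
    and "(\<Sum>j\<in>insert b T. flip (insert b U) j *\<^sub>R v j) = - v b + (\<Sum>j\<in>T. flip U j *\<^sub>R v j)"
proof -
  have "b \<notin> U" using assms by auto
  then show "(\<Sum>j\<in>insert b T. flip U j *\<^sub>R v j) = v b + (\<Sum>j\<in>T. flip U j *\<^sub>R v j)"
    using assms by (simp add: flip_def)
  have "(\<Sum>j\<in>T. flip (insert b U) j *\<^sub>R v j) = (\<Sum>j\<in>T. flip U j *\<^sub>R v j)"
    using assms by (intro sum.cong) (auto simp: flip_def)
  then show "(\<Sum>j\<in>insert b T. flip (insert b U) j *\<^sub>R v j) = - v b + (\<Sum>j\<in>T. flip U j *\<^sub>R v j)"
    using assms by (simp add: flip_def)
qed

text \<open>Conditioning on the sign of \<open>b\<close>: the signed summand is absorbed by the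
  offset \<open>a\<close>, which is why the inductions below keep \<open>a\<close>
  arbitrary.\<close>

lemma sum_Pow_flip_insert:
  fixes v :: "'k \<Rightarrow> 'a::real_vector"
  assumes "finite T" "b \<notin> T"
  shows "(\<Sum>U\<in>Pow (insert b T). h (a + (\<Sum>j\<in>insert b T. flip U j *\<^sub>R v j))) =
    (\<Sum>U\<in>Pow T. h ((a + v b) + (\<Sum>j\<in>T. flip U j *\<^sub>R v j))) +
    (\<Sum>U\<in>Pow T. h ((a - v b) + (\<Sum>j\<in>T. flip U j *\<^sub>R v j)))"
proof -
  have "(\<Sum>U\<in>Pow T. h (a + (\<Sum>j\<in>insert b T. flip U j *\<^sub>R v j)))
      = (\<Sum>U\<in>Pow T. h ((a + v b) + (\<Sum>j\<in>T. flip U j *\<^sub>R v j)))"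
    using sum_flip_insert(1)[OF assms, of _ v] by (intro sum.cong) (simp_all add: add.assoc)
  moreover have "(\<Sum>U\<in>Pow T. h (a + (\<Sum>j\<in>insert b T. flip (insert b U) j *\<^sub>R v j)))
      = (\<Sum>U\<in>Pow T. h ((a - v b) + (\<Sum>j\<in>T. flip U j *\<^sub>R v j)))"
    by (intro sum.cong) (auto simp: sum_flip_insert(2)[OF assms] diff_add_eq add_diff_eq)
  ultimately show ?thesis unfolding sum_Pow_insert[OF assms] by simp
qed

text \<open>The parallelogram law cancels the cross terms, one sign at a time.\<close>

lemma sum_flip_norm_sq:
  fixes v :: "'k \<Rightarrow> 'a::real_inner"
  assumes "finite T"
  shows "(\<Sum>U\<in>Pow T. (norm (a + (\<Sum>j\<in>T. flip U j *\<^sub>R v j)))\<^sup>2) =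
    2 ^ card T * ((norm a)\<^sup>2 + (\<Sum>j\<in>T. (norm (v j))\<^sup>2))"
  using assms
proof (induction T arbitrary: a)
  case (insert b T)
  have "(norm (a + v b))\<^sup>2 + (norm (a - v b))\<^sup>2 = 2 * (norm a)\<^sup>2 + 2 * (norm (v b))\<^sup>2"
    by (simp add: power2_norm_eq_inner inner_diff_left inner_diff_right inner_add_left inner_add_right)
  then have "(2::real) ^ card T * ((norm (a + v b))\<^sup>2 + (norm (a - v b))\<^sup>2)
    = 2 ^ card T * (2 * (norm a)\<^sup>2 + 2 * (norm (v b))\<^sup>2)" by simp
  then show ?case
    unfolding sum_Pow_flip_insert[OF insert.hyps, of "\<lambda>x. (norm x)\<^sup>2"] insert.IH
    using insert.hyps by (simp add: algebra_simps)
qed simp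

text \<open>This is \<open>cosh x \<le> exp (x\<^sup>2 / 2)\<close>, read off from the inequality
  behind Hoeffding's lemma for the symmetric two-point distribution.\<close>

lemma exp_add_exp_minus_le:
  fixes x :: real
  shows "exp x + exp (- x) \<le> 2 * exp (x\<^sup>2 / 2)"
proof -
  have pos: "exp x + exp (- x) \<le> 2 * exp (x\<^sup>2 / 2)" if "0 \<le> x" for x :: real
  proof -
    have "ln ((1 + exp (2 * x)) / 2) \<le> x + x\<^sup>2 / 2"
      using Hoeffdings_lemma_aux[of "2 * x" "1 / 2"] that by (simp add: field_simps)
    then have "exp (ln ((1 + exp (2 * x)) / 2)) \<le> exp (x + x\<^sup>2 / 2)" by simp
    moreover have "0 < (1 + exp (2 * x)) / 2" by (simp add: add_pos_pos)
    ultimately have "(1 + exp (2 * x)) / 2 \<le> exp (x + x\<^sup>2 / 2)" by (simp only: exp_ln)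
    then have "exp (- x) * ((1 + exp (2 * x)) / 2) \<le> exp (- x) * exp (x + x\<^sup>2 / 2)" by simp
    then show ?thesis by (simp add: distrib_left flip: exp_add)
  qed
  show ?thesis using pos[of x] pos[of "- x"] by (cases "0 \<le> x") auto
qed

text \<open>In the induction, the reciprocal of the exponent drops by twice the squared norm of the new
  summand.\<close>

lemma sum_flip_exp_norm_sq_le:
  fixes v :: "'k \<Rightarrow> 'a::real_inner"
  assumes "finite T" "0 < s" "2 * s * (\<Sum>j\<in>T. (norm (v j))\<^sup>2) < 1"
  shows "(\<Sum>U\<in>Pow T. exp (s * (norm (a + (\<Sum>j\<in>T. flip U j *\<^sub>R v j)))\<^sup>2)) \<le>
    2 ^ card T * exp (s / (1 - 2 * s * (\<Sum>j\<in>T. (norm (v j))\<^sup>2)) * ((norm a)\<^sup>2 + (\<Sum>j\<in>T. (norm (v j))\<^sup>2)))"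
  using assms(1,3)
proof (induction T arbitrary: a)
  case (insert b T)
  define w where "w = (\<Sum>j\<in>T. (norm (v j))\<^sup>2)"
  define \<beta> where "\<beta> = (norm (v b))\<^sup>2"
  define s1 where "s1 = s / (1 - 2 * s * w)"
  define s2 where "s2 = s / (1 - 2 * s * (\<beta> + w))"
  have w0: "0 \<le> w" "0 \<le> \<beta>" by (auto simp: w_def \<beta>_def sum_nonneg)
  have lt: "2 * s * (\<beta> + w) < 1" using insert.prems insert.hyps by (simp add: w_def \<beta>_def)
  have "2 * s * w \<le> 2 * s * (\<beta> + w)" using w0 assms(2) by (intro mult_left_mono) auto
  then have lt': "2 * s * w < 1" using lt by linarith
  have s1: "0 < s1" using lt' assms(2) by (simp add: s1_def)
  \<comment> \<open>Since \<open>1 / s2 = 1 / s1 - 2 * \<beta>\<close>, this is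
    \<open>1 + u \<le> 1 / (1 - u)\<close> for \<open>u = 2 * s1 * \<beta>\<close>.\<close>
  have inc: "s1 + 2 * s1\<^sup>2 * \<beta> \<le> s2"
  proof -
    have d: "0 < 1 - 2 * s * w" "0 < 1 - 2 * s * (\<beta> + w)" using lt lt' by auto
    have e: "1 - 2 * s * (\<beta> + w) = (1 - 2 * s * w) * (1 - 2 * s1 * \<beta>)"
      using d by (simp add: s1_def field_simps)
    then have d1: "0 < 1 - 2 * s1 * \<beta>" using d by (simp add: zero_less_mult_iff)
    have s2: "s2 = s1 / (1 - 2 * s1 * \<beta>)" unfolding s2_def s1_def e by simp
    have "(s1 + 2 * s1\<^sup>2 * \<beta>) * (1 - 2 * s1 * \<beta>) = s1 - s1 * (2 * s1 * \<beta>)\<^sup>2"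
      by (simp add: algebra_simps power2_eq_square)
    also have "\<dots> \<le> s1" using s1 by simp
    finally show ?thesis unfolding s2 using d1 by (simp add: pos_le_divide_eq)
  qed
  let ?g = "\<lambda>u. exp (s1 * ((norm u)\<^sup>2 + w))"
  have IH: "(\<Sum>U\<in>Pow T. exp (s * (norm (u + (\<Sum>j\<in>T. flip U j *\<^sub>R v j)))\<^sup>2)) \<le> 2 ^ card T * ?g u" for u
    using insert.IH[of u] lt' by (simp add: w_def s1_def)
  have "?g (a + v b) + ?g (a - v b)
    = exp (s1 * ((norm a)\<^sup>2 + \<beta> + w)) * (exp (2 * s1 * (a \<bullet> v b)) + exp (- (2 * s1 * (a \<bullet> v b))))"
    by (simp add: \<beta>_def power2_norm_eq_inner inner_diff_left inner_diff_right inner_add_left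
        inner_add_right inner_commute distrib_left right_diff_distrib flip: exp_add)
      (simp add: algebra_simps)
  also have "\<dots> \<le> exp (s1 * ((norm a)\<^sup>2 + \<beta> + w)) * (2 * exp ((2 * s1 * (a \<bullet> v b))\<^sup>2 / 2))"
    by (intro mult_left_mono exp_add_exp_minus_le) auto
  also have "\<dots> \<le> exp (s1 * ((norm a)\<^sup>2 + \<beta> + w)) * (2 * exp (2 * s1\<^sup>2 * \<beta> * (norm a)\<^sup>2))"
  proof -
    have "(a \<bullet> v b)\<^sup>2 \<le> (norm a)\<^sup>2 * \<beta>"
      using Cauchy_Schwarz_ineq[of a "v b"] by (simp add: \<beta>_def power2_norm_eq_inner)
    then have "2 * s1\<^sup>2 * (a \<bullet> v b)\<^sup>2 \<le> 2 * s1\<^sup>2 * ((norm a)\<^sup>2 * \<beta>)" by (intro mult_left_mono) auto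
    then show ?thesis by (simp add: power_mult_distrib mult_ac)
  qed
  also have "\<dots> = 2 * exp ((s1 + 2 * s1\<^sup>2 * \<beta>) * (norm a)\<^sup>2 + s1 * (\<beta> + w))"
    by (simp add: algebra_simps flip: exp_add)
  also have "\<dots> \<le> 2 * exp (s2 * ((norm a)\<^sup>2 + (\<beta> + w)))"
  proof -
    have "s1 \<le> s2" using inc w0 zero_le_power2[of s1] mult_nonneg_nonneg[of "2 * s1\<^sup>2" \<beta>] by linarith
    then show ?thesis using w0 mult_right_mono[OF inc, of "(norm a)\<^sup>2"] mult_right_mono[of s1 s2 "\<beta> + w"]
      by (simp add: distrib_left)
  qed
  finally have step: "?g (a + v b) + ?g (a - v b) \<le> 2 * exp (s2 * ((norm a)\<^sup>2 + (\<beta> + w)))" .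
  have "(\<Sum>U\<in>Pow (insert b T). exp (s * (norm (a + (\<Sum>j\<in>insert b T. flip U j *\<^sub>R v j)))\<^sup>2))
      \<le> 2 ^ card T * (?g (a + v b) + ?g (a - v b))"
    unfolding sum_Pow_flip_insert[OF insert.hyps, of "\<lambda>x. exp (s * (norm x)\<^sup>2)"]
    using IH[of "a + v b"] IH[of "a - v b"] by (simp add: distrib_left[of "2 ^ card T"])
  also have "\<dots> \<le> 2 ^ card T * (2 * exp (s2 * ((norm a)\<^sup>2 + (\<beta> + w))))"
    using step by (intro mult_left_mono) auto
  finally show ?case using insert.hyps by (simp add: w_def \<beta>_def s2_def)
qed simp

section \<open>Consequences of the gap condition\<close>

text \<open>The sorting permutation, applied to the position of an index in the chosen enumeration,
  is its rank. List positions start at 0 and ranks at 1, hence the \<open>Suc\<close>.\<close>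

lemma rearr_ranking:
  fixes x :: "real^'k::finite"
  obtains p where "bij_betw p UNIV {1..CARD('k)}" "\<And>i. rearr x (p i) = \<bar>x $ i\<bar>"
proof -
  define xs where "xs = (SOME xs. distinct xs \<and> set xs = (UNIV::'k set))"
  have xs: "distinct xs" "set xs = UNIV"
    unfolding xs_def using someI_ex[of "\<lambda>xs. distinct xs \<and> set xs = (UNIV::'k set)"]
      finite_distinct_list[of "UNIV::'k set"] by auto
  then have len: "length xs = CARD('k)" by (metis distinct_card)
  define f where "f = (\<lambda>i. \<bar>x $ i\<bar>)"
  define ys where "ys = rev (sort (map f xs))"
  have "mset (map f xs) = mset ys" by (simp add: ys_def)
  then obtain \<pi> where pi: "\<pi> permutes {..<length ys}" "permute_list \<pi> ys = map f xs"
    using mset_eq_permutation by metis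
  have ly: "length ys = CARD('k)" by (simp add: ys_def len)
  have bx: "bij_betw ((!) xs) {..<CARD('k)} UNIV"
    using bij_betw_nth[OF xs(1), of "{..<CARD('k)}" UNIV] xs len by auto
  define g where "g = inv_into {..<CARD('k)} ((!) xs)"
  have bg: "bij_betw g UNIV {..<CARD('k)}" unfolding g_def by (rule bij_betw_inv_into[OF bx])
  have xg: "xs ! g i = i" for i unfolding g_def using bij_betw_inv_into_right[OF bx] by simp
  have "bij_betw (\<pi> \<circ> g) UNIV {..<CARD('k)}"
    using bij_betw_trans[OF bg] pi(1) permutes_imp_bij ly by metis
  then have b: "bij_betw (Suc \<circ> (\<pi> \<circ> g)) UNIV {1..CARD('k)}"
    by (rule bij_betw_trans) (auto simp: bij_betw_def image_Suc_lessThan)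
  have "rearr x ((Suc \<circ> (\<pi> \<circ> g)) i) = \<bar>x $ i\<bar>" for i
  proof -
    have gi: "g i < CARD('k)" using bg by (auto simp: bij_betw_def)
    have "rearr x (Suc (\<pi> (g i))) = ys ! \<pi> (g i)"
      unfolding rearr_def ys_def f_def xs_def by simp
    also have "\<dots> = permute_list \<pi> ys ! g i"
      using pi(1) gi ly by (simp add: permute_list_nth)
    also have "\<dots> = f i" using gi len by (simp add: pi(2) xg)
    finally show ?thesis by (simp add: f_def)
  qed
  with b that show thesis by blast
qed

lemma rearr_antimono:
  fixes x :: "real^'k::finite"
  assumes "1 \<le> i" "i \<le> j" "j \<le> CARD('k)"
  shows "rearr x j \<le> rearr x i"
proof -
  define xs where "xs = (SOME xs. distinct xs \<and> set xs = (UNIV::'k set))"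
  have xs: "distinct xs" "set xs = UNIV"
    unfolding xs_def using someI_ex[of "\<lambda>xs. distinct xs \<and> set xs = (UNIV::'k set)"]
      finite_distinct_list[of "UNIV::'k set"] by auto
  then have len: "length xs = CARD('k)" by (metis distinct_card)
  let ?zs = "sort (map (\<lambda>i. \<bar>x $ i\<bar>) xs)"
  have "rev ?zs ! (j - 1) \<le> rev ?zs ! (i - 1)"
    using assms len by (simp add: rev_nth) (intro sorted_nth_mono, auto)
  then show ?thesis unfolding rearr_def xs_def .
qed

lemma
  fixes x :: "real^'k::finite"
  shows rearr_nonneg: "1 \<le> j \<Longrightarrow> j \<le> CARD('k) \<Longrightarrow> 0 \<le> rearr x j"
    and sum_rearr_sq: "(\<Sum>j=1..CARD('k). (rearr x j)\<^sup>2) = (norm x)\<^sup>2"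
proof -
  obtain p where p: "bij_betw p UNIV {1..CARD('k)}" "\<And>i. rearr x (p i) = \<bar>x $ i\<bar>"
    using rearr_ranking by blast
  show "0 \<le> rearr x j" if "1 \<le> j" "j \<le> CARD('k)"
  proof -
    have "j \<in> p ` UNIV" using p(1) that by (auto simp: bij_betw_def)
    then show ?thesis using p(2) by auto
  qed
  show "(\<Sum>j=1..CARD('k). (rearr x j)\<^sup>2) = (norm x)\<^sup>2"
    unfolding sum.reindex_bij_betw[OF p(1), of "\<lambda>j. (rearr x j)\<^sup>2", symmetric]
    unfolding power2_norm_eq_inner inner_vec_def by (simp add: p(2) power2_eq_square)
qed

text \<open>The event of the gap assumption at one point. Because all rankings and signs are
  quantified, it depends on \<open>x\<close> only through \<open>rearr x\<close>, and a single point
  speaks about every support of size \<open>S\<close>.\<close>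

definition gap_at :: "('k::finite \<Rightarrow> real^'d) \<Rightarrow> nat \<Rightarrow> real \<Rightarrow> real^'k \<Rightarrow> bool" where
  "gap_at \<Phi> S \<kappa> x \<longleftrightarrow>
    (\<forall>p \<sigma>. bij_betw p (UNIV::'k set) {1..CARD('k)} \<and> (\<forall>i. \<sigma> i \<in> {-1, 1}) \<longrightarrow>
      (\<forall>I. card I \<le> S \<and> I \<noteq> {i. p i \<le> S} \<longrightarrow>
        norm (proj_I \<Phi> {i. p i \<le> S} (synth \<Phi> (rearr_ps p \<sigma> x)))
        - norm (proj_I \<Phi> I (synth \<Phi> (rearr_ps p \<sigma> x))) \<ge> 2 * \<kappa>))"

lemma linear_proj_I: "linear (proj_I \<Psi> I)"
proof -
  have "proj_I \<Psi> I = orth_proj (span (\<Psi> ` I))" by (rule ext) (simp add: proj_I_def)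
  then show ?thesis by (simp add: linear_orth_proj)
qed

lemma sum_flip_proj_synth:
  fixes \<Phi> \<Psi> :: "'k::finite \<Rightarrow> real^'d"
  shows "(\<Sum>U\<in>UNIV. (norm (proj_I \<Psi> J (synth \<Phi> (\<chi> i. flip U i * c i))))\<^sup>2) =
    2 ^ CARD('k) * (\<Sum>i\<in>UNIV. (c i)\<^sup>2 * (norm (proj_I \<Psi> J (\<Phi> i)))\<^sup>2)"
proof -
  have "proj_I \<Psi> J (synth \<Phi> (\<chi> i. flip U i * c i)) = 0 + (\<Sum>i\<in>UNIV. flip U i *\<^sub>R proj_I \<Psi> J (c i *\<^sub>R \<Phi> i))" for U
    by (simp add: synth_def linear_sum[OF linear_proj_I] linear_cmul[OF linear_proj_I])
  then have "(\<Sum>U\<in>UNIV. (norm (proj_I \<Psi> J (synth \<Phi> (\<chi> i. flip U i * c i))))\<^sup>2) =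
    (\<Sum>U\<in>Pow UNIV. (norm (0 + (\<Sum>i\<in>UNIV. flip U i *\<^sub>R proj_I \<Psi> J (c i *\<^sub>R \<Phi> i))))\<^sup>2)"
    by simp
  also have "\<dots> = 2 ^ CARD('k) * ((norm (0::real^'d))\<^sup>2 + (\<Sum>i\<in>UNIV. (norm (proj_I \<Psi> J (c i *\<^sub>R \<Phi> i)))\<^sup>2))"
    by (rule sum_flip_norm_sq) simp
  finally show ?thesis by (simp add: linear_cmul[OF linear_proj_I] power_mult_distrib)
qed

text \<open>For each sign pattern, squaring \<open>b + 2 * \<kappa> \<le> a\<close> leaves at least
  \<open>4 * \<kappa>\<^sup>2\<close>. Averaging over the signs then removes all products of
  different atoms, so that only projections of single atoms remain.\<close>

lemma gap_at_average:
  fixes \<Phi> :: "'k::finite \<Rightarrow> real^'d"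
  assumes "gap_at \<Phi> S \<kappa> x" "0 \<le> \<kappa>" "bij_betw p UNIV {1..CARD('k)}"
    and I: "I = {i. p i \<le> S}" and J: "card J \<le> S" "J \<noteq> I"
  shows "4 * \<kappa>\<^sup>2 \<le> (\<Sum>i\<in>UNIV. (rearr x (p i))\<^sup>2 * ((norm (proj_I \<Phi> I (\<Phi> i)))\<^sup>2 - (norm (proj_I \<Phi> J (\<Phi> i)))\<^sup>2))"
proof -
  let ?y = "\<lambda>U. synth \<Phi> (\<chi> i. flip U i * rearr x (p i))"
  have "4 * \<kappa>\<^sup>2 \<le> (norm (proj_I \<Phi> I (?y U)))\<^sup>2 - (norm (proj_I \<Phi> J (?y U)))\<^sup>2" for U
  proof -
    have fl: "\<forall>i. flip U i \<in> {-1, 1}" by (simp add: flip_def)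
    have "2 * \<kappa> \<le> norm (proj_I \<Phi> I (?y U)) - norm (proj_I \<Phi> J (?y U))"
      using assms(1)[unfolded gap_at_def, rule_format, OF conjI[OF assms(3) fl], of J] I J
      by (simp add: rearr_ps_def)
    then have "norm (proj_I \<Phi> J (?y U)) + 2 * \<kappa> \<le> norm (proj_I \<Phi> I (?y U))" by simp
    then have "(norm (proj_I \<Phi> J (?y U)) + 2 * \<kappa>)\<^sup>2 \<le> (norm (proj_I \<Phi> I (?y U)))\<^sup>2"
      using assms(2) by (intro power_mono) auto
    moreover have "0 \<le> norm (proj_I \<Phi> J (?y U)) * \<kappa>" using assms(2) by simp
    ultimately show ?thesis by (simp add: power2_sum power_mult_distrib)
  qed
  then have "(\<Sum>U\<in>(UNIV :: 'k set set). 4 * \<kappa>\<^sup>2) \<le> (\<Sum>U\<in>UNIV. (norm (proj_I \<Phi> I (?y U)))\<^sup>2 - (norm (proj_I \<Phi> J (?y U)))\<^sup>2)"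
    by (intro sum_mono)
  also have "\<dots> = 2 ^ CARD('k) * (\<Sum>i\<in>UNIV. (rearr x (p i))\<^sup>2 * ((norm (proj_I \<Phi> I (\<Phi> i)))\<^sup>2 - (norm (proj_I \<Phi> J (\<Phi> i)))\<^sup>2))"
    by (simp add: sum_subtractf sum_flip_proj_synth right_diff_distrib)
  finally show ?thesis by (simp add: card_UNIV_set)
qed

text \<open>Prepares the smallest possible change of support: exchanging \<open>l\<close> and
  \<open>j\<close>, which sit on either side of the cut, affects only the coefficients of ranks
  \<open>S\<close> and \<open>S + 1\<close>.\<close>

lemma ranking_with_boundary:
  fixes T :: "'k::finite set"
  assumes "card T = S + 1" "l \<in> T" "j \<in> T" "l \<noteq> j" "1 \<le> S"
  obtains p where "bij_betw p UNIV {1..CARD('k)}" "p l = S" "p j = S + 1" "{i. p i \<le> S} = T - {j}"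
proof -
  have cT: "S + 1 \<le> CARD('k)" using assms(1) by (metis card_mono finite subset_UNIV)
  have "card (T - {l, j}) = card {1..S - 1}" using assms by (simp add: card_Diff_subset)
  then obtain f where f: "bij_betw f (T - {l, j}) {1..S - 1}"
    by (metis finite_same_card_bij finite finite_atLeastAtMost)
  have "card (- T) = card {S + 2..CARD('k)}" using assms(1) by (simp add: Compl_eq_Diff_UNIV card_Diff_subset)
  then obtain g where g: "bij_betw g (- T) {S + 2..CARD('k)}"
    by (metis finite_same_card_bij finite finite_atLeastAtMost)
  define p where "p i = (if i = l then S else if i = j then S + 1 else if i \<in> T then f i else g i)" for i
  have fr: "1 \<le> f i \<and> f i \<le> S - 1" if "i \<in> T" "i \<noteq> l" "i \<noteq> j" for i
    using f that by (auto simp: bij_betw_def)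
  have gr: "S + 2 \<le> g i" if "i \<notin> T" for i using g that by (auto simp: bij_betw_def)
  have "p ` UNIV = p ` {l} \<union> p ` {j} \<union> p ` (T - {l, j}) \<union> p ` (- T)"
    by (subst image_Un[symmetric])+ (rule arg_cong[of _ _ "image p"], auto)
  also have "p ` (T - {l, j}) = f ` (T - {l, j})" by (rule image_cong) (auto simp: p_def)
  also have "p ` (- T) = g ` (- T)" using assms by (intro image_cong) (auto simp: p_def)
  also have "f ` (T - {l, j}) = {1..S - 1}" using f by (simp add: bij_betw_def)
  also have "g ` (- T) = {S + 2..CARD('k)}" using g by (simp add: bij_betw_def)
  also have "p ` {l} \<union> p ` {j} \<union> {1..S - 1} \<union> {S + 2..CARD('k)} = {1..CARD('k)}"
    using assms cT by (auto simp: p_def)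
  finally have im: "p ` UNIV = {1..CARD('k)}" .
  then have "inj p" by (intro eq_card_imp_inj_on) auto
  with im have b: "bij_betw p UNIV {1..CARD('k)}" by (simp add: bij_betw_def)
  have "p i \<le> S \<longleftrightarrow> i \<in> T - {j}" for i
    using fr[of i] gr[of i] assms by (auto simp: p_def)
  then have "{i. p i \<le> S} = T - {j}" by blast
  with b show thesis using that[of p] assms(4) by (simp add: p_def)
qed

lemma proj_I_atom: "i \<in> I \<Longrightarrow> proj_I \<Psi> I (\<Psi> i) = \<Psi> i"
  unfolding proj_I_def by (rule orth_proj_id) (auto intro: span_base)

lemma proj_I_pythagoras: "(norm y)\<^sup>2 = (norm (proj_I \<Psi> I y))\<^sup>2 + (norm (y - proj_I \<Psi> I y))\<^sup>2"
  unfolding proj_I_def by (rule orth_proj_pythagoras) simp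

text \<open>Adding the averaged gap inequalities for a ranking and for the ranking with \<open>l\<close> and \<open>j\<close>
  exchanged cancels the contribution of all atoms outside \<open>{l, j}\<close>.\<close>

lemma gap_at_distance_pair:
  fixes \<Phi> :: "'k::finite \<Rightarrow> real^'d"
  assumes gap: "gap_at \<Phi> S \<kappa> x" and "0 \<le> \<kappa>" and unit: "\<And>i. norm (\<Phi> i) = 1"
    and T: "card T = S + 1" "l \<in> T" "j \<in> T" "l \<noteq> j" "1 \<le> S"
  shows "8 * \<kappa>\<^sup>2 \<le> ((rearr x S)\<^sup>2 - (rearr x (S + 1))\<^sup>2) *
    ((norm (\<Phi> l - proj_I \<Phi> (T - {l}) (\<Phi> l)))\<^sup>2 + (norm (\<Phi> j - proj_I \<Phi> (T - {j}) (\<Phi> j)))\<^sup>2)"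
proof -
  obtain p where p: "bij_betw p UNIV {1..CARD('k)}" "p l = S" "p j = S + 1" "{i. p i \<le> S} = T - {j}"
    using ranking_with_boundary[OF T] by blast
  let ?s = "Transposition.transpose l j"
  define p' where "p' = p \<circ> ?s"
  have p'b: "bij_betw p' UNIV {1..CARD('k)}"
    unfolding p'_def by (rule bij_betw_trans[OF _ p(1)]) simp
  have "p i \<le> S \<longleftrightarrow> i \<in> T - {j}" for i using p(4) by blast
  then have p'T: "{i. p' i \<le> S} = T - {l}"
    using T by (auto simp: p'_def Transposition.transpose_def)
  have fT: "finite T" by simp
  have cards: "card (T - {l}) \<le> S" "card (T - {j}) \<le> S" "T - {l} \<noteq> T - {j}" using T by auto
  define d where "d m = (norm (proj_I \<Phi> (T - {j}) (\<Phi> m)))\<^sup>2 - (norm (proj_I \<Phi> (T - {l}) (\<Phi> m)))\<^sup>2" for m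
  define c where "c m = (rearr x (p m))\<^sup>2" for m
  define c' where "c' m = (rearr x (p' m))\<^sup>2" for m
  have 1: "4 * \<kappa>\<^sup>2 \<le> (\<Sum>m\<in>UNIV. c m * d m)"
    unfolding c_def d_def by (rule gap_at_average[OF gap assms(2) p(1)]) (use p(4) cards in auto)
  have "4 * \<kappa>\<^sup>2 \<le> (\<Sum>m\<in>UNIV. c' m * ((norm (proj_I \<Phi> (T - {l}) (\<Phi> m)))\<^sup>2 - (norm (proj_I \<Phi> (T - {j}) (\<Phi> m)))\<^sup>2))"
    unfolding c'_def by (rule gap_at_average[OF gap assms(2) p'b]) (use p'T cards in auto)
  also have "\<dots> = (\<Sum>m\<in>UNIV. - (c' m * d m))" by (intro sum.cong) (auto simp: d_def algebra_simps)
  finally have "8 * \<kappa>\<^sup>2 \<le> (\<Sum>m\<in>UNIV. c m * d m) + (\<Sum>m\<in>UNIV. - (c' m * d m))" using 1 by simp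
  also have "\<dots> = (\<Sum>m\<in>UNIV. (c m - c' m) * d m)"
    by (simp add: sum.distrib[symmetric] left_diff_distrib)
  also have "\<dots> = (\<Sum>m\<in>{l, j}. (c m - c' m) * d m)"
    by (rule sum.mono_neutral_right) (auto simp: c_def c'_def p'_def Transposition.transpose_def)
  also have "\<dots> = ((rearr x S)\<^sup>2 - (rearr x (S + 1))\<^sup>2) * (d l - d j)"
    using T p by (simp add: c_def c'_def p'_def algebra_simps)
  \<comment> \<open>\<open>l\<close> lies in \<open>T - {j}\<close>, so the first projection fixes
    \<open>\<Phi> l\<close>, and what remains is its squared distance to the other span.\<close>
  also have "d l = (norm (\<Phi> l - proj_I \<Phi> (T - {l}) (\<Phi> l)))\<^sup>2"
    using T proj_I_pythagoras[of "\<Phi> l" \<Phi> "T - {l}"] unit by (simp add: d_def proj_I_atom)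
  also have "d j = - (norm (\<Phi> j - proj_I \<Phi> (T - {j}) (\<Phi> j)))\<^sup>2"
    using T proj_I_pythagoras[of "\<Phi> j" \<Phi> "T - {j}"] unit by (simp add: d_def proj_I_atom)
  finally show ?thesis by simp
qed

text \<open>The \<open>S\<close> largest squared entries sum to at most 1, so the smallest of them
  is at most \<open>1 / S\<close>; this eliminates \<open>x\<close> from the bound.\<close>

lemma gap_at_distance_pair_le:
  fixes \<Phi> :: "'k::finite \<Rightarrow> real^'d"
  assumes gap: "gap_at \<Phi> S \<kappa> x" and "0 \<le> \<kappa>" and unit: "\<And>i. norm (\<Phi> i) = 1"
    and T: "card T = S + 1" "l \<in> T" "j \<in> T" "l \<noteq> j" "1 \<le> S" and x: "norm x = 1"
  shows "8 * \<kappa>\<^sup>2 * real S \<le>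
    (norm (\<Phi> l - proj_I \<Phi> (T - {l}) (\<Phi> l)))\<^sup>2 + (norm (\<Phi> j - proj_I \<Phi> (T - {j}) (\<Phi> j)))\<^sup>2"
    (is "_ \<le> ?t")
proof -
  have cT: "S + 1 \<le> CARD('k)" using T(1) by (metis card_mono finite subset_UNIV)
  have "real S * (rearr x S)\<^sup>2 = (\<Sum>j=1..S. (rearr x S)\<^sup>2)" by simp
  also have "\<dots> \<le> (\<Sum>j=1..S. (rearr x j)\<^sup>2)"
    using cT by (intro sum_mono power_mono rearr_antimono rearr_nonneg) auto
  also have "\<dots> \<le> (\<Sum>j=1..CARD('k). (rearr x j)\<^sup>2)" using cT by (intro sum_mono2) auto
  also have "\<dots> = 1" unfolding sum_rearr_sq x by simp
  finally have "real S * (rearr x S)\<^sup>2 \<le> 1" .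
  moreover have "0 \<le> real S * (rearr x (S + 1))\<^sup>2" by simp
  ultimately have c: "real S * ((rearr x S)\<^sup>2 - (rearr x (S + 1))\<^sup>2) \<le> 1"
    unfolding right_diff_distrib by linarith
  have "8 * \<kappa>\<^sup>2 * real S \<le> (((rearr x S)\<^sup>2 - (rearr x (S + 1))\<^sup>2) * ?t) * real S"
    using gap_at_distance_pair[OF assms(1-8)] by (intro mult_right_mono) auto
  also have "\<dots> = (real S * ((rearr x S)\<^sup>2 - (rearr x (S + 1))\<^sup>2)) * ?t" by simp
  also have "\<dots> \<le> 1 * ?t" using c by (intro mult_right_mono) auto
  finally show ?thesis by simp
qed

text \<open>Removing the projection onto the span of the other atoms annihilates all terms but one.
  The distance of an atom to the others thus converts a bound on the norm into a bound on its
  coefficient.\<close>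

lemma span_coefficient_le:
  fixes \<Phi> :: "'k \<Rightarrow> real^'d"
  assumes "finite T" "l \<in> T"
  shows "\<bar>a l\<bar> * norm (\<Phi> l - proj_I \<Phi> (T - {l}) (\<Phi> l)) \<le> norm (\<Sum>m\<in>T. a m *\<^sub>R \<Phi> m)"
    and "(\<Sum>m\<in>T. a m *\<^sub>R \<Phi> m) - proj_I \<Phi> (T - {l}) (\<Sum>m\<in>T. a m *\<^sub>R \<Phi> m)
      = a l *\<^sub>R (\<Phi> l - proj_I \<Phi> (T - {l}) (\<Phi> l))"
proof -
  let ?P = "proj_I \<Phi> (T - {l})" and ?u = "\<Sum>m\<in>T. a m *\<^sub>R \<Phi> m"
  have "?P ?u = (\<Sum>m\<in>T. a m *\<^sub>R ?P (\<Phi> m))"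
    by (simp add: linear_sum[OF linear_proj_I] linear_cmul[OF linear_proj_I])
  then have "?u - ?P ?u = (\<Sum>m\<in>T. a m *\<^sub>R (\<Phi> m - ?P (\<Phi> m)))"
    by (simp add: scaleR_diff_right sum_subtractf)
  also have "\<dots> = (\<Sum>m\<in>{l}. a m *\<^sub>R (\<Phi> m - ?P (\<Phi> m)))"
    using assms by (intro sum.mono_neutral_right) (auto simp: proj_I_atom)
  finally show e: "?u - ?P ?u = a l *\<^sub>R (\<Phi> l - ?P (\<Phi> l))" by simp
  have "norm (?u - ?P ?u) \<le> norm ?u" unfolding proj_I_def by (rule norm_orth_proj_le) simp
  then show "\<bar>a l\<bar> * norm (\<Phi> l - ?P (\<Phi> l)) \<le> norm ?u" unfolding e by simp
qed

text \<open>By the pairwise bound at most one atom of \<open>T\<close> can be closer than \<open>sqrt (4 * \<kappa>\<^sup>2 * S)\<close> to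
  the span of the others. If it is, its expansion in the other atoms has small coefficients,
  which contradicts its unit norm unless it is not too close after all.\<close>

lemma gap_at_sum_inverse_distance:
  fixes \<Phi> :: "'k::finite \<Rightarrow> real^'d"
  assumes gap: "gap_at \<Phi> S \<kappa> x" and "0 < \<kappa>" and unit: "\<And>i. norm (\<Phi> i) = 1"
    and T: "card T = S + 1" "k \<in> T" "1 \<le> S" and x: "norm x = 1"
  defines "\<tau> \<equiv> \<lambda>l. norm (\<Phi> l - proj_I \<Phi> (T - {l}) (\<Phi> l))"
  shows "(\<Sum>l\<in>T - {k}. 1 / (\<tau> l)\<^sup>2) \<le> (real S + 3) / (4 * \<kappa>\<^sup>2)"
    and "\<And>l. l \<in> T - {k} \<Longrightarrow> 0 < \<tau> l" and "4 * \<kappa>\<^sup>2 * real S \<le> 1"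
proof -
  define t where "t = 4 * \<kappa>\<^sup>2 * real S"
  have t0: "0 < t" using assms by (simp add: t_def)
  have tau1: "\<tau> l \<le> 1" "0 \<le> \<tau> l" for l
    using norm_orth_proj_le(2)[of "span (\<Phi> ` (T - {l}))" "\<Phi> l"] unit by (auto simp: \<tau>_def proj_I_def)
  have pair: "2 * t \<le> (\<tau> l)\<^sup>2 + (\<tau> j)\<^sup>2" if "l \<in> T" "j \<in> T" "l \<noteq> j" for l j
    using gap_at_distance_pair_le[OF gap _ unit T(1) that T(3) x] assms(2) by (simp add: \<tau>_def t_def)
  have cTk: "card (T - {k}) = S" using T by simp
  then obtain m0 where "m0 \<in> T - {k}" using T(3) by (metis card.empty ex_in_conv not_one_le_zero)
  then have "2 * t \<le> (\<tau> k)\<^sup>2 + (\<tau> m0)\<^sup>2" using T by (intro pair) auto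
  also have "\<dots> \<le> 1 + 1" using tau1 by (intro add_mono power_le_one) auto
  finally have t1: "t \<le> 1" by simp
  then show "4 * \<kappa>\<^sup>2 * real S \<le> 1" by (simp add: t_def)
  have small: "t \<le> (\<tau> l)\<^sup>2 * (real S + 1)\<^sup>2" if l: "l \<in> T" "(\<tau> l)\<^sup>2 < t" for l
  proof -
    have big: "t \<le> (\<tau> m)\<^sup>2" if "m \<in> T - {l}" for m
      using pair[of l m] l that by auto
    have "proj_I \<Phi> (T - {l}) (\<Phi> l) \<in> span (\<Phi> ` (T - {l}))"
      unfolding proj_I_def by (rule orth_proj_in) simp
    then obtain b where b: "proj_I \<Phi> (T - {l}) (\<Phi> l) = (\<Sum>m\<in>T - {l}. b m *\<^sub>R \<Phi> m)"
      by (rule span_image_sum[rotated]) auto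
    define a where "a m = (if m = l then 1 else - b m)" for m
    have "(\<Sum>m\<in>T. a m *\<^sub>R \<Phi> m) = a l *\<^sub>R \<Phi> l + (\<Sum>m\<in>T - {l}. a m *\<^sub>R \<Phi> m)"
      using l by (simp add: sum.remove)
    also have "(\<Sum>m\<in>T - {l}. a m *\<^sub>R \<Phi> m) = - (\<Sum>m\<in>T - {l}. b m *\<^sub>R \<Phi> m)"
      unfolding sum_negf[symmetric] by (intro sum.cong) (auto simp: a_def)
    finally have e: "(\<Sum>m\<in>T. a m *\<^sub>R \<Phi> m) = \<Phi> l - proj_I \<Phi> (T - {l}) (\<Phi> l)"
      by (simp add: b a_def)
    have bm: "\<bar>b m\<bar> * sqrt t \<le> \<tau> l" if m: "m \<in> T - {l}" for m
    proof -
      have "\<bar>b m\<bar> * sqrt t \<le> \<bar>b m\<bar> * \<tau> m"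
        using big[OF m] tau1 by (intro mult_left_mono real_le_lsqrt) auto
      also have "\<dots> = \<bar>a m\<bar> * \<tau> m" using m by (simp add: a_def)
      also have "\<dots> \<le> \<tau> l"
        using span_coefficient_le(1)[of T m a \<Phi>] m unfolding e by (auto simp: \<tau>_def)
      finally show ?thesis .
    qed
    \<comment> \<open>The unit norm is at most the distance \<open>\<tau> l\<close> plus
      \<open>S\<close> coefficients of size at most \<open>\<tau> l / sqrt t\<close>. With
      \<open>t \<le> 1\<close> this is where \<open>(S + 1)\<^sup>2\<close> comes from.\<close>
    have "1 = norm (\<Phi> l)" using unit by simp
    also have "\<dots> \<le> norm (\<Phi> l - proj_I \<Phi> (T - {l}) (\<Phi> l)) + norm (proj_I \<Phi> (T - {l}) (\<Phi> l))"
      by (metis diff_add_cancel norm_triangle_ineq)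
    also have "\<dots> \<le> \<tau> l + (\<Sum>m\<in>T - {l}. \<bar>b m\<bar>)"
      unfolding b \<tau>_def using norm_sum[of "\<lambda>m. b m *\<^sub>R \<Phi> m" "T - {l}"] by (simp add: unit)
    finally have "1 * sqrt t \<le> (\<tau> l + (\<Sum>m\<in>T - {l}. \<bar>b m\<bar>)) * sqrt t"
      using t0 by (intro mult_right_mono) auto
    also have "\<dots> = \<tau> l * sqrt t + (\<Sum>m\<in>T - {l}. \<bar>b m\<bar> * sqrt t)"
      by (simp add: distrib_right sum_distrib_right)
    also have "\<dots> \<le> \<tau> l * 1 + (\<Sum>m\<in>T - {l}. \<tau> l)"
      using t1 tau1 by (intro add_mono mult_left_mono sum_mono bm) auto
    also have "\<dots> = \<tau> l * (real S + 1)" using T l by (simp add: algebra_simps)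
    finally have "(sqrt t)\<^sup>2 \<le> (\<tau> l * (real S + 1))\<^sup>2" using t0 by (intro power_mono) auto
    then show ?thesis using t0 by (simp add: power_mult_distrib)
  qed
  have pos: "0 < \<tau> l" if "l \<in> T" for l
  proof (cases "(\<tau> l)\<^sup>2 < t")
    case True
    then show ?thesis using small[OF that] t0 tau1(2)[of l] by (cases "\<tau> l = 0") auto
  next
    case False
    then show ?thesis using t0 tau1(2)[of l] by (cases "\<tau> l = 0") auto
  qed
  then show "\<And>l. l \<in> T - {k} \<Longrightarrow> 0 < \<tau> l" by auto
  \<comment> \<open>One summand of size at most \<open>(S + 1)\<^sup>2 / t\<close> and
    \<open>S - 1\<close> summands of size at most \<open>1 / t\<close>. The numerators add up to
    \<open>S * (S + 3)\<close>, and the factor \<open>S\<close> cancels against the one in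
    \<open>t\<close>; this is the origin of the recurring \<open>S + 3\<close>.\<close>
  have eq: "((real S - 1) + (real S + 1)\<^sup>2) / t = (real S + 3) / (4 * \<kappa>\<^sup>2)"
    using assms(2) T(3) by (simp add: t_def field_simps power2_eq_square)
  show "(\<Sum>l\<in>T - {k}. 1 / (\<tau> l)\<^sup>2) \<le> (real S + 3) / (4 * \<kappa>\<^sup>2)"
  proof (cases "\<exists>l\<in>T - {k}. (\<tau> l)\<^sup>2 < t")
    case True
    then obtain l where l: "l \<in> T - {k}" "(\<tau> l)\<^sup>2 < t" by auto
    have "(\<Sum>m\<in>T - {k}. 1 / (\<tau> m)\<^sup>2) = 1 / (\<tau> l)\<^sup>2 + (\<Sum>m\<in>T - {k} - {l}. 1 / (\<tau> m)\<^sup>2)"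
      using l by (simp add: sum.remove)
    also have "\<dots> \<le> (real S + 1)\<^sup>2 / t + (\<Sum>m\<in>T - {k} - {l}. 1 / t)"
    proof (intro add_mono sum_mono)
      show "1 / (\<tau> l)\<^sup>2 \<le> (real S + 1)\<^sup>2 / t"
        using small[of l] l pos[of l] t0 by (simp add: field_simps)
      fix m assume m: "m \<in> T - {k} - {l}"
      then have "t \<le> (\<tau> m)\<^sup>2" using pair[of l m] l by auto
      then show "1 / (\<tau> m)\<^sup>2 \<le> 1 / t" using t0 by (intro divide_left_mono mult_pos_pos) auto
    qed
    also have "\<dots> = ((real S - 1) + (real S + 1)\<^sup>2) / t"
      using l cTk T by (simp add: of_nat_diff add_divide_distrib)
    finally show ?thesis unfolding eq .
  next
    case False
    then have "(\<Sum>l\<in>T - {k}. 1 / (\<tau> l)\<^sup>2) \<le> (\<Sum>l\<in>T - {k}. 1 / t)"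
      using t0 pos by (intro sum_mono divide_left_mono mult_pos_pos zero_less_power) (auto simp: not_less)
    also have "\<dots> = real S / t" using cTk by simp
    also have "\<dots> \<le> ((real S - 1) + (real S + 1)\<^sup>2) / t"
      using t0 by (intro divide_right_mono) (auto simp: power2_eq_square algebra_simps)
    finally show ?thesis unfolding eq .
  qed
qed

text \<open>\<open>J\<close> is enlarged to a set of \<open>S + 1\<close> atoms, possible because
  \<open>S < K\<close>, with an additional element \<open>k\<close>. Each coefficient is at most the
  norm divided by the distance of its atom, and the inverse squared distances are summable over
  \<open>T - {k}\<close>.\<close>

lemma gap_at_norm_lower_bound:
  fixes \<Phi> :: "'k::finite \<Rightarrow> real^'d"
  assumes gap: "gap_at \<Phi> S \<kappa> x" and "0 < \<kappa>" and unit: "\<And>i. norm (\<Phi> i) = 1"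
    and S: "1 \<le> S" "S < CARD('k)" and x: "norm x = 1" and J: "card J \<le> S"
  shows "4 * \<kappa>\<^sup>2 / (real S + 3) * (\<Sum>j\<in>J. (a j)\<^sup>2) \<le> (norm (\<Sum>j\<in>J. a j *\<^sub>R \<Phi> j))\<^sup>2"
proof -
  have "S - card J \<le> card (- J)" using S J by (simp add: Compl_eq_Diff_UNIV card_Diff_subset)
  moreover have "card (- J) > S - card J" using S J by (simp add: Compl_eq_Diff_UNIV card_Diff_subset)
  ultimately have "S + 1 - card J \<le> card (- J)" by auto
  then obtain R where R: "R \<subseteq> - J" "card R = S + 1 - card J" "finite R"
    using obtain_subset_with_card_n by metis
  define T where "T = J \<union> R"
  have T: "card T = S + 1" using R J unfolding T_def by (subst card_Un_disjoint) auto
  have "R \<noteq> {}" using R J by auto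
  then obtain k where k: "k \<in> R" by auto
  have kT: "k \<in> T" "J \<subseteq> T - {k}" using k R by (auto simp: T_def)
  let ?\<tau> = "\<lambda>l. norm (\<Phi> l - proj_I \<Phi> (T - {l}) (\<Phi> l))"
  note inv = gap_at_sum_inverse_distance[OF gap assms(2) unit T kT(1) S(1) x]
  define b where "b j = (if j \<in> J then a j else 0)" for j
  have "(\<Sum>j\<in>T. b j *\<^sub>R \<Phi> j) = (\<Sum>j\<in>J. b j *\<^sub>R \<Phi> j)"
    by (rule sum.mono_neutral_right) (auto simp: T_def b_def)
  also have "\<dots> = (\<Sum>j\<in>J. a j *\<^sub>R \<Phi> j)" by (rule sum.cong) (auto simp: b_def)
  finally have e: "(\<Sum>j\<in>T. b j *\<^sub>R \<Phi> j) = (\<Sum>j\<in>J. a j *\<^sub>R \<Phi> j)" .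
  let ?u = "\<Sum>j\<in>J. a j *\<^sub>R \<Phi> j"
  have "(\<Sum>j\<in>J. (a j)\<^sup>2) \<le> (\<Sum>j\<in>J. (norm ?u)\<^sup>2 * (1 / (?\<tau> j)\<^sup>2))"
  proof (rule sum_mono)
    fix j assume j: "j \<in> J"
    have "\<bar>b j\<bar> * ?\<tau> j \<le> norm ?u" unfolding e[symmetric] by (rule span_coefficient_le) (use j T_def in auto)
    then have "(\<bar>b j\<bar> * ?\<tau> j)\<^sup>2 \<le> (norm ?u)\<^sup>2" by (intro power_mono) auto
    then show "(a j)\<^sup>2 \<le> (norm ?u)\<^sup>2 * (1 / (?\<tau> j)\<^sup>2)"
      using inv(2)[of j] subsetD[OF kT(2) j] j by (simp add: b_def power_mult_distrib field_simps)
  qed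
  also have "\<dots> = (norm ?u)\<^sup>2 * (\<Sum>j\<in>J. 1 / (?\<tau> j)\<^sup>2)" by (simp add: sum_distrib_left)
  also have "\<dots> \<le> (norm ?u)\<^sup>2 * (\<Sum>j\<in>T - {k}. 1 / (?\<tau> j)\<^sup>2)"
    using kT(2) by (intro mult_left_mono sum_mono2) auto
  also have "\<dots> \<le> (norm ?u)\<^sup>2 * ((real S + 3) / (4 * \<kappa>\<^sup>2))" using inv(1) by (intro mult_left_mono) auto
  finally show ?thesis using assms(2) by (simp add: field_simps)
qed

text \<open>Inside the span of \<open>T\<close>, the residual for \<open>T - {l}\<close> is the
  coefficient of \<open>l\<close> times its distance. The term \<open>l = k\<close> is missing on
  the right; orthogonality to \<open>\<Phi> k\<close> compensates for it, since the coefficient of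
  \<open>k\<close> then drops out when the squared norm is expanded. Cauchy-Schwarz against the
  inverse distances does the rest.\<close>

lemma gap_at_sum_residual:
  fixes \<Phi> :: "'k::finite \<Rightarrow> real^'d"
  assumes gap: "gap_at \<Phi> S \<kappa> x" and "0 < \<kappa>" and unit: "\<And>i. norm (\<Phi> i) = 1"
    and T: "card T = S + 1" "k \<in> T" "1 \<le> S" and x: "norm x = 1" and z: "z \<bullet> \<Phi> k = 0"
  shows "4 * \<kappa>\<^sup>2 / (real S + 3) * (norm z)\<^sup>2 \<le> (\<Sum>l\<in>T - {k}. (norm (z - proj_I \<Phi> (T - {l}) z))\<^sup>2)"
proof -
  let ?\<tau> = "\<lambda>l. norm (\<Phi> l - proj_I \<Phi> (T - {l}) (\<Phi> l))"
  note inv = gap_at_sum_inverse_distance[OF gap assms(2) unit T x]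
  let ?c = "4 * \<kappa>\<^sup>2 / (real S + 3)"
  let ?w = "proj_I \<Phi> T z"
  have "?w \<in> span (\<Phi> ` T)" unfolding proj_I_def by (rule orth_proj_in) simp
  then obtain a where a: "?w = (\<Sum>m\<in>T. a m *\<^sub>R \<Phi> m)" by (rule span_image_sum[rotated]) auto
  have res: "(norm (z - proj_I \<Phi> (T - {l}) z))\<^sup>2 = (\<bar>a l\<bar> * ?\<tau> l)\<^sup>2 + (norm (z - ?w))\<^sup>2" if "l \<in> T" for l
  proof -
    have "(norm (z - proj_I \<Phi> (T - {l}) z))\<^sup>2 = (norm (?w - proj_I \<Phi> (T - {l}) ?w))\<^sup>2 + (norm (z - ?w))\<^sup>2"
      unfolding proj_I_def by (intro orth_proj_residual_nested span_mono) auto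
    also have "?w - proj_I \<Phi> (T - {l}) ?w = a l *\<^sub>R (\<Phi> l - proj_I \<Phi> (T - {l}) (\<Phi> l))"
      unfolding a by (rule span_coefficient_le) (use that in auto)
    finally show ?thesis by simp
  qed
  have "?w \<bullet> \<Phi> k = z \<bullet> proj_I \<Phi> T (\<Phi> k)" unfolding proj_I_def by (rule orth_proj_adjoint) simp
  also have "\<dots> = 0" using z T by (simp add: proj_I_atom)
  finally have wk: "?w \<bullet> \<Phi> k = 0" .
  have "norm ?w * norm ?w = ?w \<bullet> (\<Sum>m\<in>T. a m *\<^sub>R \<Phi> m)"
    by (simp add: a[symmetric] power2_norm_eq_inner[symmetric] power2_eq_square)
  also have "\<dots> = (\<Sum>m\<in>T - {k}. a m * (?w \<bullet> \<Phi> m))"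
    unfolding inner_sum_right using T wk by (simp add: sum.remove[of T k])
  also have "\<dots> \<le> (\<Sum>m\<in>T - {k}. \<bar>a m\<bar> * norm ?w)"
  proof (rule sum_mono)
    fix m
    have "a m * (?w \<bullet> \<Phi> m) \<le> \<bar>a m\<bar> * \<bar>?w \<bullet> \<Phi> m\<bar>" by (metis abs_ge_self abs_mult)
    also have "\<dots> \<le> \<bar>a m\<bar> * (norm ?w * norm (\<Phi> m))" by (intro mult_left_mono Cauchy_Schwarz_ineq2) auto
    finally show "a m * (?w \<bullet> \<Phi> m) \<le> \<bar>a m\<bar> * norm ?w" by (simp add: unit)
  qed
  also have "\<dots> = norm ?w * (\<Sum>m\<in>T - {k}. \<bar>a m\<bar>)" by (simp add: sum_distrib_left mult.commute)
  finally have "norm ?w \<le> (\<Sum>m\<in>T - {k}. \<bar>a m\<bar>)"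
    by (cases "norm ?w = 0") (auto intro: sum_nonneg)
  also have "\<dots> = (\<Sum>m\<in>T - {k}. \<bar>\<bar>a m\<bar> * ?\<tau> m\<bar> * \<bar>1 / ?\<tau> m\<bar>)"
    using inv(2) by (intro sum.cong) auto
  also have "\<dots> \<le> L2_set (\<lambda>m. \<bar>a m\<bar> * ?\<tau> m) (T - {k}) * L2_set (\<lambda>m. 1 / ?\<tau> m) (T - {k})"
    by (rule L2_set_mult_ineq)
  finally have "(norm ?w)\<^sup>2 \<le> (L2_set (\<lambda>m. \<bar>a m\<bar> * ?\<tau> m) (T - {k}) * L2_set (\<lambda>m. 1 / ?\<tau> m) (T - {k}))\<^sup>2"
    by (intro power_mono) auto
  also have "\<dots> = (\<Sum>m\<in>T - {k}. (\<bar>a m\<bar> * ?\<tau> m)\<^sup>2) * (\<Sum>m\<in>T - {k}. 1 / (?\<tau> m)\<^sup>2)"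
    by (simp add: power_mult_distrib L2_set_def sum_nonneg power_divide)
  also have "\<dots> \<le> (\<Sum>m\<in>T - {k}. (\<bar>a m\<bar> * ?\<tau> m)\<^sup>2) * ((real S + 3) / (4 * \<kappa>\<^sup>2))"
    using inv(1) by (intro mult_left_mono sum_nonneg) auto
  finally have w: "?c * (norm ?w)\<^sup>2 \<le> (\<Sum>m\<in>T - {k}. (\<bar>a m\<bar> * ?\<tau> m)\<^sup>2)"
    using assms(2) by (simp add: field_simps)
  \<comment> \<open>The part of \<open>z\<close> orthogonal to the span of \<open>T\<close> occurs
    in all \<open>S\<close> residuals, so for this part only \<open>?c \<le> S\<close> has to be
    known.\<close>
  have "?c * real S \<le> 1 * real S"
  proof -
    have "4 * \<kappa>\<^sup>2 * 1 \<le> 4 * \<kappa>\<^sup>2 * real S" using T by (intro mult_left_mono) auto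
    then have "4 * \<kappa>\<^sup>2 \<le> 1" using inv(3) by simp
    then have "?c \<le> 1" by simp
    then show ?thesis by (intro mult_right_mono) auto
  qed
  moreover have "?c * 1 \<le> ?c * real S" using T by (intro mult_left_mono) auto
  ultimately have "?c \<le> real S" by simp
  then have "?c * (norm (z - ?w))\<^sup>2 \<le> real S * (norm (z - ?w))\<^sup>2" by (intro mult_right_mono) auto
  with w have "?c * ((norm ?w)\<^sup>2 + (norm (z - ?w))\<^sup>2)
      \<le> (\<Sum>m\<in>T - {k}. (\<bar>a m\<bar> * ?\<tau> m)\<^sup>2) + real S * (norm (z - ?w))\<^sup>2"
    unfolding distrib_left by linarith
  also have "\<dots> = (\<Sum>l\<in>T - {k}. (\<bar>a l\<bar> * ?\<tau> l)\<^sup>2 + (norm (z - ?w))\<^sup>2)"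
    using T by (simp add: sum.distrib)
  also have "\<dots> = (\<Sum>l\<in>T - {k}. (norm (z - proj_I \<Phi> (T - {l}) z))\<^sup>2)"
    using res by (intro sum.cong) auto
  finally show ?thesis unfolding proj_I_pythagoras[of z \<Phi> T] .
qed

section \<open>Dominating supports and moments of the symmetric measure\<close>

text \<open>On \<open>dom_region I\<close> the entries of \<open>x\<close> in \<open>I\<close> are the largest ones, so up to a null set the
  regions with \<open>card I = S\<close> partition the sphere.\<close>

definition dom_region :: "'k set \<Rightarrow> (real^'k::finite) set" where
  "dom_region I = {x. \<forall>i\<in>I. \<forall>j\<in>-I. \<bar>x $ j\<bar> < \<bar>x $ i\<bar>}"

lemma dom_region_sets [measurable]: "dom_region I \<in> sets borel"
proof -
  have "dom_region I = (\<Inter>i\<in>I. \<Inter>j\<in>-I. {x. \<bar>x $ j\<bar> < \<bar>x $ i\<bar>})" by (auto simp: dom_region_def)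
  moreover have "open (\<Inter>i\<in>I. \<Inter>j\<in>-I. {x::real^'a. \<bar>x $ j\<bar> < \<bar>x $ i\<bar>})"
    by (intro open_INT ballI open_Collect_less continuous_intros) auto
  ultimately show ?thesis by auto
qed

lemma dom_region_unique:
  assumes "x \<in> dom_region I" "x \<in> dom_region J" "card I = card J"
  shows "I = J"
proof (rule ccontr)
  assume "I \<noteq> J"
  then have "\<not> I \<subseteq> J" "\<not> J \<subseteq> I" using assms(3) by (metis card_subset_eq finite)+
  then obtain i j where "i \<in> I" "i \<notin> J" "j \<in> J" "j \<notin> I" by blast
  then have "\<bar>x $ j\<bar> < \<bar>x $ i\<bar>" "\<bar>x $ i\<bar> < \<bar>x $ j\<bar>" using assms(1,2) by (auto simp: dom_region_def)
  then show False by simp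
qed

lemma card_ranked:
  fixes p :: "'k::finite \<Rightarrow> nat"
  assumes "bij_betw p UNIV {1..CARD('k)}" "S \<le> CARD('k)"
  shows "card {i. p i \<le> S} = S"
proof -
  have "p ` {i. p i \<le> S} = {1..S}"
  proof
    show "p ` {i. p i \<le> S} \<subseteq> {1..S}" using assms by (auto simp: bij_betw_def)
    show "{1..S} \<subseteq> p ` {i. p i \<le> S}"
    proof
      fix j assume j: "j \<in> {1..S}"
      then have "j \<in> p ` UNIV" using assms by (auto simp: bij_betw_def)
      then show "j \<in> p ` {i. p i \<le> S}" using j by auto
    qed
  qed
  then show ?thesis
    using card_image[of p "{i. p i \<le> S}"] assms(1) by (simp add: bij_betw_def inj_on_def)
qed

text \<open>A tie between the ranks \<open>S\<close> and \<open>S + 1\<close> would make the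
  exchange inequality read \<open>8 * \<kappa>\<^sup>2 \<le> 0\<close>. So there is a strict drop at
  the cut, and monotonicity of the rearrangement does the rest.\<close>

lemma gap_at_dom_region:
  fixes \<Phi> :: "'k::finite \<Rightarrow> real^'d"
  assumes gap: "gap_at \<Phi> S \<kappa> x" and "0 < \<kappa>" and unit: "\<And>i. norm (\<Phi> i) = 1"
    and S: "1 \<le> S" "S < CARD('k)" and p: "bij_betw p UNIV {1..CARD('k)}" "\<And>i. rearr x (p i) = \<bar>x $ i\<bar>"
  shows "x \<in> dom_region {i. p i \<le> S}"
proof -
  have "S + 1 \<le> card (UNIV::'k set)" using S by simp
  then obtain T :: "'k set" where T: "card T = S + 1" using obtain_subset_with_card_n by metis
  then obtain l where l: "l \<in> T" by fastforce
  then have "card (T - {l}) \<noteq> 0" using T S by simp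
  then have "T - {l} \<noteq> {}" by (metis card.empty)
  then obtain j where j: "j \<in> T" "l \<noteq> j" by blast
  have "0 < 8 * \<kappa>\<^sup>2" using assms(2) by simp
  also have "8 * \<kappa>\<^sup>2 \<le> ((rearr x S)\<^sup>2 - (rearr x (S + 1))\<^sup>2) *
    ((norm (\<Phi> l - proj_I \<Phi> (T - {l}) (\<Phi> l)))\<^sup>2 + (norm (\<Phi> j - proj_I \<Phi> (T - {j}) (\<Phi> j)))\<^sup>2)"
    using gap_at_distance_pair[OF gap _ unit T l j S(1)] assms(2) by simp
  finally have "(rearr x (S + 1))\<^sup>2 < (rearr x S)\<^sup>2"
    by (smt (verit) mult_nonpos_nonneg zero_le_power2)
  then have lt: "rearr x (S + 1) < rearr x S"
    by (rule power2_less_imp_less) (use rearr_nonneg[of S x] S in auto)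
  show ?thesis unfolding dom_region_def
  proof (intro CollectI ballI)
    fix i j assume "i \<in> {i. p i \<le> S}" "j \<in> - {i. p i \<le> S}"
    then have i: "p i \<le> S" and j: "\<not> p j \<le> S" by auto
    have r: "p m \<in> {1..CARD('k)}" for m using p(1) by (auto simp: bij_betw_def)
    have "\<bar>x $ j\<bar> \<le> rearr x (S + 1)" unfolding p(2)[symmetric]
      using j r[of j] by (intro rearr_antimono) auto
    also note lt
    also have "rearr x S \<le> \<bar>x $ i\<bar>" unfolding p(2)[symmetric]
      using i r[of i] S by (intro rearr_antimono) auto
    finally show "\<bar>x $ j\<bar> < \<bar>x $ i\<bar>" .
  qed
qed

lemma gap_at_ex_dom_region:
  fixes \<Phi> :: "'k::finite \<Rightarrow> real^'d"
  assumes gap: "gap_at \<Phi> S \<kappa> x" and "0 < \<kappa>" and unit: "\<And>i. norm (\<Phi> i) = 1"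
    and S: "1 \<le> S" "S < CARD('k)"
  shows "\<exists>I. card I = S \<and> x \<in> dom_region I"
proof -
  obtain p where p: "bij_betw p UNIV {1..CARD('k)}" "\<And>i. rearr x (p i) = \<bar>x $ i\<bar>"
    using rearr_ranking by blast
  then show ?thesis using gap_at_dom_region[OF assms p] card_ranked[OF p(1), of S] S
    by (intro exI[of _ "{i. p i \<le> S}"]) simp
qed

text \<open>The ranking and the signs of \<open>x\<close> itself are inserted into the gap
  condition, since \<open>rearr_ps\<close> then reproduces \<open>x\<close>; uniqueness of the
  dominating support identifies the ranked set with \<open>I\<close>.\<close>

lemma gap_at_dom_region_gap:
  fixes \<Phi> :: "'k::finite \<Rightarrow> real^'d"
  assumes gap: "gap_at \<Phi> S \<kappa> x" and "0 < \<kappa>" and unit: "\<And>i. norm (\<Phi> i) = 1"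
    and S: "1 \<le> S" "S < CARD('k)" and I: "card I = S" "x \<in> dom_region I"
    and J: "card J \<le> S" "J \<noteq> I"
  shows "norm (proj_I \<Phi> J (synth \<Phi> x)) + 2 * \<kappa> \<le> norm (proj_I \<Phi> I (synth \<Phi> x))"
proof -
  obtain p where p: "bij_betw p UNIV {1..CARD('k)}" "\<And>i. rearr x (p i) = \<bar>x $ i\<bar>"
    using rearr_ranking by blast
  have Ip: "{i. p i \<le> S} = I"
    using dom_region_unique[OF gap_at_dom_region[OF assms(1-5) p] I(2)] card_ranked[OF p(1)] S I by simp
  define \<sigma> :: "'k \<Rightarrow> real" where "\<sigma> i = (if x $ i < 0 then -1 else 1)" for i
  have "rearr_ps p \<sigma> x = x" by (simp add: rearr_ps_def p(2) \<sigma>_def vec_eq_iff)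
  moreover have "\<forall>i. \<sigma> i \<in> {-1, 1}" by (simp add: \<sigma>_def)
  ultimately show ?thesis
    using gap[unfolded gap_at_def, rule_format, of p \<sigma> J] p(1) Ip J by simp
qed

text \<open>Two ways to get rid of the sorting: the maximum makes the sum visibly measurable, and on
  a dominating region the sum is one fixed quadratic form.\<close>

lemma sum_rearr_eq_Max:
  fixes x :: "real^'k::finite"
  assumes S: "S \<le> CARD('k)"
  shows "(\<Sum>j=1..S. (rearr x j)\<^sup>2) = Max ((\<lambda>I. \<Sum>i\<in>I. (x $ i)\<^sup>2) ` {I. card I = S})"
    and "card I = S \<Longrightarrow> x \<in> dom_region I \<Longrightarrow> (\<Sum>j=1..S. (rearr x j)\<^sup>2) = (\<Sum>i\<in>I. (x $ i)\<^sup>2)"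
proof -
  obtain p where p: "bij_betw p UNIV {1..CARD('k)}" "\<And>i. rearr x (p i) = \<bar>x $ i\<bar>"
    using rearr_ranking by blast
  let ?I = "{i. p i \<le> S}"
  have cI: "card ?I = S" by (rule card_ranked[OF p(1) S])
  have r: "p m \<in> {1..CARD('k)}" for m using p(1) by (auto simp: bij_betw_def)
  have inj: "inj_on p ?I" using p(1) by (auto simp: bij_betw_def inj_on_def)
  have "p ` ?I \<subseteq> {1..S}" using r by auto
  then have im: "p ` ?I = {1..S}" using card_image[OF inj] cI by (intro card_subset_eq) auto
  have "(\<Sum>j=1..S. (rearr x j)\<^sup>2) = (\<Sum>i\<in>?I. (rearr x (p i))\<^sup>2)"
    unfolding im[symmetric] sum.reindex[OF inj] by simp
  then have eq: "(\<Sum>j=1..S. (rearr x j)\<^sup>2) = (\<Sum>i\<in>?I. (x $ i)\<^sup>2)" by (simp add: p(2))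
  have le: "(\<Sum>i\<in>J. (x $ i)\<^sup>2) \<le> (\<Sum>i\<in>?I. (x $ i)\<^sup>2)" if J: "card J = S" for J
  proof (cases "S = 0")
    case False
    have x2: "(x $ i)\<^sup>2 = (rearr x (p i))\<^sup>2" for i by (simp add: p(2))
    have c: "card (J - ?I) = card (?I - J)"
      using J cI by (metis card_Diff_subset_Int Int_commute finite_Int finite)
    have "(\<Sum>i\<in>J - ?I. (x $ i)\<^sup>2) \<le> (\<Sum>i\<in>J - ?I. (rearr x S)\<^sup>2)"
      unfolding x2 using r False S
      by (intro sum_mono power_mono rearr_antimono rearr_nonneg) auto
    also have "\<dots> = (\<Sum>i\<in>?I - J. (rearr x S)\<^sup>2)" using c by simp
    also have "\<dots> \<le> (\<Sum>i\<in>?I - J. (x $ i)\<^sup>2)"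
      unfolding x2 using r False S
      by (intro sum_mono power_mono rearr_antimono rearr_nonneg) auto
    finally have "(\<Sum>i\<in>J - ?I. (x $ i)\<^sup>2) + (\<Sum>i\<in>J \<inter> ?I. (x $ i)\<^sup>2)
      \<le> (\<Sum>i\<in>?I - J. (x $ i)\<^sup>2) + (\<Sum>i\<in>J \<inter> ?I. (x $ i)\<^sup>2)" by simp
    moreover have "(\<Sum>i\<in>J - ?I. (x $ i)\<^sup>2) + (\<Sum>i\<in>J \<inter> ?I. (x $ i)\<^sup>2) = (\<Sum>i\<in>J. (x $ i)\<^sup>2)"
      by (subst sum.union_disjoint[symmetric]) (auto intro: sum.cong)
    moreover have "(\<Sum>i\<in>?I - J. (x $ i)\<^sup>2) + (\<Sum>i\<in>J \<inter> ?I. (x $ i)\<^sup>2) = (\<Sum>i\<in>?I. (x $ i)\<^sup>2)"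
      by (subst sum.union_disjoint[symmetric]) (auto intro: sum.cong)
    ultimately show ?thesis by simp
  qed (use J in \<open>simp add: sum_nonneg\<close>)
  show "(\<Sum>j=1..S. (rearr x j)\<^sup>2) = Max ((\<lambda>I. \<Sum>i\<in>I. (x $ i)\<^sup>2) ` {I. card I = S})"
    unfolding eq using le cI by (intro Max_eqI[symmetric]) auto
  show "(\<Sum>j=1..S. (rearr x j)\<^sup>2) = (\<Sum>i\<in>I. (x $ i)\<^sup>2)" if I: "card I = S" "x \<in> dom_region I"
  proof -
    have "(\<Sum>i\<in>?I. (x $ i)\<^sup>2) \<le> (\<Sum>i\<in>I. (x $ i)\<^sup>2)"
    proof -
      have c: "card (?I - I) = card (I - ?I)"
        using I cI by (metis card_Diff_subset_Int Int_commute finite_Int finite)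
      have "(\<Sum>i\<in>?I - I. (x $ i)\<^sup>2) \<le> (\<Sum>i\<in>I - ?I. (x $ i)\<^sup>2)"
      proof -
        obtain f where f: "bij_betw f (?I - I) (I - ?I)" using c by (metis finite_same_card_bij finite)
        have "(\<Sum>i\<in>?I - I. (x $ i)\<^sup>2) \<le> (\<Sum>i\<in>?I - I. (x $ f i)\<^sup>2)"
        proof (rule sum_mono)
          fix i assume i: "i \<in> ?I - I"
          then have "f i \<in> I" using f by (auto simp: bij_betw_def)
          then have "\<bar>x $ i\<bar> \<le> \<bar>x $ f i\<bar>" using I(2) i by (auto simp: dom_region_def less_imp_le)
          then show "(x $ i)\<^sup>2 \<le> (x $ f i)\<^sup>2" by (simp add: abs_le_square_iff)
        qed
        also have "\<dots> = (\<Sum>i\<in>I - ?I. (x $ i)\<^sup>2)" by (rule sum.reindex_bij_betw[OF f])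
        finally show ?thesis .
      qed
      moreover have "(\<Sum>i\<in>I - ?I. (x $ i)\<^sup>2) + (\<Sum>i\<in>I \<inter> ?I. (x $ i)\<^sup>2) = (\<Sum>i\<in>I. (x $ i)\<^sup>2)"
        by (subst sum.union_disjoint[symmetric]) (auto intro: sum.cong)
      moreover have "(\<Sum>i\<in>?I - I. (x $ i)\<^sup>2) + (\<Sum>i\<in>I \<inter> ?I. (x $ i)\<^sup>2) = (\<Sum>i\<in>?I. (x $ i)\<^sup>2)"
        by (subst sum.union_disjoint[symmetric]) (auto intro: sum.cong)
      ultimately show ?thesis by linarith
    qed
    then show ?thesis using le[OF I(1)] eq by simp
  qed
qed

definition signed :: "'k set \<Rightarrow> real^'k::finite \<Rightarrow> real^'k" where
  "signed U x = (\<chi> i. flip U i * x $ i)"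

lemma signed_dom_region: "signed U x \<in> dom_region I \<longleftrightarrow> x \<in> dom_region I"
  by (simp add: dom_region_def signed_def flip_def abs_mult)

lemma permuted_dom_region:
  assumes "\<pi> permutes (UNIV::'k::finite set)"
  shows "(\<chi> i. x $ \<pi> i) \<in> dom_region I \<longleftrightarrow> x \<in> dom_region (\<pi> ` I)"
proof -
  have "bij \<pi>" using assms by (rule permutes_bij)
  then have "- (\<pi> ` I) = \<pi> ` (- I)" by (simp add: bij_image_Compl_eq)
  then show ?thesis by (simp add: dom_region_def)
qed

text \<open>Bijections on the set and on its complement are glued; a final transposition, which
  stays on one side of \<open>I'\<close> by the second hypothesis, corrects the image of
  \<open>i\<close>.\<close>

lemma ex_permutation_between:
  fixes I I' :: "'k::finite set"
  assumes "card I = card I'" "i \<in> I \<longleftrightarrow> i' \<in> I'"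
  obtains \<pi> where "\<pi> permutes UNIV" "\<pi> ` I = I'" "\<pi> i = i'"
proof -
  obtain f where f: "bij_betw f I I'" using assms(1) by (metis finite_same_card_bij finite)
  have "card (- I) = card (- I')" using assms(1) by (simp add: Compl_eq_Diff_UNIV card_Diff_subset)
  then obtain g where g: "bij_betw g (- I) (- I')" by (metis finite_same_card_bij finite)
  define h where "h j = (if j \<in> I then f j else g j)" for j
  have "bij_betw h (I \<union> - I) (I' \<union> - I')"
    unfolding h_def by (rule bij_betw_disjoint_Un[OF f g]) auto
  then have h: "h permutes UNIV" by (auto intro: bij_imp_permutes)
  have hI: "h ` I = I'" using f by (auto simp: h_def bij_betw_def)
  have hi: "h i \<in> I' \<longleftrightarrow> i' \<in> I'" using f g assms(2) by (auto simp: h_def bij_betw_def)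
  define \<pi> where "\<pi> = Transposition.transpose (h i) i' \<circ> h"
  have "\<pi> permutes UNIV" unfolding \<pi>_def by (intro permutes_compose h permutes_swap_id) auto
  moreover have "\<pi> ` I = I'"
  proof -
    have "\<pi> ` I = Transposition.transpose (h i) i' ` I'" unfolding \<pi>_def image_comp[symmetric] hI ..
    also have "\<dots> = I'" using hi by (cases "h i \<in> I'") auto
    finally show ?thesis .
  qed
  moreover have "\<pi> i = i'" by (simp add: \<pi>_def)
  ultimately show thesis using that by blast
qed

lemma exp_half_le: "exp (1 / 2 :: real) \<le> 5 / 3"
proof -
  have "exp (1 / 2 :: real) ^ 2 = exp 1" by (simp flip: exp_of_nat_mult)
  also have "\<dots> \<le> (5 / 3 :: real) ^ 2" using e_less_272 by (simp add: power2_eq_square)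
  finally show ?thesis by (rule power2_le_imp_le) simp
qed

section \<open>Integrals over dominating regions under the symmetric measure\<close>

locale gap_model =
  fixes \<Phi> :: "'k::finite \<Rightarrow> real^'d" and A :: real and \<nu> :: "(real^'k) measure"
    and S :: nat and \<kappa> :: real
  assumes frame: "unit_norm_tight_frame \<Phi> A"
    and symmetric: "symmetric_sphere_measure \<nu>"
    and kappa_pos: "0 < \<kappa>"
    and S_pos: "1 \<le> S" and S_less: "S < CARD('k)"
    and gap: "AE x in \<nu>. gap_at \<Phi> S \<kappa> x"
begin

lemma unit: "norm (\<Phi> i) = 1"
  using frame by (simp add: unit_norm_tight_frame_def)

lemma A_ge_1: "1 \<le> A"
  using frame by (rule tight_frame_const_ge_1)

sublocale prob_space \<nu>
  using symmetric by (simp add: symmetric_sphere_measure_def)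

lemma sets_nu [measurable_cong, simp]: "sets \<nu> = sets borel"
  using symmetric by (simp add: symmetric_sphere_measure_def)

lemma space_nu [simp]: "space \<nu> = UNIV"
  using sets_eq_imp_space_eq[OF sets_nu] by simp

lemma AE_sphere: "AE x in \<nu>. norm x = 1"
proof -
  have "prob (sphere 0 1) = 1"
    using symmetric by (simp add: symmetric_sphere_measure_def measure_def)
  then have "AE x in \<nu>. x \<in> sphere 0 1" by (intro AE_prob_1) auto
  then show ?thesis by (simp add: dist_norm)
qed

lemma ex_gap_point: "\<exists>x. norm x = 1 \<and> gap_at \<Phi> S \<kappa> x"
proof -
  have "AE x in \<nu>. norm x = 1 \<and> gap_at \<Phi> S \<kappa> x" using AE_sphere gap by simp
  show ?thesis
  proof (rule ccontr)
    assume "\<nexists>x. norm x = 1 \<and> gap_at \<Phi> S \<kappa> x"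
    with \<open>AE x in \<nu>. norm x = 1 \<and> gap_at \<Phi> S \<kappa> x\<close> have "AE x in \<nu>. False"
      by (elim AE_mp) auto
    then show False by simp
  qed
qed

lemma norm_sq_synth_le: "norm x = 1 \<Longrightarrow> (norm (synth \<Phi> x))\<^sup>2 \<le> A"
  using tight_frame_synth_le[OF frame, of x] A_ge_1 by simp

lemma kappa_bound: "4 * \<kappa>\<^sup>2 * real S \<le> 1"
proof -
  obtain x where x: "norm x = 1" "gap_at \<Phi> S \<kappa> x" using ex_gap_point by blast
  have "S + 1 \<le> card (UNIV::'k set)" using S_less by simp
  then obtain T :: "'k set" where T: "card T = S + 1" using obtain_subset_with_card_n by metis
  then obtain k where "k \<in> T" by fastforce
  then show ?thesis using gap_at_sum_inverse_distance(3)[OF x(2) kappa_pos unit T _ S_pos x(1)] by simp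
qed

lemma norm_lower_bound:
  assumes "card J \<le> S"
  shows "4 * \<kappa>\<^sup>2 / (real S + 3) * (\<Sum>j\<in>J. (a j)\<^sup>2) \<le> (norm (\<Sum>j\<in>J. a j *\<^sub>R \<Phi> j))\<^sup>2"
proof -
  obtain x where x: "norm x = 1" "gap_at \<Phi> S \<kappa> x" using ex_gap_point by blast
  show ?thesis by (rule gap_at_norm_lower_bound[OF x(2) kappa_pos unit S_pos S_less x(1) assms])
qed

lemma lower_isometry_ge: "4 * \<kappa>\<^sup>2 / (real S + 3) \<le> 1 - lower_isometry_const \<Phi> S"
  using norm_lower_bound by (intro lower_isometry_const_le S_pos)

lemma dim_span_atoms:
  assumes "card J \<le> S"
  shows "dim (span (\<Phi> ` J)) = card J"
  using kappa_pos S_pos norm_lower_bound[OF assms]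
  by (intro dim_span_image_eq_card[of _ "4 * \<kappa>\<^sup>2 / (real S + 3)"]) auto

abbreviation supports :: "'k set set" where
  "supports \<equiv> {I. card I = S}"

lemma supports_pos: "0 < card supports"
proof -
  obtain T :: "'k set" where "card T = S"
    using obtain_subset_with_card_n[of S "UNIV :: 'k set"] S_less by auto
  then show ?thesis by (auto simp: card_gt_0_iff)
qed

lemma AE_partition: "AE x in \<nu>. (\<Sum>I\<in>supports. indicator (dom_region I) x) = (1::real)"
  using gap
proof eventually_elim
  case (elim x)
  then obtain I where I: "card I = S" "x \<in> dom_region I"
    using gap_at_ex_dom_region[where \<Phi>=\<Phi>, OF _ kappa_pos unit S_pos S_less] by blast
  have "(\<Sum>J\<in>supports. indicator (dom_region J) x) = (\<Sum>J\<in>supports. if J = I then 1 else (0::real))"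
    using I dom_region_unique[of x] by (intro sum.cong) (auto simp: indicator_def)
  then show ?case using I by simp
qed

text \<open>The measure lives on the compact sphere, where continuous functions are bounded.\<close>

lemma integrable_continuous:
  fixes f :: "real^'k \<Rightarrow> real"
  assumes "continuous_on UNIV f"
  shows "integrable \<nu> f"
proof -
  have "compact (f ` sphere 0 1)"
    using assms by (intro compact_continuous_image) (auto intro: continuous_on_subset)
  then obtain B where B: "\<And>y. y \<in> f ` sphere 0 1 \<Longrightarrow> norm y \<le> B"
    using compact_imp_bounded bounded_iff by metis
  have "AE x in \<nu>. norm (f x) \<le> B"
    using AE_sphere by eventually_elim (rule B, auto)
  then show ?thesis
    using borel_measurable_continuous_onI[OF assms] by (intro integrable_const_bound) auto
qed

lemma integrable_indicator_continuous:
  fixes f :: "real^'k \<Rightarrow> real"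
  assumes "continuous_on UNIV f"
  shows "integrable \<nu> (\<lambda>x. indicator (dom_region I) x * f x)"
  using integrable_mult_indicator[OF _ integrable_continuous[OF assms], of "dom_region I"] by simp

lemma integral_partition:
  fixes f :: "real^'k \<Rightarrow> real"
  assumes "continuous_on UNIV f"
  shows "(\<integral>x. f x \<partial>\<nu>) = (\<Sum>I\<in>supports. \<integral>x. indicator (dom_region I) x * f x \<partial>\<nu>)"
proof -
  have m: "f \<in> borel_measurable \<nu>" using borel_measurable_continuous_onI[OF assms] by simp
  have "(\<integral>x. f x \<partial>\<nu>) = (\<integral>x. (\<Sum>I\<in>supports. indicator (dom_region I) x * f x) \<partial>\<nu>)"
  proof (rule integral_cong_AE)
    show "AE x in \<nu>. f x = (\<Sum>I\<in>supports. indicator (dom_region I) x * f x)"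
      using AE_partition by eventually_elim (simp flip: sum_distrib_right)
  qed (use m in measurable)
  also have "\<dots> = (\<Sum>I\<in>supports. \<integral>x. indicator (dom_region I) x * f x \<partial>\<nu>)"
    by (rule Bochner_Integration.integral_sum) (rule integrable_indicator_continuous[OF assms])
  finally show ?thesis .
qed

lemma continuous_signed: "continuous_on UNIV (signed U)"
  unfolding signed_def by (intro continuous_intros)

lemma distr_signed: "distr \<nu> borel (signed U) = \<nu>"
proof -
  have "\<forall>i. flip U i \<in> {-1, 1}" by (simp add: flip_def)
  moreover have "signed U = (\<lambda>x. \<chi> i. flip U i * x $ i)" by (rule ext) (simp add: signed_def)
  ultimately show ?thesis using symmetric by (simp add: symmetric_sphere_measure_def)
qed

text \<open>Sign changes preserve each dominating region, so sign symmetry is available region by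
  region and \<open>f\<close> may be replaced by its average over all sign patterns.\<close>

lemma integral_sign_average:
  fixes f :: "real^'k \<Rightarrow> real"
  assumes f: "continuous_on UNIV f"
  shows "(\<integral>x. indicator (dom_region I) x * f x \<partial>\<nu>) =
    (\<integral>x. indicator (dom_region I) x * ((\<Sum>U\<in>UNIV. f (signed U x)) / 2 ^ CARD('k)) \<partial>\<nu>)"
proof -
  have fU: "continuous_on UNIV (\<lambda>x. f (signed U x))" for U
    using continuous_on_compose2[OF f continuous_signed[of U]] by simp
  have m: "(\<lambda>x. indicator (dom_region I) x * f x) \<in> borel_measurable borel"
    using borel_measurable_continuous_onI[OF f] by measurable
  have ms: "signed U \<in> borel_measurable \<nu>" for U
    using borel_measurable_continuous_onI[OF continuous_signed[of U]] by simp
  have one: "(\<integral>x. indicator (dom_region I) x * f (signed U x) \<partial>\<nu>) = (\<integral>x. indicator (dom_region I) x * f x \<partial>\<nu>)" for U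
  proof -
    have "(\<integral>x. indicator (dom_region I) x * f x \<partial>\<nu>) = (\<integral>x. indicator (dom_region I) x * f x \<partial>distr \<nu> borel (signed U))"
      by (simp add: distr_signed)
    also have "\<dots> = (\<integral>x. indicator (dom_region I) (signed U x) * f (signed U x) \<partial>\<nu>)"
      by (rule integral_distr[OF ms m])
    also have "\<dots> = (\<integral>x. indicator (dom_region I) x * f (signed U x) \<partial>\<nu>)"
      by (intro Bochner_Integration.integral_cong) (auto simp: indicator_def signed_dom_region)
    finally show ?thesis by simp
  qed
  have "(\<integral>x. indicator (dom_region I) x * ((\<Sum>U\<in>UNIV. f (signed U x)) / 2 ^ CARD('k)) \<partial>\<nu>)
    = (\<integral>x. (\<Sum>U\<in>UNIV. indicator (dom_region I) x * f (signed U x)) / 2 ^ CARD('k) \<partial>\<nu>)"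
    by (simp add: sum_distrib_left)
  also have "\<dots> = (\<Sum>U\<in>(UNIV::'k set set). \<integral>x. indicator (dom_region I) x * f (signed U x) \<partial>\<nu>) / 2 ^ CARD('k)"
    by (subst integral_divide_zero, subst Bochner_Integration.integral_sum)
      (rule integrable_indicator_continuous[OF fU], rule refl)
  also have "\<dots> = (\<integral>x. indicator (dom_region I) x * f x \<partial>\<nu>)"
    unfolding one by (simp add: card_UNIV_set)
  finally show ?thesis ..
qed

definition moment :: "'k set \<Rightarrow> 'k \<Rightarrow> real" where
  "moment I i = (\<integral>x. indicator (dom_region I) x * (x $ i)\<^sup>2 \<partial>\<nu>)"

lemma moment_nonneg: "0 \<le> moment I i"
  unfolding moment_def by (intro integral_nonneg_AE) auto

lemma continuous_permuted: "continuous_on UNIV (\<lambda>x::real^'k. \<chi> i. x $ \<pi> i)"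
  by (intro continuous_intros)

lemma integral_permuted:
  fixes f :: "real^'k \<Rightarrow> real"
  assumes "\<pi> permutes UNIV" "f \<in> borel_measurable borel"
  shows "(\<integral>x. f (\<chi> i. x $ \<pi> i) \<partial>\<nu>) = (\<integral>x. f x \<partial>\<nu>)"
proof -
  have "(\<lambda>x::real^'k. \<chi> i. x $ \<pi> i) \<in> borel_measurable \<nu>"
    using borel_measurable_continuous_onI[OF continuous_permuted[of \<pi>]] by simp
  then have "(\<integral>x. f (\<chi> i. x $ \<pi> i) \<partial>\<nu>) = (\<integral>x. f x \<partial>distr \<nu> borel (\<lambda>x. \<chi> i. x $ \<pi> i))"
    using assms(2) by (simp add: integral_distr)
  also have "distr \<nu> borel (\<lambda>x. \<chi> i. x $ \<pi> i) = \<nu>"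
    using symmetric assms(1) by (simp add: symmetric_sphere_measure_def)
  finally show ?thesis .
qed

lemma indicator_permuted:
  assumes "\<pi> permutes (UNIV :: 'k set)"
  shows "indicator (dom_region I) (\<chi> i. x $ \<pi> i) = (indicator (dom_region (\<pi> ` I)) x :: real)"
  using permuted_dom_region[OF assms, of x I] by (simp add: indicator_def)

text \<open>For supports of equal size the moments take only two values, one for indices inside and
  one for indices outside the support.\<close>

lemma moment_eq:
  assumes "card I = card I'" "i \<in> I \<longleftrightarrow> i' \<in> I'"
  shows "moment I i = moment I' i'"
proof -
  obtain \<pi> where pi: "\<pi> permutes UNIV" "\<pi> ` I = I'" "\<pi> i = i'"
    using ex_permutation_between[OF assms] by blast
  have "(\<lambda>x. indicator (dom_region I) x * (x $ i)\<^sup>2 :: real) \<in> borel_measurable borel"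
    by (intro borel_measurable_times borel_measurable_indicator dom_region_sets
        borel_measurable_continuous_onI continuous_intros)
  from integral_permuted[OF pi(1) this] show ?thesis
    by (simp add: moment_def indicator_permuted[OF pi(1)] pi)
qed

lemma prob_dom_region:
  assumes "card I = S"
  shows "(\<integral>x. indicator (dom_region I) x \<partial>\<nu>) = 1 / real (card supports)"
proof -
  have eq: "(\<integral>x. indicator (dom_region J) x \<partial>\<nu>) = (\<integral>x. indicator (dom_region I) x \<partial>\<nu> :: real)" if J: "card J = S" for J
  proof -
    have "I \<noteq> {}" "J \<noteq> {}" using assms that S_pos by auto
    then obtain i j where "i \<in> I" "j \<in> J" by blast
    then obtain \<pi> where pi: "\<pi> permutes UNIV" "\<pi> ` J = I"
      by (rule_tac ex_permutation_between[of J I j i]) (use assms J in auto)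
    have "(indicator (dom_region J) :: _ \<Rightarrow> real) \<in> borel_measurable borel" by measurable
    from integral_permuted[OF pi(1) this] show ?thesis
      by (simp add: indicator_permuted[OF pi(1)] pi)
  qed
  have "1 = (\<Sum>J\<in>supports. \<integral>x. indicator (dom_region J) x * (1::real) \<partial>\<nu>)"
    using integral_partition[of "\<lambda>_. 1"] prob_space by simp
  also have "\<dots> = real (card supports) * (\<integral>x. indicator (dom_region I) x \<partial>\<nu>)"
    using eq by simp
  finally have "(\<integral>x. indicator (dom_region I) x \<partial>\<nu>) * real (card supports) = 1" by (simp only: mult.commute)
  moreover have "real (card supports) \<noteq> 0" using supports_pos by linarith
  ultimately show ?thesis by (metis nonzero_eq_divide_eq)
qed

definition gamma2 :: real where
  "gamma2 = (\<integral>x. (\<Sum>j=1..S. (rearr x j)\<^sup>2) \<partial>\<nu>)"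

definition lam :: real where
  "lam = gamma2 / real S - (1 - gamma2) / (real CARD('k) - real S)"

lemma gamma2_eq: "gamma2 = (\<Sum>I\<in>supports. \<Sum>i\<in>I. moment I i)"
proof -
  let ?g = "\<lambda>x::real^'k. \<Sum>I\<in>supports. indicator (dom_region I) x * (\<Sum>i\<in>I. (x $ i)\<^sup>2)"
  have c: "continuous_on UNIV (\<lambda>x::real^'k. \<Sum>i\<in>I. (x $ i)\<^sup>2)" for I
    by (intro continuous_intros)
  have cm: "(\<lambda>x::real^'k. \<Sum>i\<in>I. (x $ i)\<^sup>2) \<in> borel_measurable borel" for I
    by (rule borel_measurable_continuous_onI[OF c])
  have "gamma2 = (\<integral>x. ?g x \<partial>\<nu>)"
    unfolding gamma2_def
  proof (rule integral_cong_AE)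
    have "(\<lambda>x::real^'k. Max ((\<lambda>I. \<Sum>i\<in>I. (x $ i)\<^sup>2) ` supports)) \<in> borel_measurable borel"
      using supports_pos cm by (intro borel_measurable_Max) (auto simp: card_gt_0_iff)
    moreover have "(\<lambda>x::real^'k. \<Sum>j=1..S. (rearr x j)\<^sup>2) = (\<lambda>x. Max ((\<lambda>I. \<Sum>i\<in>I. (x $ i)\<^sup>2) ` supports))"
      using S_less by (intro ext sum_rearr_eq_Max(1)) simp
    ultimately show "(\<lambda>x. \<Sum>j=1..S. (rearr x j)\<^sup>2) \<in> borel_measurable \<nu>" by simp
    show "?g \<in> borel_measurable \<nu>" using cm by measurable
    show "AE x in \<nu>. (\<Sum>j=1..S. (rearr x j)\<^sup>2) = ?g x"
      using AE_partition
    proof eventually_elim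
      case (elim x)
      have "?g x = (\<Sum>I\<in>supports. indicator (dom_region I) x * (\<Sum>j=1..S. (rearr x j)\<^sup>2))"
        using sum_rearr_eq_Max(2)[of S _ x] S_less by (intro sum.cong) (auto simp: indicator_def)
      also have "\<dots> = (\<Sum>j=1..S. (rearr x j)\<^sup>2)" using elim by (simp flip: sum_distrib_right)
      finally show ?case by simp
    qed
  qed
  also have "\<dots> = (\<Sum>I\<in>supports. \<integral>x. indicator (dom_region I) x * (\<Sum>i\<in>I. (x $ i)\<^sup>2) \<partial>\<nu>)"
    by (rule Bochner_Integration.integral_sum) (rule integrable_indicator_continuous[OF c])
  also have "\<dots> = (\<Sum>I\<in>supports. \<Sum>i\<in>I. moment I i)"
    unfolding moment_def sum_distrib_left
    by (intro sum.cong refl Bochner_Integration.integral_sum integrable_indicator_continuous continuous_intros)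
  finally show ?thesis .
qed

lemma sum_moment: "(\<Sum>I\<in>supports. \<Sum>i\<in>UNIV. moment I i) = 1"
proof -
  have "1 = (\<integral>x. (\<Sum>i\<in>UNIV. (x $ i)\<^sup>2) \<partial>\<nu>)"
  proof -
    have "(\<integral>x. (\<Sum>i\<in>UNIV. (x $ i)\<^sup>2) \<partial>\<nu>) = (\<integral>x. 1 \<partial>\<nu>)"
    proof (rule integral_cong_AE)
      show "(\<lambda>x. \<Sum>i\<in>UNIV. (x $ i)\<^sup>2) \<in> borel_measurable \<nu>"
        using borel_measurable_continuous_onI[of "\<lambda>x::real^'k. \<Sum>i\<in>UNIV. (x $ i)\<^sup>2"]
        by (simp add: continuous_intros)
      show "AE x in \<nu>. (\<Sum>i\<in>UNIV. (x $ i)\<^sup>2) = 1"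
        using AE_sphere by eventually_elim (simp add: norm_vec_def L2_set_def)
    qed simp
    then show ?thesis using prob_space by simp
  qed
  also have "\<dots> = (\<Sum>I\<in>supports. \<integral>x. indicator (dom_region I) x * (\<Sum>i\<in>UNIV. (x $ i)\<^sup>2) \<partial>\<nu>)"
    by (intro integral_partition continuous_intros)
  also have "\<dots> = (\<Sum>I\<in>supports. \<Sum>i\<in>UNIV. moment I i)"
    unfolding moment_def sum_distrib_left
    by (intro sum.cong refl Bochner_Integration.integral_sum integrable_indicator_continuous continuous_intros)
  finally show ?thesis by simp
qed

text \<open>\<open>gamma2 / S\<close> and \<open>(1 - gamma2) / (K - S)\<close> are the two values
  of the moments, inside and outside, multiplied by the number of supports. So \<open>lam\<close> is
  the contrast in energy per entry, and it is bounded by the energy per entry inside.\<close>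

lemma lam_moment:
  assumes "card I = S" "i \<in> I" "j \<notin> I"
  shows "lam = real (card supports) * (moment I i - moment I j)" and "lam * real S \<le> 1"
proof -
  let ?n = "real (card supports)" and ?K = "real CARD('k)"
  have in1: "moment J m = moment I i" if "card J = S" "m \<in> J" for J m
    using that assms by (intro moment_eq) auto
  have out1: "moment J m = moment I j" if "card J = S" "m \<notin> J" for J m
    using that assms by (intro moment_eq) auto
  have "gamma2 = (\<Sum>J\<in>supports. \<Sum>m\<in>J. moment I i)"
    unfolding gamma2_eq using in1 by (intro sum.cong) auto
  then have g: "gamma2 = ?n * real S * moment I i" by simp
  have "1 = (\<Sum>J\<in>supports. (\<Sum>m\<in>J. moment J m) + (\<Sum>m\<in>-J. moment J m))"
    unfolding sum_moment[symmetric]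
    by (intro sum.cong refl) (subst sum.union_disjoint[symmetric], auto)
  also have "\<dots> = (\<Sum>J\<in>supports. (\<Sum>m\<in>J. moment I i) + (\<Sum>m\<in>-J. moment I j))"
    using in1 out1 by (intro sum.cong refl arg_cong2[of _ _ _ _ "(+)"]) auto
  also have "\<dots> = (\<Sum>J\<in>supports. real S * moment I i + (?K - real S) * moment I j)"
    using S_less by (intro sum.cong) (auto simp: Compl_eq_Diff_UNIV card_Diff_subset of_nat_diff)
  finally have o: "1 = ?n * (real S * moment I i + (?K - real S) * moment I j)" by simp
  have KS: "?K - real S > 0" using S_less by simp
  have "1 - gamma2 = ?n * moment I j * (?K - real S)" using g o by (simp add: algebra_simps)
  then have "(1 - gamma2) / (?K - real S) = ?n * moment I j" using KS by simp
  moreover have "gamma2 / real S = ?n * moment I i" using g S_pos by simp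
  ultimately show l: "lam = ?n * (moment I i - moment I j)" unfolding lam_def by (simp add: algebra_simps)
  have "?n * (?K - real S) * moment I j \<ge> 0" "?n * moment I j * real S \<ge> 0"
    using KS moment_nonneg by auto
  then show "lam * real S \<le> 1" unfolding l using o by (simp add: algebra_simps)
qed

lemma lam_le: "lam * real S \<le> 1"
proof -
  obtain I :: "'k set" where I: "card I = S" using supports_pos by (auto simp: card_gt_0_iff)
  then have "I \<noteq> {}" "I \<noteq> UNIV" using S_pos S_less by auto
  then obtain i j where "i \<in> I" "j \<notin> I" by auto
  then show ?thesis using lam_moment(2)[OF I] by blast
qed

lemma continuous_synth: "continuous_on UNIV (synth \<Phi>)"
  unfolding synth_def by (intro continuous_intros)

lemma continuous_norm_proj: "continuous_on UNIV (\<lambda>x. (norm (proj_I \<Psi> J (synth \<Phi> x)))\<^sup>2)"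
proof -
  have "continuous_on UNIV (proj_I \<Psi> J)"
    by (intro linear_continuous_on linear_conv_bounded_linear[THEN iffD1] linear_proj_I)
  then have "continuous_on UNIV (\<lambda>x. proj_I \<Psi> J (synth \<Phi> x))"
    by (rule continuous_on_compose2[OF _ continuous_synth]) simp
  then show ?thesis by (intro continuous_intros)
qed

lemma integral_norm_proj:
  fixes \<Psi> :: "'k \<Rightarrow> real^'d"
  shows "(\<integral>x. indicator (dom_region I) x * (norm (proj_I \<Psi> J (synth \<Phi> x)))\<^sup>2 \<partial>\<nu>) =
    (\<Sum>i\<in>UNIV. moment I i * (norm (proj_I \<Psi> J (\<Phi> i)))\<^sup>2)"
proof -
  have avg: "(\<Sum>U\<in>UNIV. (norm (proj_I \<Psi> J (synth \<Phi> (signed U x))))\<^sup>2) / 2 ^ CARD('k)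
      = (\<Sum>i\<in>UNIV. (x $ i)\<^sup>2 * (norm (proj_I \<Psi> J (\<Phi> i)))\<^sup>2)" for x
    using sum_flip_proj_synth[of \<Psi> J \<Phi> "\<lambda>i. x $ i"] by (simp add: signed_def)
  have "(\<integral>x. indicator (dom_region I) x * (norm (proj_I \<Psi> J (synth \<Phi> x)))\<^sup>2 \<partial>\<nu>) =
    (\<integral>x. (\<Sum>i\<in>UNIV. indicator (dom_region I) x * ((x $ i)\<^sup>2 * (norm (proj_I \<Psi> J (\<Phi> i)))\<^sup>2)) \<partial>\<nu>)"
    unfolding integral_sign_average[OF continuous_norm_proj] avg sum_distrib_left ..
  also have "\<dots> = (\<Sum>i\<in>UNIV. \<integral>x. indicator (dom_region I) x * ((x $ i)\<^sup>2 * (norm (proj_I \<Psi> J (\<Phi> i)))\<^sup>2) \<partial>\<nu>)"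
    by (intro Bochner_Integration.integral_sum integrable_indicator_continuous continuous_intros)
  also have "\<dots> = (\<Sum>i\<in>UNIV. moment I i * (norm (proj_I \<Psi> J (\<Phi> i)))\<^sup>2)"
    unfolding moment_def by (intro sum.cong refl) (simp add: mult.assoc[symmetric])
  finally show ?thesis .
qed

text \<open>The atoms outside the support contribute \<open>A\<close> times a difference of dimensions, by
  tightness of the frame.\<close>

lemma integral_drop:
  assumes I: "card I = S"
  shows "lam / real (card supports) * (\<Sum>i\<in>I. (norm (\<Phi> i - proj_I \<Psi> I (\<Phi> i)))\<^sup>2)
    \<le> (\<integral>x. indicator (dom_region I) x *
        ((norm (proj_I \<Phi> I (synth \<Phi> x)))\<^sup>2 - (norm (proj_I \<Psi> I (synth \<Phi> x)))\<^sup>2) \<partial>\<nu>)"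
proof -
  have "I \<noteq> {}" "I \<noteq> UNIV" using I S_pos S_less by auto
  then obtain i0 j0 where i0: "i0 \<in> I" "j0 \<notin> I" by auto
  let ?a = "moment I i0" and ?b = "moment I j0"
  let ?d = "\<lambda>i. (norm (proj_I \<Phi> I (\<Phi> i)))\<^sup>2 - (norm (proj_I \<Psi> I (\<Phi> i)))\<^sup>2"
  have res: "?d i = (norm (\<Phi> i - proj_I \<Psi> I (\<Phi> i)))\<^sup>2" if "i \<in> I" for i
    using that proj_I_pythagoras[of "\<Phi> i" \<Psi> I] unit by (simp add: proj_I_atom)
  \<comment> \<open>The atoms of \<open>\<Psi>\<close> may be dependent while those of
    \<open>\<Phi>\<close> on \<open>I\<close> are not, so the difference of dimensions has the
    favourable sign.\<close>
  have "dim (span (\<Psi> ` I)) \<le> card (\<Psi> ` I)" by (simp add: dim_le_card')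
  also have "\<dots> \<le> S" using I card_image_le[of I \<Psi>] by simp
  finally have dim: "dim (span (\<Psi> ` I)) \<le> S" .
  have "(\<Sum>i\<in>UNIV. ?d i) = A * real S - A * real (dim (span (\<Psi> ` I)))"
    unfolding sum_subtractf proj_I_def tight_frame_trace[OF frame subspace_span_image]
    using dim_span_atoms[of I] I by simp
  also have "\<dots> \<ge> 0" using dim A_ge_1 by simp
  finally have tr: "0 \<le> (\<Sum>i\<in>UNIV. ?d i)" .
  have "(\<Sum>i\<in>UNIV. moment I i * ?d i) = (\<Sum>i\<in>UNIV. (if i \<in> I then (?a - ?b) * ?d i else 0) + ?b * ?d i)"
  proof (rule sum.cong)
    fix i show "moment I i * ?d i = (if i \<in> I then (?a - ?b) * ?d i else 0) + ?b * ?d i"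
      using moment_eq[of I I i i0] moment_eq[of I I i j0] i0 by (auto simp: algebra_simps)
  qed simp
  also have "\<dots> = (?a - ?b) * (\<Sum>i\<in>I. ?d i) + ?b * (\<Sum>i\<in>UNIV. ?d i)"
    by (simp add: sum.distrib sum_distrib_left sum.If_cases)
  also have "(\<Sum>i\<in>I. ?d i) = (\<Sum>i\<in>I. (norm (\<Phi> i - proj_I \<Psi> I (\<Phi> i)))\<^sup>2)"
    using res by (rule sum.cong[OF refl])
  also have "?a - ?b = lam / real (card supports)"
  proof -
    have "real (card supports) \<noteq> 0" using supports_pos by linarith
    then show ?thesis unfolding lam_moment(1)[OF I i0] by (metis nonzero_mult_div_cancel_left)
  qed
  finally have "lam / real (card supports) * (\<Sum>i\<in>I. (norm (\<Phi> i - proj_I \<Psi> I (\<Phi> i)))\<^sup>2)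
      \<le> (\<Sum>i\<in>UNIV. moment I i * ?d i)"
    using mult_nonneg_nonneg[OF moment_nonneg[of I j0] tr] by simp
  also have "\<dots> = (\<integral>x. indicator (dom_region I) x * (norm (proj_I \<Phi> I (synth \<Phi> x)))\<^sup>2 \<partial>\<nu>)
      - (\<integral>x. indicator (dom_region I) x * (norm (proj_I \<Psi> I (synth \<Phi> x)))\<^sup>2 \<partial>\<nu>)"
    unfolding integral_norm_proj by (simp add: sum_subtractf right_diff_distrib)
  also have "\<dots> = (\<integral>x. indicator (dom_region I) x * (norm (proj_I \<Phi> I (synth \<Phi> x)))\<^sup>2
      - indicator (dom_region I) x * (norm (proj_I \<Psi> I (synth \<Phi> x)))\<^sup>2 \<partial>\<nu>)"
    by (intro Bochner_Integration.integral_diff[symmetric] integrable_indicator_continuous continuous_norm_proj)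
  finally show ?thesis by (simp add: right_diff_distrib)
qed

lemma continuous_exp_norm: "continuous_on UNIV (\<lambda>x. exp ((norm (synth \<Phi> x))\<^sup>2 / 4))"
  by (intro continuous_intros continuous_on_compose2[OF continuous_on_norm_id continuous_synth]) auto

text \<open>For fixed \<open>x\<close> the signs turn \<open>synth \<Phi> x\<close> into a random
  sum whose summands have total squared norm 1, as the atoms are unit vectors. The exponent
  \<open>1 / 4\<close> then becomes \<open>(1 / 4) / (1 - 1 / 2) = 1 / 2\<close>, so the bound
  depends neither on \<open>A\<close> nor on the dimensions.\<close>

lemma integral_exp_norm:
  assumes I: "card I = S"
  shows "(\<integral>x. indicator (dom_region I) x * exp ((norm (synth \<Phi> x))\<^sup>2 / 4) \<partial>\<nu>) \<le> 5 / 3 / real (card supports)"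
proof -
  let ?f = "\<lambda>x. exp ((norm (synth \<Phi> x))\<^sup>2 / 4)"
  have avg: "(\<Sum>U\<in>UNIV. ?f (signed U x)) / 2 ^ CARD('k) \<le> 5 / 3" if x: "norm x = 1" for x
  proof -
    let ?v = "\<lambda>i. x $ i *\<^sub>R \<Phi> i"
    have one: "(\<Sum>i\<in>UNIV. (norm (?v i))\<^sup>2) = 1"
      using x by (simp add: unit norm_vec_def[of x] L2_set_def)
    have "synth \<Phi> (signed U x) = 0 + (\<Sum>i\<in>UNIV. flip U i *\<^sub>R ?v i)" for U
      by (simp add: synth_def signed_def)
    then have "(\<Sum>U\<in>UNIV. ?f (signed U x)) = (\<Sum>U\<in>Pow UNIV. exp (1 / 4 * (norm (0 + (\<Sum>i\<in>UNIV. flip U i *\<^sub>R ?v i)))\<^sup>2))"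
      by simp
    also have "\<dots> \<le> 2 ^ CARD('k) * exp (1 / 4 / (1 - 2 * (1 / 4) * (\<Sum>i\<in>UNIV. (norm (?v i))\<^sup>2)) *
        ((norm (0::real^'d))\<^sup>2 + (\<Sum>i\<in>UNIV. (norm (?v i))\<^sup>2)))"
      by (rule sum_flip_exp_norm_sq_le) (use one in auto)
    also have "\<dots> = 2 ^ CARD('k) * exp (1 / 2)" unfolding one by simp
    also have "\<dots> \<le> 2 ^ CARD('k) * (5 / 3)" using exp_half_le by (intro mult_left_mono) auto
    finally show ?thesis by (simp add: field_simps)
  qed
  have "(\<integral>x. indicator (dom_region I) x * ?f x \<partial>\<nu>) =
    (\<integral>x. indicator (dom_region I) x * ((\<Sum>U\<in>UNIV. ?f (signed U x)) / 2 ^ CARD('k)) \<partial>\<nu>)"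
    by (rule integral_sign_average[OF continuous_exp_norm])
  also have "\<dots> \<le> (\<integral>x. indicator (dom_region I) x * (5 / 3) \<partial>\<nu>)"
  proof (rule integral_mono_AE)
    show "AE x in \<nu>. indicator (dom_region I) x * ((\<Sum>U\<in>UNIV. ?f (signed U x)) / 2 ^ CARD('k))
        \<le> indicator (dom_region I) x * (5 / 3)"
      using AE_sphere by eventually_elim (intro mult_left_mono avg, auto)
    have "continuous_on UNIV (\<lambda>x. ?f (signed U x))" for U
      using continuous_on_compose2[OF continuous_exp_norm continuous_signed[of U]] by simp
    then show "integrable \<nu> (\<lambda>x. indicator (dom_region I) x * ((\<Sum>U\<in>UNIV. ?f (signed U x)) / 2 ^ CARD('k)))"
      by (intro integrable_indicator_continuous continuous_on_divide continuous_on_sum continuous_on_const) auto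
  qed (intro integrable_indicator_continuous continuous_intros)
  also have "\<dots> = 5 / 3 / real (card supports)" using prob_dom_region[OF I] by simp
  finally show ?thesis .
qed

end

section \<open>Exponential moment of the drop of the objective\<close>

text \<open>A set \<open>I\<close> arises from \<open>T\<close> by removing \<open>l\<close> exactly
  once for each of the \<open>K - S\<close> elements outside \<open>I\<close>.\<close>

lemma sum_supersets_double_count:
  fixes f :: "'k::finite set \<Rightarrow> real"
  shows "(\<Sum>T\<in>{T. card T = S + 1 \<and> k \<in> T}. \<Sum>l\<in>T - {k}. f (T - {l})) =
    (real CARD('k) - real S) * (\<Sum>I\<in>{I. card I = S \<and> k \<in> I}. f I)"
proof -
  have "(\<Sum>T\<in>{T. card T = S + 1 \<and> k \<in> T}. \<Sum>l\<in>T - {k}. f (T - {l})) =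
    (\<Sum>(T, l)\<in>Sigma {T. card T = S + 1 \<and> k \<in> T} (\<lambda>T. T - {k}). f (T - {l}))"
    by (simp add: sum.Sigma)
  also have "\<dots> = (\<Sum>(I, l)\<in>Sigma {I. card I = S \<and> k \<in> I} (\<lambda>I. - I). f I)"
    by (rule sum.reindex_bij_witness[where i="\<lambda>(I, l). (insert l I, l)" and j="\<lambda>(T, l). (T - {l}, l)"])
      (auto simp: insert_absorb)
  also have "\<dots> = (\<Sum>I\<in>{I. card I = S \<and> k \<in> I}. \<Sum>l\<in>-I. f I)"
    by (rule sum.Sigma[symmetric]) auto
  also have "\<dots> = (\<Sum>I\<in>{I. card I = S \<and> k \<in> I}. (real CARD('k) - real S) * f I)"
  proof (rule sum.cong)
    fix I :: "'k set" assume "I \<in> {I. card I = S \<and> k \<in> I}"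
    moreover have "card I \<le> CARD('k)" by (rule card_mono) auto
    ultimately show "(\<Sum>l\<in>-I. f I) = (real CARD('k) - real S) * f I"
      by (auto simp: Compl_eq_Diff_UNIV card_Diff_subset of_nat_diff)
  qed simp
  finally show ?thesis by (simp add: sum_distrib_left)
qed

text \<open>Transpositions show that the count is the same for every element; then the incidences
  between elements and supports are counted in both orders.\<close>

lemma card_supports_containing:
  fixes k :: "'k::finite"
  shows "card {I. card I = S \<and> k \<in> I} * CARD('k) = card {I :: 'k set. card I = S} * S"
proof -
  have eq: "card {I. card I = S \<and> j \<in> I} = card {I. card I = S \<and> k \<in> I}" for j :: 'k
  proof -
    let ?t = "Transposition.transpose j k"
    have inv: "?t ` ?t ` I = I" for I by (simp add: image_comp)
    have ct: "card (?t ` I) = card I" for I by (rule card_image) (rule inj_on_inverseI[of _ ?t], simp)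
    have jk: "k \<in> ?t ` I" if "j \<in> I" for I using imageI[OF that, of ?t] by simp
    have kj: "j \<in> ?t ` I" if "k \<in> I" for I using imageI[OF that, of ?t] by simp
    have "bij_betw (image ?t) {I. card I = S \<and> j \<in> I} {I. card I = S \<and> k \<in> I}"
    proof (rule bij_betw_byWitness[where f'="image ?t"])
      show "(`) ?t ` {I. card I = S \<and> j \<in> I} \<subseteq> {I. card I = S \<and> k \<in> I}"
        using ct jk by auto
      show "(`) ?t ` {I. card I = S \<and> k \<in> I} \<subseteq> {I. card I = S \<and> j \<in> I}"
        using ct kj by auto
    qed (use inv in auto)
    then show ?thesis by (rule bij_betw_same_card)
  qed
  have "card {I. card I = S \<and> k \<in> I} * CARD('k) = (\<Sum>j\<in>(UNIV::'k set). card {I. card I = S \<and> j \<in> I})"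
  proof -
    have "(\<Sum>j\<in>(UNIV::'k set). card {I. card I = S \<and> j \<in> I}) = (\<Sum>j\<in>(UNIV::'k set). card {I. card I = S \<and> k \<in> I})"
      by (rule sum.cong[OF refl eq])
    also have "\<dots> = card {I. card I = S \<and> k \<in> I} * CARD('k)" by (simp only: sum_constant of_nat_id mult.commute)
    finally show ?thesis by (rule sym)
  qed
  also have "\<dots> = (\<Sum>j\<in>(UNIV::'k set). \<Sum>I\<in>{I. card I = S}. if j \<in> I then 1 else 0)"
    by (intro sum.cong refl) (simp add: sum.If_cases Int_def)
  also have "\<dots> = (\<Sum>I\<in>{I :: 'k set. card I = S}. \<Sum>j\<in>UNIV. if j \<in> I then 1 else 0)"
    by (rule sum.swap)
  also have "\<dots> = (\<Sum>I\<in>{I :: 'k set. card I = S}. S)" by (intro sum.cong refl) (simp add: sum.If_cases)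
  finally show ?thesis by simp
qed

section \<open>Continuity and perturbation of the maximal projection\<close>

lemma continuous_on_Max_image:
  fixes f :: "'i \<Rightarrow> 'a::topological_space \<Rightarrow> real"
  assumes "finite \<I>" "\<I> \<noteq> {}" "\<And>i. i \<in> \<I> \<Longrightarrow> continuous_on X (f i)"
  shows "continuous_on X (\<lambda>x. Max ((\<lambda>i. f i x) ` \<I>))"
  using assms
proof (induction rule: finite_ne_induct)
  case (insert i \<I>)
  then have "(\<lambda>x. Max ((\<lambda>i. f i x) ` insert i \<I>)) = (\<lambda>x. max (f i x) (Max ((\<lambda>i. f i x) ` \<I>)))"
    by simp
  then show ?case using insert by (simp add: continuous_on_max)
qed simp

lemma abs_Max_diff_le:
  fixes f g :: "'i \<Rightarrow> real"
  assumes "finite \<I>" "\<I> \<noteq> {}" "\<And>i. i \<in> \<I> \<Longrightarrow> \<bar>f i - g i\<bar> \<le> c"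
  shows "\<bar>Max (f ` \<I>) - Max (g ` \<I>)\<bar> \<le> c"
proof -
  have *: "Max (f ` \<I>) \<le> Max (g ` \<I>) + c" if "\<And>i. i \<in> \<I> \<Longrightarrow> \<bar>f i - g i\<bar> \<le> c" for f g :: "'i \<Rightarrow> real"
  proof (rule Max.boundedI)
    fix a assume "a \<in> f ` \<I>"
    then obtain i where i: "i \<in> \<I>" "a = f i" by auto
    then have "g i \<le> Max (g ` \<I>)" using assms(1) by simp
    then show "a \<le> Max (g ` \<I>) + c" using that[OF i(1)] i(2) by simp
  qed (use assms in auto)
  have "Max (f ` \<I>) \<le> Max (g ` \<I>) + c" "Max (g ` \<I>) \<le> Max (f ` \<I>) + c"
    using *[of f g] *[of g f] assms(3) by (auto simp: abs_minus_commute)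
  then show ?thesis by simp
qed

lemma exp_minus_le_quadratic:
  fixes w :: real
  shows "exp (- w) \<le> 1 - w + w\<^sup>2 / 2 * exp \<bar>w\<bar>"
proof -
  obtain t where t: "\<bar>t\<bar> \<le> \<bar>- w\<bar>" "exp (- w) = (\<Sum>m<2. (- w) ^ m / fact m) + (exp t / fact 2) * (- w) ^ 2"
    using Maclaurin_exp_le[of "- w" 2] by blast
  have "exp t * (w\<^sup>2 / 2) \<le> exp \<bar>w\<bar> * (w\<^sup>2 / 2)" using t(1) by (intro mult_right_mono) auto
  then show ?thesis using t(2) by (simp add: numeral_2_eq_2 mult.commute)
qed

definition max_proj :: "nat \<Rightarrow> ('k::finite \<Rightarrow> real^'d) \<Rightarrow> real^'d \<Rightarrow> real" where
  "max_proj S \<Psi> y = Max ((\<lambda>I. (norm (proj_I \<Psi> I y))\<^sup>2) ` {I. card I \<le> S})"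

lemma obj_max_proj: "obj S N y \<Psi> = (1 / real N) * (\<Sum>n=1..N. max_proj S \<Psi> (y n))"
  by (simp add: obj_def max_proj_def)

lemma supports_le_nonempty: "{I :: 'k::finite set. card I \<le> S} \<noteq> {}"
  by (auto intro!: exI[of _ "{}"])

lemma max_proj_close:
  fixes \<Phi> \<Psi> :: "'k::finite \<Rightarrow> real^'d"
  assumes "\<And>J. card J \<le> S \<Longrightarrow> norm (proj_I \<Phi> J y - proj_I \<Psi> J y) \<le> \<theta> * norm y"
  shows "\<bar>max_proj S \<Phi> y - max_proj S \<Psi> y\<bar> \<le> \<theta> * (norm y)\<^sup>2"
  unfolding max_proj_def
  by (intro abs_Max_diff_le supports_le_nonempty proj_I_norm_sq_close assms) auto

lemma max_proj_eqI:
  fixes \<Psi> :: "'k::finite \<Rightarrow> real^'d"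
  assumes "card I \<le> S" "\<And>J. card J \<le> S \<Longrightarrow> norm (proj_I \<Psi> J y) \<le> norm (proj_I \<Psi> I y)"
  shows "max_proj S \<Psi> y = (norm (proj_I \<Psi> I y))\<^sup>2"
  unfolding max_proj_def using assms by (intro Max_eqI) (auto intro: power_mono)

section \<open>Averaged residuals and the exponential moment\<close>

context gap_model
begin

text \<open>The estimate for one set of \<open>S + 1\<close> atoms is summed over all such sets
  containing \<open>k\<close>. Double counting turns this into a sum over supports, where the
  additional \<open>1 / S\<close> accounts for the \<open>S\<close> choices of the removed
  atom.\<close>

lemma residual_average:
  assumes z: "z \<bullet> \<Phi> k = 0"
  shows "real (card {I. card I = S \<and> k \<in> I}) * (4 * \<kappa>\<^sup>2 / (real S * (real S + 3)) * (norm z)\<^sup>2)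
    \<le> (\<Sum>I\<in>{I. card I = S \<and> k \<in> I}. (norm (z - proj_I \<Phi> I z))\<^sup>2)"
proof -
  obtain x where x: "norm x = 1" "gap_at \<Phi> S \<kappa> x" using ex_gap_point by blast
  let ?c = "4 * \<kappa>\<^sup>2 / (real S + 3) * (norm z)\<^sup>2" and ?KS = "real CARD('k) - real S"
  let ?T = "{T. card T = S + 1 \<and> k \<in> T}" and ?I = "{I. card I = S \<and> k \<in> I}"
  have KS: "0 < ?KS" using S_less by simp
  have "(\<Sum>T\<in>?T. \<Sum>l\<in>T - {k}. (1::real)) = ?KS * (\<Sum>I\<in>?I. 1)"
    by (rule sum_supersets_double_count)
  also have "(\<Sum>T\<in>?T. \<Sum>l\<in>T - {k}. (1::real)) = (\<Sum>T\<in>?T. real S)" by (intro sum.cong) auto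
  finally have n: "real (card ?T) * real S = ?KS * real (card ?I)" by simp
  have "real (card ?T) * ?c = (\<Sum>T\<in>?T. ?c)" by simp
  also have "\<dots> \<le> (\<Sum>T\<in>?T. \<Sum>l\<in>T - {k}. (norm (z - proj_I \<Phi> (T - {l}) z))\<^sup>2)"
    by (intro sum_mono gap_at_sum_residual[OF x(2) kappa_pos unit _ _ S_pos x(1) z]) auto
  also have "\<dots> = ?KS * (\<Sum>I\<in>?I. (norm (z - proj_I \<Phi> I z))\<^sup>2)"
    by (rule sum_supersets_double_count)
  finally have le: "real (card ?T) * ?c \<le> ?KS * (\<Sum>I\<in>?I. (norm (z - proj_I \<Phi> I z))\<^sup>2)" .
  have "?KS * (real (card ?I) * (4 * \<kappa>\<^sup>2 / (real S * (real S + 3)) * (norm z)\<^sup>2))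
    = (?KS * real (card ?I)) * (?c / real S)" by (simp add: mult_ac)
  also have "\<dots> = real (card ?T) * ?c" unfolding n[symmetric] using S_pos by simp
  finally have "?KS * (real (card ?I) * (4 * \<kappa>\<^sup>2 / (real S * (real S + 3)) * (norm z)\<^sup>2))
    \<le> ?KS * (\<Sum>I\<in>?I. (norm (z - proj_I \<Phi> I z))\<^sup>2)" using le by simp
  then show ?thesis using KS by (simp only: mult_le_cancel_left_pos)
qed

definition residual :: "('k \<Rightarrow> real^'d) \<Rightarrow> 'k set \<Rightarrow> real" where
  "residual \<Psi> I = (\<Sum>i\<in>I. (norm (\<Phi> i - proj_I \<Psi> I (\<Phi> i)))\<^sup>2)"

lemma residual_nonneg: "0 \<le> residual \<Psi> I"
  by (simp add: residual_def sum_nonneg)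

text \<open>The average bound concerns spans of \<open>\<Phi>\<close> atoms and vectors orthogonal
  to \<open>\<Phi> k\<close>, whereas the residual concerns \<open>\<Phi> k\<close> and spans of
  \<open>\<Psi>\<close> atoms. The vector \<open>g\<close> bridges this, and replacing the span
  costs \<open>\<theta> * norm g\<close>, which the condition
  \<open>8 * \<theta>\<^sup>2 \<le> c\<close> absorbs.\<close>

lemma residual_sum_ge:
  assumes psi: "norm (\<Psi> k) = 1" "norm (\<Psi> k - \<Phi> k) = r" and r: "0 \<le> r" "r \<le> 1" and th: "0 \<le> \<theta>"
    and close: "\<And>I y. card I = S \<Longrightarrow> norm (proj_I \<Phi> I y - proj_I \<Psi> I y) \<le> \<theta> * norm y"
    and c: "8 * \<theta>\<^sup>2 \<le> c" "c \<le> 8 * \<kappa>\<^sup>2 / (real S * (real S + 3))"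
  shows "r\<^sup>2 * c / 8 * real S * real (card supports) \<le> real CARD('k) * (\<Sum>I\<in>supports. residual \<Psi> I)"
proof -
  let ?I = "{I. card I = S \<and> k \<in> I}"
  define b where "b = \<Phi> k \<bullet> \<Psi> k"
  have "r\<^sup>2 = (norm (\<Psi> k - \<Phi> k))\<^sup>2" using psi by simp
  also have "\<dots> = (norm (\<Psi> k))\<^sup>2 + (norm (\<Phi> k))\<^sup>2 - 2 * b"
    by (simp add: power2_norm_eq_inner inner_diff_left inner_diff_right inner_commute b_def)
  finally have "r\<^sup>2 = 2 - 2 * b" using psi(1) unit by simp
  then have b: "b = 1 - r\<^sup>2 / 2" by linarith
  have r1: "r\<^sup>2 \<le> 1" using r by (simp add: power_le_one)
  have b0: "0 < b" using b r1 by simp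
  \<comment> \<open>Subtracting a multiple of \<open>\<Psi> k\<close> does not change the residual
    with respect to any span containing \<open>\<Psi> k\<close>; the multiple is chosen to make
    \<open>g\<close> orthogonal to \<open>\<Phi> k\<close>.\<close>
  define g where "g = \<Phi> k - (1 / b) *\<^sub>R \<Psi> k"
  have pp: "\<Phi> k \<bullet> \<Phi> k = 1" "\<Psi> k \<bullet> \<Psi> k = 1" using unit[of k] psi(1) by (simp_all add: norm_eq_1)
  have bc: "\<Psi> k \<bullet> \<Phi> k = b" "\<Phi> k \<bullet> \<Psi> k = b" by (simp_all add: b_def inner_commute)
  have gk: "g \<bullet> \<Phi> k = 0" using b0 by (simp add: g_def inner_diff_left pp bc)
  have "(norm g)\<^sup>2 = 1 - 2 * (1 / b) * b + (1 / b)\<^sup>2"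
    unfolding g_def power2_norm_eq_inner using b0
    by (simp add: inner_diff_left inner_diff_right pp bc power2_eq_square field_simps)
  then have g2: "(norm g)\<^sup>2 = (1 / b)\<^sup>2 - 1" using b0 by simp
  \<comment> \<open>\<open>b\<close> is the cosine of the angle between the two atoms and
    \<open>norm g\<close> its tangent, which is at least the chord length \<open>r\<close>.\<close>
  have "b\<^sup>2 * (1 + r\<^sup>2) = 1 - (r\<^sup>2)\<^sup>2 * (3 - r\<^sup>2) / 4"
    unfolding b by (simp add: power2_eq_square field_simps)
  also have "\<dots> \<le> 1" using r1 by simp
  finally have "1 + r\<^sup>2 \<le> (1 / b)\<^sup>2" using b0 by (simp add: power_divide field_simps)
  then have g_ge: "r\<^sup>2 \<le> (norm g)\<^sup>2" unfolding g2 by simp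
  have one: "(norm (g - proj_I \<Phi> I g))\<^sup>2 / 2 - \<theta>\<^sup>2 * (norm g)\<^sup>2 \<le> residual \<Psi> I" if "I \<in> ?I" for I
  proof -
    have I: "card I = S" "k \<in> I" using that by auto
    have "g - proj_I \<Psi> I g = \<Phi> k - proj_I \<Psi> I (\<Phi> k)"
      unfolding g_def using I
      by (simp add: linear_diff[OF linear_proj_I] linear_cmul[OF linear_proj_I] proj_I_atom)
    moreover have "norm (g - proj_I \<Phi> I g) \<le> norm (g - proj_I \<Psi> I g) + \<theta> * norm g"
      using norm_triangle_ineq4[of "g - proj_I \<Psi> I g" "proj_I \<Phi> I g - proj_I \<Psi> I g"] close[OF I(1), of g] by simp
    ultimately have "(norm (g - proj_I \<Phi> I g))\<^sup>2 \<le> (norm (\<Phi> k - proj_I \<Psi> I (\<Phi> k)) + \<theta> * norm g)\<^sup>2"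
      by (intro power_mono) auto
    also have "\<dots> \<le> 2 * (norm (\<Phi> k - proj_I \<Psi> I (\<Phi> k)))\<^sup>2 + 2 * (\<theta> * norm g)\<^sup>2"
      by (smt (verit) power2_sum power2_diff zero_le_power2)
    also have "(norm (\<Phi> k - proj_I \<Psi> I (\<Phi> k)))\<^sup>2 \<le> residual \<Psi> I"
      unfolding residual_def using I by (intro member_le_sum) auto
    finally show ?thesis by (simp add: power_mult_distrib)
  qed
  have "real (card ?I) * (r\<^sup>2 * c / 8) \<le> real (card ?I) * ((norm g)\<^sup>2 * c / 8)"
    using g_ge c(1) order_trans[OF _ c(1), of 0]
    by (intro mult_left_mono divide_right_mono mult_right_mono) auto
  also have "\<dots> \<le> real (card ?I) * ((c / 2) * (norm g)\<^sup>2) / 2 - real (card ?I) * (\<theta>\<^sup>2 * (norm g)\<^sup>2)"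
  proof -
    have "\<theta>\<^sup>2 * (norm g)\<^sup>2 \<le> c / 8 * (norm g)\<^sup>2" using c(1) by (intro mult_right_mono) auto
    then have "(norm g)\<^sup>2 * c / 8 \<le> c / 4 * (norm g)\<^sup>2 - \<theta>\<^sup>2 * (norm g)\<^sup>2" by simp
    then have "real (card ?I) * ((norm g)\<^sup>2 * c / 8) \<le> real (card ?I) * (c / 4 * (norm g)\<^sup>2 - \<theta>\<^sup>2 * (norm g)\<^sup>2)"
      by (intro mult_left_mono) auto
    then show ?thesis by (simp add: algebra_simps)
  qed
  also have "\<dots> \<le> (\<Sum>I\<in>?I. (norm (g - proj_I \<Phi> I g))\<^sup>2) / 2 - real (card ?I) * (\<theta>\<^sup>2 * (norm g)\<^sup>2)"
  proof -
    have "(c / 2) * (norm g)\<^sup>2 \<le> 4 * \<kappa>\<^sup>2 / (real S * (real S + 3)) * (norm g)\<^sup>2"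
      using c(2) by (intro mult_right_mono) auto
    then have "real (card ?I) * ((c / 2) * (norm g)\<^sup>2) \<le> real (card ?I) * (4 * \<kappa>\<^sup>2 / (real S * (real S + 3)) * (norm g)\<^sup>2)"
      by (intro mult_left_mono) auto
    also note residual_average[OF gk]
    finally show ?thesis by (intro diff_right_mono divide_right_mono) auto
  qed
  also have "\<dots> = (\<Sum>I\<in>?I. (norm (g - proj_I \<Phi> I g))\<^sup>2 / 2 - \<theta>\<^sup>2 * (norm g)\<^sup>2)"
    by (simp add: sum_subtractf sum_divide_distrib)
  also have "\<dots> \<le> (\<Sum>I\<in>?I. residual \<Psi> I)" by (rule sum_mono) (rule one)
  also have "\<dots> \<le> (\<Sum>I\<in>supports. residual \<Psi> I)"
    by (rule sum_mono2) (auto simp: residual_nonneg)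
  finally have main: "real CARD('k) * (real (card ?I) * (r\<^sup>2 * c / 8)) \<le> real CARD('k) * (\<Sum>I\<in>supports. residual \<Psi> I)"
    by (intro mult_left_mono) auto
  have e2: "real (card ?I) * real CARD('k) = real (card supports) * real S"
    using card_supports_containing[of S k] by (simp flip: of_nat_mult)
  have e1: "real CARD('k) * (real (card ?I) * (r\<^sup>2 * c / 8)) = (real (card ?I) * real CARD('k)) * (r\<^sup>2 * c / 8)"
    by simp
  have e3: "r\<^sup>2 * c / 8 * real S * real (card supports) = (real (card supports) * real S) * (r\<^sup>2 * c / 8)"
    by simp
  show ?thesis unfolding e3 e2[symmetric] using main unfolding e1 .
qed

definition loss_diff :: "('k \<Rightarrow> real^'d) \<Rightarrow> real^'k \<Rightarrow> real" where
  "loss_diff \<Psi> x = max_proj S \<Phi> (synth \<Phi> x) - max_proj S \<Psi> (synth \<Phi> x)"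

lemma continuous_loss_diff: "continuous_on UNIV (loss_diff \<Psi>)"
  unfolding loss_diff_def max_proj_def
  by (intro continuous_on_diff continuous_on_Max_image supports_le_nonempty continuous_norm_proj) auto

text \<open>If \<open>\<theta> * norm (synth \<Phi> x) < \<kappa>\<close> the optimal support of \<open>x\<close> is the same for \<open>\<Phi>\<close> and \<open>\<Psi>\<close>. The
  remaining \<open>x\<close> are exponentially rare and absorbed by the last summand.\<close>

lemma exp_loss_diff_le:
  assumes x: "gap_at \<Phi> S \<kappa> x" and I: "card I = S" "x \<in> dom_region I"
    and th: "0 < \<theta>" and s: "0 < s" "s * \<theta> \<le> 1 / 8" and eta: "0 < \<eta>"
    and close: "\<And>J y. card J \<le> S \<Longrightarrow> norm (proj_I \<Phi> J y - proj_I \<Psi> J y) \<le> \<theta> * norm y"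
    and closeI: "\<And>y. norm (proj_I \<Phi> I y - proj_I \<Psi> I y) \<le> sqrt (residual \<Psi> I / \<eta>) * norm y"
    and sq: "sqrt (residual \<Psi> I / \<eta>) \<le> \<theta>"
  shows "exp (- s * loss_diff \<Psi> x) \<le>
    1 - s * ((norm (proj_I \<Phi> I (synth \<Phi> x)))\<^sup>2 - (norm (proj_I \<Psi> I (synth \<Phi> x)))\<^sup>2)
    + (64 * s\<^sup>2 * residual \<Psi> I / \<eta> + exp (- \<kappa>\<^sup>2 / (8 * \<theta>\<^sup>2))) * exp ((norm (synth \<Phi> x))\<^sup>2 / 4)"
proof -
  let ?y = "synth \<Phi> x"
  let ?W = "(norm (proj_I \<Phi> I ?y))\<^sup>2 - (norm (proj_I \<Psi> I ?y))\<^sup>2"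
  define n where "n = (norm ?y)\<^sup>2"
  have n0: "0 \<le> n" by (simp add: n_def)
  have W1: "\<bar>?W\<bar> \<le> sqrt (residual \<Psi> I / \<eta>) * n"
    unfolding n_def by (rule proj_I_norm_sq_close[OF closeI])
  also have W2: "\<dots> \<le> \<theta> * n" using sq n0 by (intro mult_right_mono)
  finally have W3: "\<bar>?W\<bar> \<le> \<theta> * n" .
  have sW: "\<bar>s * ?W\<bar> \<le> n / 8"
  proof -
    have "\<bar>s * ?W\<bar> = s * \<bar>?W\<bar>" using s by (simp add: abs_mult)
    also have "\<dots> \<le> s * (\<theta> * n)" using s W3 by (intro mult_left_mono) auto
    also have "\<dots> = (s * \<theta>) * n" by simp
    also have "\<dots> \<le> 1 / 8 * n" using s n0 by (intro mult_right_mono) auto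
    finally show ?thesis by simp
  qed
  \<comment> \<open>One factor \<open>exp (n / 8)\<close> comes from the Taylor remainder, the other
    one absorbs \<open>n\<^sup>2 / 128\<close>. Their product \<open>exp (n / 4)\<close> is the
    function whose integral is under control; this fixes the constants \<open>1 / 8\<close> and
    \<open>64\<close>.\<close>
  have "(s * ?W)\<^sup>2 / 2 * exp \<bar>s * ?W\<bar> \<le> 64 * s\<^sup>2 * residual \<Psi> I / \<eta> * exp (n / 4)"
  proof -
    have "?W\<^sup>2 \<le> (sqrt (residual \<Psi> I / \<eta>) * n)\<^sup>2" using W1 by (rule power2_le_iff_abs_le[THEN iffD2, rotated]) (use n0 residual_nonneg eta in simp)
    also have "\<dots> = residual \<Psi> I / \<eta> * n\<^sup>2" using residual_nonneg eta by (simp add: power_mult_distrib)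
    finally have "(s * ?W)\<^sup>2 / 2 * exp \<bar>s * ?W\<bar> \<le> (s\<^sup>2 * (residual \<Psi> I / \<eta> * n\<^sup>2)) / 2 * exp (n / 8)"
      unfolding power_mult_distrib using sW
      using residual_nonneg[of \<Psi> I] eta by (intro mult_mono divide_right_mono mult_left_mono) auto
    also have "\<dots> = 64 * s\<^sup>2 * residual \<Psi> I / \<eta> * (n\<^sup>2 / 128 * exp (n / 8))"
      by (simp add: mult_ac)
    also have "\<dots> \<le> 64 * s\<^sup>2 * residual \<Psi> I / \<eta> * (exp (n / 8) * exp (n / 8))"
    proof (intro mult_left_mono mult_right_mono)
      have "1 + n / 8 + (n / 8)\<^sup>2 / 2 \<le> exp (n / 8)" using n0 by (intro exp_lower_Taylor_quadratic) auto
      then show "n\<^sup>2 / 128 \<le> exp (n / 8)" using n0 by (simp add: power_divide)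
    qed (use residual_nonneg eta in auto)
    also have "exp (n / 8) * exp (n / 8) = exp (n / 4)" by (simp flip: exp_add)
    finally show ?thesis .
  qed
  then have quad: "exp (- (s * ?W)) \<le> 1 - s * ?W + 64 * s\<^sup>2 * residual \<Psi> I / \<eta> * exp (n / 4)"
    using exp_minus_le_quadratic[of "s * ?W"] by linarith
  have gapJ: "norm (proj_I \<Phi> J ?y) + 2 * \<kappa> \<le> norm (proj_I \<Phi> I ?y)" if "card J \<le> S" "J \<noteq> I" for J
    by (rule gap_at_dom_region_gap[OF x kappa_pos unit S_pos S_less I that])
  show ?thesis
  proof (cases "\<theta> * norm ?y < \<kappa>")
    case True
    have "max_proj S \<Phi> ?y = (norm (proj_I \<Phi> I ?y))\<^sup>2"
    proof (rule max_proj_eqI)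
      fix J :: "'k set" assume "card J \<le> S"
      then show "norm (proj_I \<Phi> J ?y) \<le> norm (proj_I \<Phi> I ?y)"
        using gapJ[of J] kappa_pos by (cases "J = I") auto
    qed (use I in simp)
    moreover have "max_proj S \<Psi> ?y = (norm (proj_I \<Psi> I ?y))\<^sup>2"
    proof (rule max_proj_eqI)
      fix J :: "'k set" assume J: "card J \<le> S"
      show "norm (proj_I \<Psi> J ?y) \<le> norm (proj_I \<Psi> I ?y)"
      proof (cases "J = I")
        case False
        have "norm (proj_I \<Psi> J ?y) \<le> norm (proj_I \<Phi> J ?y) + \<theta> * norm ?y"
          using norm_triangle_ineq4[of "proj_I \<Phi> J ?y" "proj_I \<Phi> J ?y - proj_I \<Psi> J ?y"] close[OF J, of ?y] by simp
        moreover have "norm (proj_I \<Phi> I ?y) \<le> norm (proj_I \<Psi> I ?y) + \<theta> * norm ?y"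
          using norm_triangle_ineq[of "proj_I \<Psi> I ?y" "proj_I \<Phi> I ?y - proj_I \<Psi> I ?y"] close[of I ?y] I by simp
        ultimately show ?thesis using gapJ[OF J False] True by linarith
      qed simp
    qed (use I in simp)
    ultimately have "loss_diff \<Psi> x = ?W" by (simp add: loss_diff_def)
    then have "exp (- s * loss_diff \<Psi> x) \<le> 1 - s * ?W + 64 * s\<^sup>2 * residual \<Psi> I / \<eta> * exp (n / 4)"
      using quad by simp
    moreover have "0 \<le> exp (- \<kappa>\<^sup>2 / (8 * \<theta>\<^sup>2)) * exp (n / 4)" by simp
    ultimately show ?thesis unfolding n_def[symmetric] distrib_right by linarith
  next
    case False
    \<comment> \<open>Here \<open>n \<ge> \<kappa>\<^sup>2 / \<theta>\<^sup>2\<close>, so replacing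
      the exponent \<open>n / 8\<close> by \<open>n / 4\<close> gains the factor
      \<open>exp (- \<kappa>\<^sup>2 / (8 * \<theta>\<^sup>2))\<close>.\<close>
    then have "\<kappa>\<^sup>2 \<le> (\<theta> * norm ?y)\<^sup>2" using kappa_pos by (intro power_mono) auto
    then have nk: "\<kappa>\<^sup>2 / \<theta>\<^sup>2 \<le> n" using th by (simp add: power_mult_distrib n_def field_simps)
    have "\<bar>loss_diff \<Psi> x\<bar> \<le> \<theta> * n" unfolding loss_diff_def n_def by (rule max_proj_close[OF close])
    then have "s * (- loss_diff \<Psi> x) \<le> s * (\<theta> * n)" using s by (intro mult_left_mono) auto
    also have "\<dots> = (s * \<theta>) * n" by simp
    also have "\<dots> \<le> 1 / 8 * n" using s n0 by (intro mult_right_mono) auto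
    also have "\<dots> \<le> - (\<kappa>\<^sup>2 / \<theta>\<^sup>2) / 8 + n / 4" using nk by simp
    finally have "exp (- s * loss_diff \<Psi> x) \<le> exp (- \<kappa>\<^sup>2 / (8 * \<theta>\<^sup>2) + n / 4)" by simp
    also have "\<dots> = exp (- \<kappa>\<^sup>2 / (8 * \<theta>\<^sup>2)) * exp (n / 4)" by (rule exp_add)
    moreover have "0 \<le> 1 - s * ?W + 64 * s\<^sup>2 * residual \<Psi> I / \<eta> * exp (n / 4)"
      using quad by (rule order_trans[rotated]) simp
    ultimately show ?thesis unfolding n_def[symmetric] distrib_right by linarith
  qed
qed

text \<open>All regions have equal mass, and the residual enters the linear and the quadratic term
  with the first power. Hence \<open>\<Psi>\<close> matters only through the average residual
  \<open>D\<close>, and a choice of \<open>s\<close> that does not depend on the radius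
  \<open>r\<close> can balance the two terms. The factor \<open>320 / 3\<close> is
  \<open>64 * 5 / 3\<close>.\<close>

lemma integral_exp_loss_diff:
  fixes \<Psi> :: "'k \<Rightarrow> real^'d"
  assumes th: "0 < \<theta>" "\<theta> < 1" and s: "0 < s" "s * \<theta> \<le> 1 / 8" and eta: "0 < \<eta>"
    and low: "\<And>J v. card J \<le> S \<Longrightarrow> \<eta> * (\<Sum>j\<in>J. (v j)\<^sup>2) \<le> (norm (\<Sum>j\<in>J. v j *\<^sub>R \<Phi> j))\<^sup>2"
    and r: "0 \<le> r" "real S * r\<^sup>2 \<le> \<eta> * \<theta>\<^sup>2" and psi: "\<And>j. norm (\<Phi> j - \<Psi> j) \<le> r"
  defines "D \<equiv> (\<Sum>I\<in>supports. residual \<Psi> I) / real (card supports)"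
  shows "(\<integral>x. exp (- s * loss_diff \<Psi> x) \<partial>\<nu>) \<le>
    1 - s * lam * D + 320 / 3 * s\<^sup>2 * D / \<eta> + 5 / 3 * exp (- \<kappa>\<^sup>2 / (8 * \<theta>\<^sup>2))"
proof -
  let ?n = "real (card supports)"
  have n0: "?n > 0" using supports_pos by linarith
  let ?e = "exp (- \<kappa>\<^sup>2 / (8 * \<theta>\<^sup>2))"
  let ?W = "\<lambda>I x. (norm (proj_I \<Phi> I (synth \<Phi> x)))\<^sup>2 - (norm (proj_I \<Psi> I (synth \<Phi> x)))\<^sup>2"
  let ?E = "\<lambda>x. exp ((norm (synth \<Phi> x))\<^sup>2 / 4)"
  let ?c = "\<lambda>I. 64 * s\<^sup>2 * residual \<Psi> I / \<eta> + ?e"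
  have close: "norm (proj_I \<Phi> J y - proj_I \<Psi> J y) \<le> \<theta> * norm y" if "card J \<le> S" for J y
    using that th r psi low[OF that] eta by (intro proj_I_close[of J \<eta> \<theta> S r]) auto
  have one: "(\<integral>x. indicator (dom_region I) x * exp (- s * loss_diff \<Psi> x) \<partial>\<nu>)
      \<le> (1 - s * lam * residual \<Psi> I + 5 / 3 * ?c I) / ?n" if I: "card I = S" for I
  proof -
    have "residual \<Psi> I \<le> (\<Sum>i\<in>I. r\<^sup>2)"
      unfolding residual_def using proj_I_residual_le[of _ I] psi
      by (intro sum_mono power_mono) (blast intro: order_trans, simp)
    also have "\<dots> \<le> \<eta> * \<theta>\<^sup>2" using I r by simp
    finally have "residual \<Psi> I / \<eta> \<le> \<theta>\<^sup>2" using eta by (simp add: field_simps)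
    then have sq: "sqrt (residual \<Psi> I / \<eta>) \<le> \<theta>" using th by (intro real_le_lsqrt) auto
    \<comment> \<open>On its own region, \<open>I\<close> is compared at the rate given by its
      residual, which may be far below the uniform \<open>\<theta>\<close>. This makes the quadratic
      term proportional to the residual.\<close>
    have closeI: "norm (proj_I \<Phi> I y - proj_I \<Psi> I y) \<le> sqrt (residual \<Psi> I / \<eta>) * norm y" for y
    proof (rule proj_I_close_residual[of I \<eta>])
      show "sqrt (residual \<Psi> I / \<eta>) < 1" using sq th(2) by (rule le_less_trans)
      show "(\<Sum>j\<in>I. (norm (\<Phi> j - proj_I \<Psi> I (\<Phi> j)))\<^sup>2) \<le> \<eta> * (sqrt (residual \<Psi> I / \<eta>))\<^sup>2"
        using residual_nonneg[of \<Psi> I] eta by (simp add: residual_def)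
    qed (use I low eta residual_nonneg[of \<Psi> I] in auto)
    have cE: "continuous_on UNIV (\<lambda>x. s * ?W I x)" "continuous_on UNIV (\<lambda>x. ?c I * ?E x)"
      by (intro continuous_on_mult continuous_on_const continuous_on_diff continuous_norm_proj continuous_exp_norm)+
    have i1: "integrable \<nu> (\<lambda>x. indicator (dom_region I) x * (1::real))"
      "integrable \<nu> (\<lambda>x. indicator (dom_region I) x * (s * ?W I x))"
      "integrable \<nu> (\<lambda>x. indicator (dom_region I) x * (?c I * ?E x))"
      by (intro integrable_indicator_continuous continuous_on_const cE)+
    have "(\<integral>x. indicator (dom_region I) x * exp (- s * loss_diff \<Psi> x) \<partial>\<nu>)
      \<le> (\<integral>x. indicator (dom_region I) x * 1 - indicator (dom_region I) x * (s * ?W I x)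
          + indicator (dom_region I) x * (?c I * ?E x) \<partial>\<nu>)"
    proof (rule integral_mono_AE)
      show "integrable \<nu> (\<lambda>x. indicator (dom_region I) x * exp (- s * loss_diff \<Psi> x))"
        by (intro integrable_indicator_continuous continuous_on_exp continuous_on_mult continuous_on_const
            continuous_loss_diff)
      show "integrable \<nu> (\<lambda>x. indicator (dom_region I) x * 1 - indicator (dom_region I) x * (s * ?W I x)
          + indicator (dom_region I) x * (?c I * ?E x))"
        using i1 by (intro Bochner_Integration.integrable_add Bochner_Integration.integrable_diff)
      show "AE x in \<nu>. indicator (dom_region I) x * exp (- s * loss_diff \<Psi> x)
        \<le> indicator (dom_region I) x * 1 - indicator (dom_region I) x * (s * ?W I x)
          + indicator (dom_region I) x * (?c I * ?E x)"
        using gap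
      proof eventually_elim
        case (elim x)
        show ?case
        proof (cases "x \<in> dom_region I")
          case True
          then show ?thesis
            using exp_loss_diff_le[OF elim I True th(1) s eta close closeI sq] by simp
        qed simp
      qed
    qed
    also have "\<dots> = (\<integral>x. indicator (dom_region I) x \<partial>\<nu>) - s * (\<integral>x. indicator (dom_region I) x * ?W I x \<partial>\<nu>)
        + ?c I * (\<integral>x. indicator (dom_region I) x * ?E x \<partial>\<nu>)"
    proof -
      have "(\<integral>x. indicator (dom_region I) x * (s * ?W I x) \<partial>\<nu>) = s * (\<integral>x. indicator (dom_region I) x * ?W I x \<partial>\<nu>)"
        by (subst integral_mult_right_zero[symmetric]) (simp only: mult.left_commute)
      moreover have "(\<integral>x. indicator (dom_region I) x * (?c I * ?E x) \<partial>\<nu>) = ?c I * (\<integral>x. indicator (dom_region I) x * ?E x \<partial>\<nu>)"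
        by (subst integral_mult_right_zero[symmetric]) (simp only: mult.left_commute)
      moreover have "(\<integral>x. indicator (dom_region I) x * 1 - indicator (dom_region I) x * (s * ?W I x)
          + indicator (dom_region I) x * (?c I * ?E x) \<partial>\<nu>) =
        (\<integral>x. indicator (dom_region I) x * 1 \<partial>\<nu>) - (\<integral>x. indicator (dom_region I) x * (s * ?W I x) \<partial>\<nu>)
          + (\<integral>x. indicator (dom_region I) x * (?c I * ?E x) \<partial>\<nu>)"
        using i1 by (subst Bochner_Integration.integral_add) (auto simp: Bochner_Integration.integral_diff)
      ultimately show ?thesis by simp
    qed
    also have "\<dots> \<le> 1 / ?n - s * (lam / ?n * residual \<Psi> I) + ?c I * (5 / 3 / ?n)"
    proof (intro add_mono diff_mono mult_left_mono)
      show "(\<integral>x. indicator (dom_region I) x \<partial>\<nu>) \<le> 1 / ?n" using prob_dom_region[OF I] by simp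
      show "lam / ?n * residual \<Psi> I \<le> (\<integral>x. indicator (dom_region I) x * ?W I x \<partial>\<nu>)"
        unfolding residual_def by (rule integral_drop[OF I])
      show "(\<integral>x. indicator (dom_region I) x * ?E x \<partial>\<nu>) \<le> 5 / 3 / ?n" by (rule integral_exp_norm[OF I])
    qed (use s residual_nonneg[of \<Psi> I] eta in auto)
    also have "\<dots> = (1 - s * lam * residual \<Psi> I + 5 / 3 * ?c I) / ?n"
      by (simp add: add_divide_distrib diff_divide_distrib)
    finally show ?thesis .
  qed
  have "(\<integral>x. exp (- s * loss_diff \<Psi> x) \<partial>\<nu>)
      = (\<Sum>I\<in>supports. \<integral>x. indicator (dom_region I) x * exp (- s * loss_diff \<Psi> x) \<partial>\<nu>)"
    by (intro integral_partition continuous_on_exp continuous_on_mult continuous_on_const continuous_loss_diff)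
  also have "\<dots> \<le> (\<Sum>I\<in>supports. (1 - s * lam * residual \<Psi> I + 5 / 3 * ?c I) / ?n)"
    by (intro sum_mono one) simp
  also have "\<dots> = (\<Sum>I\<in>supports. (1 + 5 / 3 * ?e) / ?n + (320 / 3 * s\<^sup>2 / \<eta> - s * lam) * (residual \<Psi> I / ?n))"
  proof (intro sum.cong refl)
    fix I
    have "(1 - s * lam * R + 5 / 3 * (64 * s\<^sup>2 * R / \<eta> + e)) / n = (1 + 5 / 3 * e) / n + (320 / 3 * s\<^sup>2 / \<eta> - s * lam) * (R / n)"
      if "n \<noteq> 0" for R e n using that eta by (simp add: field_simps)
    then show "(1 - s * lam * residual \<Psi> I + 5 / 3 * ?c I) / ?n
        = (1 + 5 / 3 * ?e) / ?n + (320 / 3 * s\<^sup>2 / \<eta> - s * lam) * (residual \<Psi> I / ?n)"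
      by this (use n0 in linarith)
  qed
  also have "\<dots> = (\<Sum>I\<in>supports. (1 + 5 / 3 * ?e) / ?n)
      + (\<Sum>I\<in>supports. (320 / 3 * s\<^sup>2 / \<eta> - s * lam) * (residual \<Psi> I / ?n))"
    by (rule sum.distrib)
  also have "(\<Sum>I\<in>supports. (1 + 5 / 3 * ?e) / ?n) = ?n * ((1 + 5 / 3 * ?e) / ?n)" by (rule sum_constant)
  also have "(\<Sum>I\<in>supports. (320 / 3 * s\<^sup>2 / \<eta> - s * lam) * (residual \<Psi> I / ?n))
      = (320 / 3 * s\<^sup>2 / \<eta> - s * lam) * D"
    unfolding D_def sum_distrib_left[symmetric] sum_divide_distrib[symmetric] ..
  also have "?n * ((1 + 5 / 3 * ?e) / ?n) = 1 + 5 / 3 * ?e"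
  proof -
    have "n * (a / n) = a" if "0 < n" for n a :: real using that by simp
    then show ?thesis by this (rule n0)
  qed
  also have "1 + 5 / 3 * ?e + (320 / 3 * s\<^sup>2 / \<eta> - s * lam) * D
      = 1 - s * lam * D + 320 / 3 * s\<^sup>2 * D / \<eta> + 5 / 3 * ?e"
    by (simp only: left_diff_distrib times_divide_eq_left)
  finally show ?thesis .
qed

end

section \<open>Uniformity over the boundary and existence of a local maximum\<close>

text \<open>Markov's inequality for an exponential that factorizes by independence, followed by
  \<open>1 - u \<le> exp (- u)\<close>. Nonnegative integrals avoid any question of integrability on
  the product space.\<close>

lemma chernoff_product:
  fixes \<nu> :: "'a measure" and G :: "'a \<Rightarrow> real" and N :: nat
  assumes "prob_space \<nu>" and G [measurable]: "G \<in> borel_measurable \<nu>"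
    and int: "integrable \<nu> (\<lambda>x. exp (- s * G x))" "(\<integral>x. exp (- s * G x) \<partial>\<nu>) \<le> 1 - u" and "0 < s"
  defines "M \<equiv> PiM {1..N} (\<lambda>_. \<nu>)"
  shows "{X \<in> space M. (\<Sum>n=1..N. G (X n)) \<le> real N * t} \<in> sets M"
    and "measure M {X \<in> space M. (\<Sum>n=1..N. G (X n)) \<le> real N * t} \<le> exp (real N * (s * t - u))"
proof -
  interpret prob_space \<nu> by fact
  interpret P: product_prob_space "\<lambda>_::nat. \<nu>" "{1..N}" by unfold_locales
  interpret PM: prob_space M unfolding M_def by (rule prob_space_PiM) (rule assms(1))
  let ?B = "{X \<in> space M. (\<Sum>n=1..N. G (X n)) \<le> real N * t}"
  have [measurable]: "(\<lambda>X. X n) \<in> measurable M \<nu>" if "n \<in> {1..N}" for n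
    unfolding M_def using that by (rule measurable_component_singleton)
  have [measurable]: "(\<lambda>X. \<Sum>n=1..N. G (X n)) \<in> borel_measurable M"
    by (rule borel_measurable_sum) measurable
  show B: "?B \<in> sets M" by measurable
  let ?f = "\<lambda>x. exp (s * t) * exp (- s * G x)"
  have "emeasure M ?B = (\<integral>\<^sup>+X. indicator ?B X \<partial>M)" using B by simp
  also have "\<dots> \<le> (\<integral>\<^sup>+X. (\<Prod>n\<in>{1..N}. ennreal (?f (X n))) \<partial>M)"
  proof (rule nn_integral_mono)
    fix X assume "X \<in> space M"
    show "indicator ?B X \<le> (\<Prod>n\<in>{1..N}. ennreal (?f (X n)))"
    proof (cases "X \<in> ?B")
      case True
      have "(\<Prod>n\<in>{1..N}. ?f (X n)) = exp (\<Sum>n=1..N. s * t + - s * G (X n))"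
        by (simp only: exp_sum exp_add finite_atLeastAtMost)
      also have "(\<Sum>n=1..N. s * t + - s * G (X n)) = s * (real N * t - (\<Sum>n=1..N. G (X n)))"
        unfolding sum.distrib sum_distrib_left[symmetric] by (simp add: algebra_simps)
      finally have "1 \<le> (\<Prod>n\<in>{1..N}. ?f (X n))" using True \<open>0 < s\<close> by simp
      then have "ennreal 1 \<le> ennreal (\<Prod>n\<in>{1..N}. ?f (X n))" by (rule ennreal_leI)
      then show ?thesis using True by (simp add: prod_ennreal)
    qed simp
  qed
  also have "\<dots> = (\<Prod>n\<in>{1..N}. \<integral>\<^sup>+x. ennreal (?f x) \<partial>\<nu>)"
    unfolding M_def by (rule P.product_nn_integral_prod) auto
  also have "(\<integral>\<^sup>+x. ennreal (?f x) \<partial>\<nu>) = ennreal (\<integral>x. ?f x \<partial>\<nu>)"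
    using int(1) by (intro nn_integral_eq_integral) auto
  also have "(\<Prod>n\<in>{1..N}. ennreal (\<integral>x. ?f x \<partial>\<nu>)) = ennreal ((\<integral>x. ?f x \<partial>\<nu>) ^ N)"
    by (simp add: ennreal_power)
  finally have le: "measure M ?B \<le> (\<integral>x. ?f x \<partial>\<nu>) ^ N"
    unfolding PM.emeasure_eq_measure by (subst (asm) ennreal_le_iff) auto
  have "(\<integral>x. ?f x \<partial>\<nu>) = exp (s * t) * (\<integral>x. exp (- s * G x) \<partial>\<nu>)" by simp
  also have "\<dots> \<le> exp (s * t) * exp (- u)"
    using int(2) exp_ge_add_one_self[of "- u"] by (intro mult_left_mono) auto
  also have "\<dots> = exp (s * t - u)" by (simp add: exp_diff exp_minus field_simps)
  finally have "(\<integral>x. ?f x \<partial>\<nu>) ^ N \<le> exp (s * t - u) ^ N" by (intro power_mono) auto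
  then show "measure M ?B \<le> exp (real N * (s * t - u))" using le by (simp add: exp_of_nat_mult)
qed

text \<open>The probability estimate is available only at members of \<open>T\<close>, so the net
  must lie in \<open>T\<close>: one representative is chosen per occupied grid cell. A
  coordinatewise error \<open>h\<close> costs at most \<open>d * h\<close> in norm.\<close>

lemma grid_net:
  fixes \<Phi> :: "'k::finite \<Rightarrow> real^'d"
  assumes T: "\<And>\<Psi> k. \<Psi> \<in> T \<Longrightarrow> norm (\<Psi> k - \<Phi> k) \<le> r" and r: "0 \<le> r" and h: "0 < h"
  obtains T0 where "T0 \<subseteq> T" "finite T0" "real (card T0) \<le> (2 * r / h + 2) ^ (CARD('k) * CARD('d))"
    "\<And>\<Psi>. \<Psi> \<in> T \<Longrightarrow> \<exists>\<Psi>'\<in>T0. \<forall>k. norm (\<Psi> k - \<Psi>' k) \<le> real CARD('d) * h"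
proof -
  define Q where "Q \<Psi> = (\<lambda>(k, i). \<lfloor>(\<Psi> k $ i - \<Phi> k $ i) / h\<rfloor>)" for \<Psi> :: "'k \<Rightarrow> real^'d"
  let ?Z = "{\<lfloor>- (r / h)\<rfloor>..\<lfloor>r / h\<rfloor>}"
  have range: "Q ` T \<subseteq> PiE UNIV (\<lambda>_. ?Z)"
  proof
    fix f assume "f \<in> Q ` T"
    then obtain \<Psi> where psi: "\<Psi> \<in> T" "f = Q \<Psi>" by auto
    have "f (k, i) \<in> ?Z" for k i
    proof -
      have "\<bar>(\<Psi> k - \<Phi> k) $ i\<bar> \<le> r" using T[OF psi(1), of k] component_le_norm_cart[of "\<Psi> k - \<Phi> k" i] by linarith
      then have "- r / h \<le> (\<Psi> k $ i - \<Phi> k $ i) / h" "(\<Psi> k $ i - \<Phi> k $ i) / h \<le> r / h"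
        using divide_right_mono[of "- r" "\<Psi> k $ i - \<Phi> k $ i" h] divide_right_mono[of "\<Psi> k $ i - \<Phi> k $ i" r h] h by auto
      then show ?thesis unfolding psi(2) Q_def by (auto intro!: floor_mono)
    qed
    then show "f \<in> PiE UNIV (\<lambda>_. ?Z)" by (auto simp: PiE_UNIV_domain)
  qed
  have fin: "finite (PiE (UNIV :: ('k \<times> 'd) set) (\<lambda>_. ?Z))" by (intro finite_PiE) auto
  define T0 where "T0 = inv_into T Q ` (Q ` T)"
  have "T0 \<subseteq> T" unfolding T0_def by (auto intro: inv_into_into)
  moreover have "finite T0" unfolding T0_def using finite_subset[OF range fin] by simp
  moreover have "real (card T0) \<le> (2 * r / h + 2) ^ (CARD('k) * CARD('d))"
  proof -
    have "card T0 \<le> card (Q ` T)" unfolding T0_def using finite_subset[OF range fin] by (rule card_image_le)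
    also have "\<dots> \<le> card (PiE (UNIV :: ('k \<times> 'd) set) (\<lambda>_. ?Z))" by (rule card_mono[OF fin range])
    also have "\<dots> = card ?Z ^ (CARD('k) * CARD('d))" by (simp add: card_PiE)
    finally have "real (card T0) \<le> real (card ?Z) ^ (CARD('k) * CARD('d))" by (metis of_nat_le_iff of_nat_power)
    also have "\<dots> \<le> (2 * r / h + 2) ^ (CARD('k) * CARD('d))"
    proof (rule power_mono)
      have z: "0 \<le> r / h" using r h by simp
      have "real (card ?Z) = real_of_int (\<lfloor>r / h\<rfloor> + 1 - \<lfloor>- (r / h)\<rfloor>)"
      proof -
        have "\<lfloor>- (r / h)\<rfloor> \<le> \<lfloor>r / h\<rfloor>" using z by (intro floor_mono) linarith
        then show ?thesis by simp
      qed
      also have "\<dots> \<le> 2 * r / h + 2" by linarith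
      finally show "real (card ?Z) \<le> 2 * r / h + 2" .
    qed simp
    finally show ?thesis .
  qed
  moreover have "\<exists>\<Psi>'\<in>T0. \<forall>k. norm (\<Psi> k - \<Psi>' k) \<le> real CARD('d) * h" if "\<Psi> \<in> T" for \<Psi>
  proof
    let ?\<Psi>' = "inv_into T Q (Q \<Psi>)"
    show "?\<Psi>' \<in> T0" unfolding T0_def using that by auto
    have q: "Q ?\<Psi>' = Q \<Psi>" using f_inv_into_f[of "Q \<Psi>" Q T] that by auto
    show "\<forall>k. norm (\<Psi> k - ?\<Psi>' k) \<le> real CARD('d) * h"
    proof
      fix k
      have "\<bar>(\<Psi> k - ?\<Psi>' k) $ i\<bar> \<le> h" for i
      proof -
        have "\<lfloor>(?\<Psi>' k $ i - \<Phi> k $ i) / h\<rfloor> = \<lfloor>(\<Psi> k $ i - \<Phi> k $ i) / h\<rfloor>"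
          using fun_cong[OF q, of "(k, i)"] by (simp add: Q_def)
        then have "\<bar>(\<Psi> k $ i - \<Phi> k $ i) / h - (?\<Psi>' k $ i - \<Phi> k $ i) / h\<bar> \<le> 1" by linarith
        moreover have "(\<Psi> k $ i - \<Phi> k $ i) / h - (?\<Psi>' k $ i - \<Phi> k $ i) / h = (\<Psi> k - ?\<Psi>' k) $ i / h"
          by (simp add: diff_divide_distrib)
        ultimately show ?thesis using h by (simp add: abs_divide)
      qed
      then have "(\<Sum>i\<in>UNIV. \<bar>(\<Psi> k - ?\<Psi>' k) $ i\<bar>) \<le> (\<Sum>i\<in>(UNIV::'d set). h)" by (intro sum_mono)
      then show "norm (\<Psi> k - ?\<Psi>' k) \<le> real CARD('d) * h"
        using norm_le_l1_cart[of "\<Psi> k - ?\<Psi>' k"] by simp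
    qed
  qed
  ultimately show thesis using that by blast
qed

text \<open>The lower bound passes from \<open>\<Phi>\<close> to \<open>\<Psi>\<close> with half the
  singular value, hence \<open>\<eta> / 4\<close>; with it the projections for \<open>\<Psi>\<close>
  and \<open>\<Psi>'\<close> are compared.\<close>

lemma max_proj_close_perturb:
  fixes \<Phi> \<Psi> \<Psi>' :: "'k::finite \<Rightarrow> real^'d"
  assumes low: "\<And>J v. card J \<le> S \<Longrightarrow> \<eta> * (\<Sum>j\<in>J. (v j)\<^sup>2) \<le> (norm (\<Sum>j\<in>J. v j *\<^sub>R \<Phi> j))\<^sup>2"
    and eta: "0 < \<eta>" and r: "0 \<le> r" "sqrt (real S) * r \<le> sqrt \<eta> / 2"
    and psi: "\<And>j. norm (\<Phi> j - \<Psi> j) \<le> r" and rho: "0 \<le> \<rho>" "\<And>j. norm (\<Psi> j - \<Psi>' j) \<le> \<rho>"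
    and th: "0 \<le> \<theta>" "\<theta> < 1" "real S * \<rho>\<^sup>2 \<le> \<eta> / 4 * \<theta>\<^sup>2"
  shows "\<bar>max_proj S \<Psi> y - max_proj S \<Psi>' y\<bar> \<le> \<theta> * (norm y)\<^sup>2"
proof (rule max_proj_close)
  fix J :: "'k set" assume J: "card J \<le> S"
  have "(sqrt \<eta> / 2)\<^sup>2 * (\<Sum>j\<in>J. (v j)\<^sup>2) \<le> (norm (\<Sum>j\<in>J. v j *\<^sub>R \<Psi> j))\<^sup>2" for v
    using low[OF J] eta r psi J by (intro norm_lower_bound_perturb[of J _ S r]) auto
  then have "\<eta> / 4 * (\<Sum>j\<in>J. (v j)\<^sup>2) \<le> (norm (\<Sum>j\<in>J. v j *\<^sub>R \<Psi> j))\<^sup>2" for v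
    using eta by (simp add: power_divide)
  then show "norm (proj_I \<Psi> J y - proj_I \<Psi>' J y) \<le> \<theta> * norm y"
    using J eta rho th by (intro proj_I_close[of J "\<eta> / 4" \<theta> S \<rho>]) auto
qed

text \<open>A maximizer over the compact ball cannot sit on its boundary, because
  \<open>\<Phi>\<close> is a better competitor. Continuity of the objective rests on the lower
  bound, which prevents spans of nearby dictionaries from losing dimension.\<close>

lemma local_max_from_boundary:
  fixes \<Phi> :: "'k::finite \<Rightarrow> real^'d"
  assumes low: "\<And>J v. card J \<le> S \<Longrightarrow> \<eta> * (\<Sum>j\<in>J. (v j)\<^sup>2) \<le> (norm (\<Sum>j\<in>J. v j *\<^sub>R \<Phi> j))\<^sup>2"
    and eta: "0 < \<eta>" and r: "0 < r" "sqrt (real S) * r \<le> sqrt \<eta> / 2" and Phi: "\<Phi> \<in> dict_set"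
    and boundary: "\<And>\<Psi> k. \<Psi> \<in> dict_set \<Longrightarrow> (\<And>j. norm (\<Psi> j - \<Phi> j) \<le> r) \<Longrightarrow> norm (\<Psi> k - \<Phi> k) = r
      \<Longrightarrow> obj S N y \<Psi> < obj S N y \<Phi>"
  shows "\<exists>\<Psi>. local_max_on dict_set (obj S N y) \<Psi> \<and> (\<forall>k. norm (\<Psi> k - \<Phi> k) \<le> r)"
proof -
  \<comment> \<open>Dictionaries are recast as vectors of vectors to have compactness of closed
    bounded sets.\<close>
  let ?C = "{V :: (real^'d)^'k. \<forall>k. norm (V $ k) = 1 \<and> norm (V $ k - \<Phi> k) \<le> r}"
  let ?f = "\<lambda>V :: (real^'d)^'k. obj S N y (\<lambda>k. V $ k)"
  have "?C = (\<Inter>k. {V. norm (V $ k) = 1}) \<inter> (\<Inter>k. {V. norm (V $ k - \<Phi> k) \<le> r})" by auto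
  moreover have "closed \<dots>"
    by (intro closed_Int closed_INT ballI closed_Collect_eq closed_Collect_le continuous_intros)
  ultimately have closed: "closed ?C" by simp
  have "bounded ?C"
  proof (rule boundedI)
    fix V assume "V \<in> ?C"
    then show "norm V \<le> (\<Sum>k\<in>(UNIV::'k set). 1)"
      using L2_set_le_sum[of UNIV "\<lambda>k. norm (V $ k)"] by (simp add: norm_vec_def[of V])
  qed
  then have comp: "compact ?C" using closed by (simp add: compact_eq_bounded_closed)
  have mp: "continuous_on ?C (\<lambda>V. max_proj S (\<lambda>k. V $ k) z)" for z
    unfolding continuous_on_iff
  proof (intro ballI allI impI)
    fix V :: "(real^'d)^'k" and e :: real assume V: "V \<in> ?C" and e: "0 < e"
    define \<theta> where "\<theta> = min (1 / 2) (e / (2 * ((norm z)\<^sup>2 + 1)))"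
    have z0: "0 < (norm z)\<^sup>2 + 1" by (simp add: add_nonneg_pos)
    have th: "0 < \<theta>" "\<theta> < 1" using e z0 by (auto simp: \<theta>_def)
    \<comment> \<open>\<open>S + 1\<close> under the root avoids a division by zero, since
      \<open>S = 0\<close> is allowed here.\<close>
    define \<rho> where "\<rho> = \<theta> * sqrt \<eta> / (2 * sqrt (real S + 1))"
    have rho: "0 < \<rho>" using th eta by (simp add: \<rho>_def)
    have "real S * \<rho>\<^sup>2 \<le> (real S + 1) * \<rho>\<^sup>2" by (intro mult_right_mono) auto
    also have "\<dots> = \<eta> / 4 * \<theta>\<^sup>2" using eta by (simp add: \<rho>_def power_mult_distrib power_divide field_simps)
    finally have sr: "real S * \<rho>\<^sup>2 \<le> \<eta> / 4 * \<theta>\<^sup>2" .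
    show "\<exists>\<delta>>0. \<forall>V'\<in>?C. dist V' V < \<delta> \<longrightarrow> dist (max_proj S (\<lambda>k. V' $ k) z) (max_proj S (\<lambda>k. V $ k) z) < e"
    proof (intro exI conjI ballI impI)
      fix V' assume "V' \<in> ?C" and d: "dist V' V < \<rho>"
      have "norm (V $ j - V' $ j) \<le> \<rho>" for j
        using d Finite_Cartesian_Product.norm_nth_le[of "V - V'" j] by (simp add: dist_norm norm_minus_commute)
      then have "\<bar>max_proj S (\<lambda>k. V $ k) z - max_proj S (\<lambda>k. V' $ k) z\<bar> \<le> \<theta> * (norm z)\<^sup>2"
        using V eta r rho th sr
        by (intro max_proj_close_perturb[where r=r and \<rho>=\<rho>, OF low eta]) (auto simp: norm_minus_commute)
      also have "\<dots> \<le> (e / (2 * ((norm z)\<^sup>2 + 1))) * ((norm z)\<^sup>2 + 1)"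
        using e z0 by (intro mult_mono) (auto simp: \<theta>_def)
      also have "\<dots> = e / 2" using z0 by (simp add: field_simps)
      finally show "dist (max_proj S (\<lambda>k. V' $ k) z) (max_proj S (\<lambda>k. V $ k) z) < e"
        using e by (simp add: dist_real_def abs_minus_commute)
    qed (rule rho)
  qed
  have cont: "continuous_on ?C ?f" unfolding obj_max_proj by (intro continuous_intros mp)
  let ?V\<Phi> = "\<chi> k. \<Phi> k"
  have "?V\<Phi> \<in> ?C" using Phi r by (simp add: dict_set_def)
  then obtain V0 where V0: "V0 \<in> ?C" "\<And>V. V \<in> ?C \<Longrightarrow> ?f V \<le> ?f V0"
    using continuous_attains_sup[OF comp _ cont] by blast
  define \<Psi>0 where "\<Psi>0 k = V0 $ k" for k
  have p0: "\<Psi>0 \<in> dict_set" "\<And>k. norm (\<Psi>0 k - \<Phi> k) \<le> r" using V0(1) by (auto simp: \<Psi>0_def dict_set_def)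
  have opt: "obj S N y \<Psi> \<le> obj S N y \<Psi>0" if "\<Psi> \<in> dict_set" "\<And>k. norm (\<Psi> k - \<Phi> k) \<le> r" for \<Psi>
    using V0(2)[of "\<chi> k. \<Psi> k"] that by (simp add: \<Psi>0_def[abs_def] dict_set_def)
  have strict: "norm (\<Psi>0 k - \<Phi> k) < r" for k
  proof (rule ccontr)
    assume "\<not> norm (\<Psi>0 k - \<Phi> k) < r"
    then have "norm (\<Psi>0 k - \<Phi> k) = r" using p0(2)[of k] by simp
    from boundary[OF p0 this] opt[of \<Phi>] Phi r show False by simp
  qed
  define \<epsilon> where "\<epsilon> = Min (range (\<lambda>k. r - norm (\<Psi>0 k - \<Phi> k)))"
  have "0 < \<epsilon>" unfolding \<epsilon>_def using strict by (subst Min_gr_iff) auto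
  moreover have "obj S N y \<Psi> \<le> obj S N y \<Psi>0" if "\<Psi> \<in> dict_set" "\<forall>k. dist (\<Psi> k) (\<Psi>0 k) < \<epsilon>" for \<Psi>
  proof (rule opt[OF that(1)])
    fix k
    have "\<epsilon> \<le> r - norm (\<Psi>0 k - \<Phi> k)" unfolding \<epsilon>_def by (rule Min_le) auto
    then show "norm (\<Psi> k - \<Phi> k) \<le> r"
      using that(2)[rule_format, of k] norm_triangle_ineq[of "\<Psi> k - \<Psi>0 k" "\<Psi>0 k - \<Phi> k"] by (simp add: dist_norm)
  qed
  ultimately have "local_max_on dict_set (obj S N y) \<Psi>0" using p0 unfolding local_max_on_def by blast
  then show ?thesis using p0(2) by blast
qed

section \<open>Numerical constants\<close>

text \<open>In what follows \<open>\<epsilon> = N\<^sup>-\<^sup>q\<close>, \<open>\<eta> = 1 - \<delta>\<^sub>S\<close> and \<open>L = ln (5 A K\<^sup>S / \<lambda>)\<close>.\<close>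

locale recovery_constants =
  fixes S K d A \<eta> \<kappa> \<epsilon> L lam :: real
  assumes S: "1 \<le> S" and K: "S + 1 \<le> K" and d: "S \<le> d" and A: "1 \<le> A"
    and eta: "0 < \<eta>" "\<eta> \<le> 1" and kappa: "0 < \<kappa>" "4 * \<kappa>\<^sup>2 * S \<le> 1" "4 * \<kappa>\<^sup>2 / (S + 3) \<le> \<eta>"
    and lam: "0 < lam" "lam * S \<le> 1" and L: "S + 1 \<le> L" "5 * K / lam \<le> exp L"
    and eps: "0 < \<epsilon>" "\<epsilon> \<le> \<kappa>\<^sup>2 * \<eta> / (68 * sqrt S * L)"
begin

lemma sqrt_S: "1 \<le> sqrt S" "sqrt S \<le> S"
  using S by (simp_all add: real_le_lsqrt power2_eq_square)

lemma eps_le: "68 * \<epsilon> * sqrt S * L \<le> \<kappa>\<^sup>2 * \<eta>"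
proof -
  have "0 < 68 * sqrt S * L" using S L by simp
  then show ?thesis using eps(2) by (simp add: pos_le_divide_eq mult_ac)
qed

lemma eps_S: "68 * \<epsilon> * sqrt S * (S + 1) \<le> \<kappa>\<^sup>2 * \<eta>"
  by (rule order_trans[OF _ eps_le]) (use L eps S in \<open>intro mult_left_mono, auto\<close>)

lemma eps_S': "68 * \<epsilon> * (S + 1) \<le> \<kappa>\<^sup>2 * \<eta>"
proof -
  have "68 * \<epsilon> * (S + 1) * 1 \<le> 68 * \<epsilon> * (S + 1) * sqrt S"
    using sqrt_S eps S by (intro mult_left_mono) auto
  then show ?thesis using eps_S by (simp add: mult_ac)
qed

lemma kappa_le: "\<kappa>\<^sup>2 \<le> 1 / 4" "\<kappa>\<^sup>2 \<le> \<eta> * (S + 3) / 4"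
proof -
  have "4 * \<kappa>\<^sup>2 * 1 \<le> 4 * \<kappa>\<^sup>2 * S" using S by (intro mult_left_mono) auto
  then show "\<kappa>\<^sup>2 \<le> 1 / 4" using kappa(2) by linarith
  show "\<kappa>\<^sup>2 \<le> \<eta> * (S + 3) / 4" using kappa(3) S by (simp add: field_simps)
qed

lemma eps_eta: "544 * \<epsilon> \<le> \<eta>"
proof -
  have "68 * \<epsilon> * 2 \<le> 68 * \<epsilon> * (S + 1)" using eps S by (intro mult_left_mono) auto
  also note eps_S'
  also have "\<kappa>\<^sup>2 * \<eta> \<le> 1 / 4 * \<eta>" using kappa_le eta by (intro mult_right_mono) auto
  finally show ?thesis by simp
qed

lemma eps_small: "544 * \<epsilon> \<le> 1"
  using eps_eta eta by linarith

lemma lam_le_1: "lam \<le> 1"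
proof -
  have "lam * 1 \<le> lam * S" using lam S by (intro mult_left_mono) auto
  then show ?thesis using lam(2) by linarith
qed

lemma eps_sq: "4624 * \<epsilon>\<^sup>2 * S * (S + 1)\<^sup>2 \<le> \<kappa>\<^sup>2 * \<kappa>\<^sup>2 * \<eta>\<^sup>2"
proof -
  have "(68 * \<epsilon> * sqrt S * (S + 1))\<^sup>2 \<le> (\<kappa>\<^sup>2 * \<eta>)\<^sup>2" using eps_S eps S by (intro power_mono) auto
  moreover have "(68 * \<epsilon> * sqrt S * (S + 1))\<^sup>2 = 4624 * \<epsilon>\<^sup>2 * S * (S + 1)\<^sup>2"
    using S by (simp add: power_mult_distrib)
  moreover have "(\<kappa>\<^sup>2 * \<eta>)\<^sup>2 = \<kappa>\<^sup>2 * \<kappa>\<^sup>2 * \<eta>\<^sup>2" by (simp add: power2_eq_square mult_ac)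
  ultimately show ?thesis by metis
qed

text \<open>The angle between spans at the radius \<open>2 * \<epsilon>\<close>, chosen with
  equality in the condition \<open>S * \<rho>\<^sup>2 \<le> \<eta> * \<theta>\<^sup>2\<close> of
  \<open>proj_I_close\<close>.\<close>

definition theta :: real where
  "theta = 2 * \<epsilon> * sqrt S / sqrt \<eta>"

lemma theta_sq: "theta\<^sup>2 = 4 * \<epsilon>\<^sup>2 * S / \<eta>"
  using S eta by (simp add: theta_def power_mult_distrib power_divide)

text \<open>Provides the condition \<open>8 * \<theta>\<^sup>2 \<le> c\<close> of
  \<open>residual_sum_ge\<close> for the largest admissible \<open>c\<close>.\<close>

lemma theta_sq_le: "theta\<^sup>2 \<le> \<kappa>\<^sup>2 / (S * (S + 3))"
proof -
  have "S * (S + 3) * (4 * \<epsilon>\<^sup>2 * S) \<le> S * (4 * (S + 1)\<^sup>2) * (4 * \<epsilon>\<^sup>2 * S)"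
    using S by (intro mult_right_mono mult_left_mono) (auto simp: power2_eq_square algebra_simps)
  also have "\<dots> = S * (16 / 4624) * (4624 * \<epsilon>\<^sup>2 * S * (S + 1)\<^sup>2)" by simp
  also have "\<dots> \<le> S * (16 / 4624) * (\<kappa>\<^sup>2 * \<kappa>\<^sup>2 * \<eta>\<^sup>2)"
    using S eps_sq by (intro mult_left_mono) auto
  also have "\<dots> = (4 * \<kappa>\<^sup>2 * S) * (\<eta> * (4 / 4624)) * (\<kappa>\<^sup>2 * \<eta>)" by (simp add: power2_eq_square)
  also have "\<dots> \<le> 1 * 1 * (\<kappa>\<^sup>2 * \<eta>)"
    using kappa eta S by (intro mult_right_mono mult_mono) auto
  finally have "S * (S + 3) * (4 * \<epsilon>\<^sup>2 * S) / \<eta> \<le> \<kappa>\<^sup>2 * \<eta> / \<eta>" using eta by (intro divide_right_mono) auto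
  then have "theta\<^sup>2 * (S * (S + 3)) \<le> \<kappa>\<^sup>2" using eta by (simp add: theta_sq mult_ac)
  then show ?thesis using S by (subst pos_le_divide_eq) auto
qed

lemma theta_pos: "0 < theta"
  using eps S eta by (simp add: theta_def)

lemma theta_less: "theta < 1"
proof -
  have "theta\<^sup>2 \<le> \<kappa>\<^sup>2 / (S * (S + 3))" by (rule theta_sq_le)
  also have "\<dots> \<le> \<kappa>\<^sup>2 / 1"
    using S mult_mono[of 1 S 1 "S + 3"] by (intro divide_left_mono) auto
  also have "\<dots> < 1\<^sup>2" using kappa_le by simp
  finally show ?thesis by (rule power2_less_imp_less) simp
qed

lemma radius_le: "sqrt S * (2 * \<epsilon>) \<le> sqrt \<eta> / 2"
proof -
  have "theta \<le> \<kappa>"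
  proof (rule power2_le_imp_le)
    have "\<kappa>\<^sup>2 / (S * (S + 3)) \<le> \<kappa>\<^sup>2 / 1"
      using S mult_mono[of 1 S 1 "S + 3"] by (intro divide_left_mono) auto
    then show "theta\<^sup>2 \<le> \<kappa>\<^sup>2" using theta_sq_le by simp
  qed (use kappa in simp)
  also have "\<kappa> \<le> 1 / 2" by (rule power2_le_imp_le) (use kappa_le in \<open>auto simp: power_divide\<close>)
  finally have "theta * sqrt \<eta> \<le> 1 / 2 * sqrt \<eta>" using eta by (intro mult_right_mono) auto
  moreover have "theta * sqrt \<eta> = sqrt S * (2 * \<epsilon>)" using eta by (simp add: theta_def)
  ultimately show ?thesis by simp
qed

text \<open>The tail may consume a quarter of the guaranteed linear gain, which is of order
  \<open>\<epsilon>\<^sup>2\<close>. The bound on \<open>\<epsilon>\<close> makes the exponent at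
  least \<open>2 * (L / (sqrt S * \<epsilon>))\<close>: one half is at least
  \<open>1 / \<epsilon>\<close> and beats powers of \<open>\<epsilon>\<close>, the other is at least
  \<open>3 * L\<close> and beats \<open>K / lam\<^sup>2\<close>.\<close>

lemma exp_tail_le:
  "5 / 3 * exp (- \<kappa>\<^sup>2 / (8 * theta\<^sup>2)) \<le> (lam * \<eta> / 256) * lam * (4 * \<epsilon>\<^sup>2 * \<kappa>\<^sup>2 / (K * (S + 3))) / 4"
proof -
  define X where "X = \<kappa>\<^sup>2 / (8 * theta\<^sup>2)"
  have K0: "0 < K" using K S by simp
  have X: "X = \<kappa>\<^sup>2 * \<eta> / (32 * \<epsilon>\<^sup>2 * S)" using eta by (simp add: X_def theta_sq)
  have x1: "68 * \<epsilon> * sqrt S * L / (32 * \<epsilon>\<^sup>2 * S) \<le> X"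
    unfolding X using eps_le eps S by (intro divide_right_mono) auto
  have x2: "68 * \<epsilon> * sqrt S * L / (32 * \<epsilon>\<^sup>2 * S) = 17 / 8 * (L / (sqrt S * \<epsilon>))"
  proof -
    have "S = sqrt S * sqrt S" using S by simp
    then show ?thesis using eps S by (simp add: power2_eq_square field_simps)
  qed
  have "0 \<le> L / (sqrt S * \<epsilon>)" using L S eps by simp
  with x1 x2 have X1: "2 * (L / (sqrt S * \<epsilon>)) \<le> X" by linarith
  have s1: "1 / \<epsilon> \<le> L / (sqrt S * \<epsilon>)"
    using eps S L sqrt_S by (simp add: divide_simps)
  have s2: "3 * L \<le> L / (sqrt S * \<epsilon>)"
  proof -
    have "3 * \<epsilon> * sqrt S \<le> 68 * \<epsilon> * sqrt S * (S + 1)"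
      using eps S mult_mono[of 3 "68 * (S + 1)" "\<epsilon> * sqrt S" "\<epsilon> * sqrt S"] by (simp add: mult_ac)
    also note eps_S
    also have "\<kappa>\<^sup>2 * \<eta> \<le> 1 * 1" using kappa_le eta by (intro mult_mono) auto
    finally have "L * (3 * \<epsilon> * sqrt S) \<le> L * 1" using L S by (intro mult_left_mono) auto
    then show ?thesis using eps S by (simp add: field_simps)
  qed
  \<comment> \<open>Two of the three powers of \<open>\<epsilon>\<close> match those in the gain;
    the third one is exchanged for \<open>\<kappa>\<^sup>2 * \<eta> / (S + 3)\<close> at the
    end.\<close>
  have e1: "(1 / (3 * \<epsilon>)) ^ 3 \<le> exp (1 / \<epsilon>)"
  proof -
    have "(1 / (3 * \<epsilon>)) ^ 3 \<le> exp (1 / (3 * \<epsilon>)) ^ 3"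
    proof (rule power_mono)
      show "1 / (3 * \<epsilon>) \<le> exp (1 / (3 * \<epsilon>))"
        using exp_ge_add_one_self[of "1 / (3 * \<epsilon>)"] by linarith
    qed (use eps in simp)
    also have "\<dots> = exp (1 / \<epsilon>)" by (simp flip: exp_of_nat_mult)
    finally show ?thesis .
  qed
  have e2: "500 * K / lam\<^sup>2 \<le> exp (3 * L)"
  proof -
    have "500 * K / lam\<^sup>2 \<le> (5 * K / lam) ^ 3"
    proof -
      have "2 * 2 * K \<le> K * K * K" using K S by (intro mult_mono) auto
      then have "lam * (4 * K) \<le> 1 * (K * K * K)" using lam_le_1 lam K0 by (intro mult_mono) auto
      then have f: "lam * (4 * K) \<le> K * K * K" by simp
      have "lam * (4 * K) * 125 / lam ^ 3 \<le> (K * K * K) * 125 / lam ^ 3"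
        using lam by (intro divide_right_mono mult_right_mono f) auto
      moreover have "lam * (4 * K) * 125 / lam ^ 3 = 500 * K / lam\<^sup>2"
        using lam by (simp add: power3_eq_cube power2_eq_square)
      moreover have "(K * K * K) * 125 / lam ^ 3 = (5 * K / lam) ^ 3"
        by (simp add: power3_eq_cube)
      ultimately show ?thesis by simp
    qed
    also have "\<dots> \<le> exp L ^ 3" using L(2) lam K0 by (intro power_mono) auto
    also have "\<dots> = exp (3 * L)" by (simp flip: exp_of_nat_mult)
    finally show ?thesis .
  qed
  have "500 * K / lam\<^sup>2 * (1 / (3 * \<epsilon>)) ^ 3 \<le> exp (3 * L) * exp (1 / \<epsilon>)"
    using e1 e2 eps K0 by (intro mult_mono) auto
  also have "\<dots> = exp (3 * L + 1 / \<epsilon>)" by (simp add: exp_add)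
  also have "\<dots> \<le> exp X"
  proof -
    have "b + a \<le> x" if "a \<le> y" "b \<le> y" "2 * y \<le> x" for a b x y :: real using that by linarith
    from this[OF s1 s2 X1] have "3 * L + 1 / \<epsilon> \<le> X" .
    then show ?thesis by simp
  qed
  finally have eX: "500 * K / lam\<^sup>2 * (1 / (3 * \<epsilon>)) ^ 3 \<le> exp X" .
  have "exp (- X) \<le> inverse (500 * K / lam\<^sup>2 * (1 / (3 * \<epsilon>)) ^ 3)"
    unfolding exp_minus using eX lam eps K0 by (intro le_imp_inverse_le) auto
  also have "\<dots> = 27 * lam\<^sup>2 * \<epsilon> ^ 3 / (500 * K)"
    by (simp add: power_divide power_mult_distrib)
  finally have "5 / 3 * exp (- X) \<le> 5 / 3 * (27 * lam\<^sup>2 * \<epsilon> ^ 3 / (500 * K))"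
    by (rule mult_left_mono) simp
  also have "\<dots> \<le> lam\<^sup>2 * \<epsilon>\<^sup>2 / (256 * K) * (34 * \<epsilon>)"
    using lam eps K0 by (simp add: power3_eq_cube power2_eq_square field_simps)
  also have "\<dots> \<le> lam\<^sup>2 * \<epsilon>\<^sup>2 / (256 * K) * (\<kappa>\<^sup>2 * \<eta> / (S + 3))"
  proof (rule mult_left_mono)
    have "34 * \<epsilon> * (S + 3) \<le> 34 * \<epsilon> * (2 * (S + 1))" using eps S by (intro mult_left_mono) auto
    then show "34 * \<epsilon> \<le> \<kappa>\<^sup>2 * \<eta> / (S + 3)" using eps_S' S by (simp add: field_simps)
  qed (use lam K0 in auto)
  also have "\<dots> = (lam * \<eta> / 256) * lam * (4 * \<epsilon>\<^sup>2 * \<kappa>\<^sup>2 / (K * (S + 3))) / 4"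
    by (simp add: power2_eq_square mult_ac)
  finally show ?thesis by (simp add: X_def)
qed

text \<open>From \<open>S \<le> d\<close> follows \<open>C \<le> 1 + 1 / \<eta>\<^sup>2\<close>. The
  growth in \<open>1 / \<eta>\<close> is compensated by \<open>544 * \<epsilon> \<le> \<eta>\<close>
  in the first bound and by \<open>\<kappa>\<^sup>2 \<le> \<eta> * (S + 3) / 4\<close> in the
  second.\<close>

lemma C_bounds:
  defines "C \<equiv> (1 - S / (d * \<eta>))\<^sup>2"
  shows "\<epsilon>\<^sup>2 * C \<le> 2" and "\<kappa>\<^sup>2 * \<eta> * C \<le> K"
proof -
  have d0: "0 < d" using d S by simp
  have Sd: "S / d \<le> 1" "0 \<le> S / d" using d d0 S by auto
  have "C \<le> 1 + (S / (d * \<eta>))\<^sup>2" using d0 S eta by (simp add: C_def power2_diff)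
  also have "(S / (d * \<eta>))\<^sup>2 = (S / d)\<^sup>2 * (1 / \<eta>\<^sup>2)" by (simp add: power_divide power_mult_distrib)
  also have "\<dots> \<le> 1 * (1 / \<eta>\<^sup>2)" using Sd by (intro mult_right_mono power_le_one) auto
  finally have C: "C \<le> 1 + 1 / \<eta>\<^sup>2" by simp
  have "\<epsilon>\<^sup>2 * C \<le> \<epsilon>\<^sup>2 * (1 + 1 / \<eta>\<^sup>2)" using C by (intro mult_left_mono) auto
  also have "\<dots> = \<epsilon>\<^sup>2 + (\<epsilon> / \<eta>)\<^sup>2" by (simp add: power_divide distrib_left)
  also have "\<dots> \<le> 1 + 1" using eps_eta eta eps eps_small by (intro add_mono power_le_one) auto
  finally show "\<epsilon>\<^sup>2 * C \<le> 2" by simp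
  have "\<kappa>\<^sup>2 * \<eta> * C \<le> \<kappa>\<^sup>2 * \<eta> * (1 + 1 / \<eta>\<^sup>2)" using C eta by (intro mult_left_mono) auto
  also have "\<dots> = \<kappa>\<^sup>2 * \<eta> + \<kappa>\<^sup>2 / \<eta>" using eta by (simp add: field_simps power2_eq_square)
  also have "\<dots> \<le> 1 / 4 * 1 + (S + 3) / 4"
  proof (intro add_mono mult_mono)
    show "\<kappa>\<^sup>2 / \<eta> \<le> (S + 3) / 4" using kappa_le(2) eta by (simp add: field_simps)
  qed (use kappa_le eta in auto)
  also have "\<dots> \<le> K" using K S by (simp add: field_simps)
  finally show "\<kappa>\<^sup>2 * \<eta> * C \<le> K" .
qed

text \<open>The claimed exponent contains two more powers of \<open>\<epsilon>\<close>. By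
  \<open>eps_sq\<close> they supply \<open>\<kappa>\<^sup>2 * \<eta>\<close> twice: one copy is the
  factor of the obtained exponent, the other controls \<open>C\<close>.\<close>

lemma exponent_le:
  assumes N: "0 < N"
  defines "C \<equiv> (1 - S / (d * \<eta>))\<^sup>2"
  shows "N * \<epsilon> ^ 4 * lam\<^sup>2 * S\<^sup>2 * C / (4 * K\<^sup>2 * A) \<le>
    N * ((lam * \<eta> / 256) * lam * (4 * \<epsilon>\<^sup>2 * \<kappa>\<^sup>2 / (K * (S + 3))) / 8)"
proof -
  have K0: "0 < K" using K S by simp
  have C0: "0 \<le> C" by (simp add: C_def)
  \<comment> \<open>Equality holds at \<open>S = 3\<close>; the difference is
    \<open>(S - 3)\<^sup>2 / 8\<close>.\<close>
  have "S * (S + 3) \<le> 9 / 8 * (S + 1)\<^sup>2"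
    using zero_le_power2[of "S - 3"] by (simp add: power2_eq_square algebra_simps)
  then have "128 * \<epsilon>\<^sup>2 * S * C * (S * (S + 3)) \<le> 128 * \<epsilon>\<^sup>2 * S * C * (9 / 8 * (S + 1)\<^sup>2)"
    using S C0 by (intro mult_left_mono) auto
  also have "\<dots> = 144 / 4624 * C * (4624 * \<epsilon>\<^sup>2 * S * (S + 1)\<^sup>2)" by simp
  also have "\<dots> \<le> 144 / 4624 * C * (\<kappa>\<^sup>2 * \<kappa>\<^sup>2 * \<eta>\<^sup>2)"
    using C0 eps_sq by (intro mult_left_mono) auto
  also have "\<dots> = 144 / 4624 * (\<kappa>\<^sup>2 * \<eta>) * (\<kappa>\<^sup>2 * \<eta> * C)" by (simp add: power2_eq_square)
  also have "\<dots> \<le> 1 * (\<kappa>\<^sup>2 * \<eta>) * (K * A)"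
  proof (rule mult_mono)
    show "144 / 4624 * (\<kappa>\<^sup>2 * \<eta>) \<le> 1 * (\<kappa>\<^sup>2 * \<eta>)" using eta by (intro mult_right_mono) auto
    have "K * 1 \<le> K * A" using A K0 by (intro mult_left_mono) auto
    then show "\<kappa>\<^sup>2 * \<eta> * C \<le> K * A" using C_bounds(2) by (simp add: C_def)
  qed (use eta C0 in auto)
  finally have main: "128 * \<epsilon>\<^sup>2 * S * C * (S * (S + 3)) \<le> \<kappa>\<^sup>2 * \<eta> * (K * A)" by simp
  have pos: "0 < 512 * K\<^sup>2 * A * (S + 3)" using K0 A S by simp
  have "N * \<epsilon> ^ 4 * lam\<^sup>2 * S\<^sup>2 * C / (4 * K\<^sup>2 * A)
    = (N * \<epsilon>\<^sup>2 * lam\<^sup>2) * (128 * \<epsilon>\<^sup>2 * S * C * (S * (S + 3))) / (512 * K\<^sup>2 * A * (S + 3))"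
    using K0 A S by (simp add: divide_simps power2_eq_square power4_eq_xxxx)
  also have "\<dots> \<le> (N * \<epsilon>\<^sup>2 * lam\<^sup>2) * (\<kappa>\<^sup>2 * \<eta> * (K * A)) / (512 * K\<^sup>2 * A * (S + 3))"
    using main pos N by (intro divide_right_mono mult_left_mono) auto
  also have "\<dots> = N * ((lam * \<eta> / 256) * lam * (4 * \<epsilon>\<^sup>2 * \<kappa>\<^sup>2 / (K * (S + 3))) / 8)"
    using K0 A S by (simp add: divide_simps power2_eq_square)
  finally show ?thesis .
qed

text \<open>\<open>dom\<close> says that the claimed probability bound is below 1. The logarithm is
  at least \<open>1 / 2\<close>, so \<open>dom\<close> forces
  \<open>K * K * K * d * A < N * \<epsilon>\<^sup>2\<close>, in particular
  \<open>d * S \<le> N * \<epsilon>\<^sup>2\<close>, and this bounds the cells per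
  coordinate.\<close>

lemma grid_size_le:
  assumes N: "1 \<le> N" and dom: "K * d * ln (N * K * A / (lam * S)) < N * \<epsilon> ^ 4 * lam\<^sup>2 * S\<^sup>2 * (1 - S / (d * \<eta>))\<^sup>2 / (4 * K\<^sup>2 * A)"
  defines "\<rho> \<equiv> lam * (4 * \<epsilon>\<^sup>2 * \<kappa>\<^sup>2 / (K * (S + 3))) / (16 * A) * sqrt \<eta> / (2 * sqrt S)"
  shows "2 * (2 * \<epsilon>) / (\<rho> / d) + 2 \<le> N * K * A / (lam * S)"
proof -
  let ?C = "(1 - S / (d * \<eta>))\<^sup>2"
  have K0: "0 < K" "2 \<le> K" and d0: "0 < d" and A0: "0 < A" and S0: "0 < S" using K S d A by auto
  have lS: "0 < lam * S" using lam S0 by simp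
  have "2 * (lam * S) \<le> 2 * 1" using lam by simp
  also have "\<dots> \<le> N * K * A"
  proof -
    have "1 * 2 * 1 \<le> N * K * A" using N K0 A by (intro mult_mono) auto
    then show ?thesis by simp
  qed
  finally have "2 \<le> N * K * A / (lam * S)" using lS by (simp add: pos_le_divide_eq)
  then have "ln 2 \<le> ln (N * K * A / (lam * S))" by simp
  moreover have "1 / 2 \<le> ln (2 :: real)" using ln2_ge_two_thirds by simp
  ultimately have "K * d * (1 / 2) \<le> K * d * ln (N * K * A / (lam * S))"
    using K0 d0 by (intro mult_left_mono) auto
  also note dom
  finally have "K * d * (1 / 2) * (4 * K\<^sup>2 * A) < N * \<epsilon> ^ 4 * lam\<^sup>2 * S\<^sup>2 * ?C"
    using K0 A0 by (subst (asm) pos_less_divide_eq) auto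
  also have "\<dots> = (N * \<epsilon>\<^sup>2) * ((lam * S)\<^sup>2 * (\<epsilon>\<^sup>2 * ?C))"
    by (simp add: power2_eq_square power4_eq_xxxx mult_ac)
  also have "\<dots> \<le> (N * \<epsilon>\<^sup>2) * (1 * 2)"
    using N lS lam C_bounds(1) by (intro mult_left_mono mult_mono power_le_one) auto
  finally have "K * K * K * d * A < N * \<epsilon>\<^sup>2" by (simp add: power2_eq_square mult_ac)
  moreover have "S * 1 * 1 * d * 1 \<le> K * K * K * d * A"
    using K K0 d0 A S by (intro mult_mono) auto
  ultimately have Nd: "d * S \<le> N * \<epsilon>\<^sup>2" by (simp add: mult_ac)
  have se: "\<eta> \<le> sqrt \<eta>" using eta by (intro real_le_rsqrt) (auto simp: power2_eq_square mult_le_one)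
  have ke: "68 * \<epsilon> * sqrt S * (S + 1) \<le> \<kappa>\<^sup>2 * sqrt \<eta>"
    by (rule order_trans[OF eps_S]) (use se in \<open>intro mult_left_mono, auto\<close>)
  have eq: "2 * (2 * \<epsilon>) / (\<rho> / d) = (K * A / (lam * S)) * (32 * d * S * sqrt S * (S + 3) / (\<epsilon> * (\<kappa>\<^sup>2 * sqrt \<eta>)))"
    unfolding \<rho>_def using K0 A0 S0 d0 lam eps kappa eta by (simp add: field_simps power2_eq_square)
  have "32 * d * S * sqrt S * (S + 3) / (\<epsilon> * (\<kappa>\<^sup>2 * sqrt \<eta>)) \<le> 32 * d * S * sqrt S * (S + 3) / (\<epsilon> * (68 * \<epsilon> * sqrt S * (S + 1)))"
    using ke eps S0 d0 kappa eta by (intro divide_left_mono mult_left_mono) auto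
  also have "\<dots> = (sqrt S * (32 * d * S * (S + 3))) / (sqrt S * (68 * \<epsilon>\<^sup>2 * (S + 1)))"
    by (simp add: power2_eq_square mult_ac)
  also have "\<dots> = (32 * d * S * (S + 3)) / (68 * \<epsilon>\<^sup>2 * (S + 1))"
    using S0 by (intro mult_divide_mult_cancel_left) simp
  also have "\<dots> = 32 / 68 * (d * S / \<epsilon>\<^sup>2) * ((S + 3) / (S + 1))"
    by (simp only: times_divide_times_eq mult.assoc)
  also have "\<dots> \<le> 32 / 68 * (d * S / \<epsilon>\<^sup>2) * 2"
    using S0 S d0 by (intro mult_left_mono) (auto simp: divide_le_eq)
  also have "\<dots> = 16 / 17 * (d * S / \<epsilon>\<^sup>2)" by simp
  finally have b1: "2 * (2 * \<epsilon>) / (\<rho> / d) \<le> (K * A / (lam * S)) * (16 / 17 * (d * S / \<epsilon>\<^sup>2))"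
    unfolding eq by (rule mult_left_mono) (use K0 A0 lS in simp)
  \<comment> \<open>The number of cells uses \<open>16 / 17\<close> of the available size; the
    remaining seventeenth pays for the additive 2 that comes from rounding.\<close>
  have b2: "2 \<le> (K * A / (lam * S)) * (1 / 17 * (d * S / \<epsilon>\<^sup>2))"
  proof -
    have "\<epsilon>\<^sup>2 \<le> (1 / 544)\<^sup>2" using eps_small eps by (intro power_mono) auto
    also have "\<dots> \<le> 1 / 34" by (simp add: power2_eq_square)
    finally have "34 * \<epsilon>\<^sup>2 \<le> 1 * 1" by simp
    also have "\<dots> \<le> d * S" using d S by (intro mult_mono) auto
    finally have "34 \<le> d * S / \<epsilon>\<^sup>2" using eps by (simp add: field_simps)
    moreover have "1 \<le> K * A / (lam * S)"
      using lam lS mult_mono[of 1 K 1 A] K0 A by (simp add: pos_le_divide_eq)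
    ultimately have "1 * (1 / 17 * 34) \<le> (K * A / (lam * S)) * (1 / 17 * (d * S / \<epsilon>\<^sup>2))"
      by (intro mult_mono) auto
    then show ?thesis by simp
  qed
  have "2 * (2 * \<epsilon>) / (\<rho> / d) + 2 \<le> (K * A / (lam * S)) * (d * S / \<epsilon>\<^sup>2)"
  proof -
    have "c * (16 / 17 * w) + c * (1 / 17 * w) = c * w" for c w :: real by (simp add: field_simps)
    from add_mono[OF b1 b2, unfolded this] show ?thesis .
  qed
  also have "\<dots> \<le> (K * A / (lam * S)) * N"
    using Nd eps K0 A0 lS by (intro mult_left_mono) (auto simp: divide_le_eq)
  finally show ?thesis by (simp add: mult_ac)
qed

end

section \<open>Assembly of the recovery estimate\<close>

context gap_model
begin

lemma lam_nonneg: "0 \<le> lam"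
proof -
  obtain I :: "'k set" where I: "card I = S" using supports_pos by (auto simp: card_gt_0_iff)
  then have "I \<noteq> {}" "I \<noteq> UNIV" using S_pos S_less by auto
  then obtain i j where ij: "i \<in> I" "j \<notin> I" by auto
  have "moment I j \<le> moment I i"
    unfolding moment_def
  proof (rule integral_mono)
    fix x :: "real^'k"
    show "indicator (dom_region I) x * (x $ j)\<^sup>2 \<le> indicator (dom_region I) x * (x $ i)\<^sup>2"
    proof (cases "x \<in> dom_region I")
      case True
      then have "\<bar>x $ j\<bar> \<le> \<bar>x $ i\<bar>" using ij by (auto simp: dom_region_def less_imp_le)
      then show ?thesis using True by (simp add: abs_le_square_iff)
    qed simp
  qed (intro integrable_indicator_continuous continuous_intros)+
  then show ?thesis unfolding lam_moment(1)[OF I ij] by simp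
qed

text \<open>The passage from grid points to arbitrary dictionaries is deterministic and needs a
  bound for all samples at once, outside one fixed null set.\<close>

lemma AE_sphere_product:
  fixes N :: nat
  defines "M \<equiv> PiM {1..N} (\<lambda>_. \<nu>)"
  shows "{X \<in> space M. \<exists>n\<in>{1..N}. norm (X n) \<noteq> 1} \<in> null_sets M"
proof -
  have "AE X in M. norm (X n) = 1" if "n \<in> {1..N}" for n
    unfolding M_def by (rule AE_PiM_component[OF _ that AE_sphere]) (rule prob_space_axioms)
  then have ae: "AE X in M. \<forall>n\<in>{1..N}. norm (X n) = 1" by (simp add: AE_finite_all)
  have [measurable]: "(\<lambda>X. norm (X n)) \<in> borel_measurable M" if "n \<in> {1..N}" for n
  proof -
    have "(\<lambda>X. X n) \<in> measurable M \<nu>" unfolding M_def using that by (rule measurable_component_singleton)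
    then show ?thesis by (rule measurable_compose) simp
  qed
  have "{X \<in> space M. \<exists>n\<in>{1..N}. norm (X n) \<noteq> 1} \<in> sets M" by measurable
  moreover have "\<And>X. \<not> (\<forall>n\<in>{1..N}. norm (X n) = 1) \<longleftrightarrow> (\<exists>n\<in>{1..N}. norm (X n) \<noteq> 1)" by blast
  ultimately show ?thesis using ae by (subst (asm) AE_iff_null) auto
qed

lemma log_term_ge:
  assumes "0 < lam"
  shows "real S + 1 \<le> ln (5 * A * real CARD('k) ^ S / lam)"
    and "5 * real CARD('k) / lam \<le> exp (ln (5 * A * real CARD('k) ^ S / lam))"
proof -
  let ?K = "real CARD('k)"
  have "lam * 1 \<le> lam * real S" using assms S_pos by (intro mult_left_mono) auto
  then have lam1: "lam \<le> 1" using lam_le by linarith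
  have K1: "1 \<le> ?K" using S_less by simp
  have e3: "exp 1 \<le> (3::real)" using e_less_272 by simp
  \<comment> \<open>For \<open>S = 1\<close> only \<open>K \<ge> 2\<close> is known, less than
    \<open>exp 1\<close>, so \<open>exp 2 \<le> 10\<close> is used. For larger \<open>S\<close> one
    has \<open>exp 1 \<le> 3 \<le> K\<close>.\<close>
  have exp_le: "exp (real S + 1) \<le> 5 * ?K ^ S"
  proof (cases "S = 1")
    case True
    have "exp (2::real) = exp 1 * exp 1" by (simp flip: exp_add)
    also have "\<dots> \<le> 272 / 100 * (272 / 100)" using e_less_272 by (intro mult_mono) auto
    also have "\<dots> \<le> 5 * ?K ^ S" using S_less True by simp
    finally show ?thesis using True by simp
  next
    case False
    then have K3: "3 \<le> ?K" using S_pos S_less by simp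
    have "exp (real S + 1) = exp 1 * exp 1 ^ S" by (simp add: exp_add mult.commute flip: exp_of_nat_mult)
    also have "\<dots> \<le> 5 * ?K ^ S" using e3 K3 by (intro mult_mono power_mono) auto
    finally show ?thesis .
  qed
  have ge: "5 * ?K ^ S \<le> 5 * A * ?K ^ S / lam"
  proof -
    have "lam * (5 * ?K ^ S) \<le> A * (5 * ?K ^ S)" using lam1 A_ge_1 by (intro mult_right_mono) auto
    then show ?thesis using assms by (simp add: pos_le_divide_eq mult_ac)
  qed
  have "exp (real S + 1) \<le> 5 * A * ?K ^ S / lam" using exp_le ge by simp
  then show "real S + 1 \<le> ln (5 * A * ?K ^ S / lam)"
    using assms A_ge_1 K1 by (subst ln_ge_iff) auto
  have "?K ^ 1 \<le> ?K ^ S" using K1 S_pos by (intro power_increasing) auto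
  then have "1 * ?K \<le> A * ?K ^ S" using A_ge_1 by (intro mult_mono) auto
  then have "5 * ?K / lam \<le> 5 * A * ?K ^ S / lam" using assms by (intro divide_right_mono) auto
  also have "\<dots> = exp (ln (5 * A * ?K ^ S / lam))" using assms A_ge_1 K1 by (subst exp_ln) auto
  finally show "5 * ?K / lam \<le> exp (ln (5 * A * ?K ^ S / lam))" .
qed

lemma recovery:
  fixes \<epsilon> :: real and N :: nat
  defines "K \<equiv> real CARD('k)" and "d \<equiv> real CARD('d)" and "\<eta> \<equiv> 1 - lower_isometry_const \<Phi> S"
  defines "E \<equiv> real N * \<epsilon> ^ 4 * lam\<^sup>2 * (real S)\<^sup>2 * (1 - real S / (d * \<eta>))\<^sup>2 / (4 * K\<^sup>2 * A)"
    and "M \<equiv> PiM {1..N} (\<lambda>_. \<nu>)"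
  assumes N: "1 \<le> N" and eps: "0 < \<epsilon>" "\<epsilon> \<le> \<kappa>\<^sup>2 * \<eta> / (68 * sqrt (real S) * ln (5 * A * K ^ S / lam))"
    and dom: "K * d * ln (real N * K * A / (lam * real S)) < E"
  shows "\<exists>B\<in>sets M. measure M B \<le> exp (- E + K * d * ln (real N * K * A / (lam * real S))) \<and>
    (\<forall>X\<in>space M - B. \<exists>\<Psi>. local_max_on dict_set (obj S N (\<lambda>n. synth \<Phi> (X n))) \<Psi> \<and>
      (\<forall>k. norm (\<Psi> k - \<Phi> k) \<le> 2 * \<epsilon>))"
proof -
  define L where "L = ln (5 * A * K ^ S / lam)"
  have eta0: "4 * \<kappa>\<^sup>2 / (real S + 3) \<le> \<eta>" unfolding \<eta>_def by (rule lower_isometry_ge)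
  moreover have "0 < 4 * \<kappa>\<^sup>2 / (real S + 3)" using kappa_pos by simp
  ultimately have eta: "0 < \<eta>" by linarith
  have eta1: "\<eta> \<le> 1" using lower_isometry_const_bounds(1)[OF S_pos, of \<Phi>] unit by (simp add: \<eta>_def)
  have "0 < \<kappa>\<^sup>2 * \<eta> / (68 * sqrt (real S) * L)" using eps unfolding L_def by linarith
  moreover have "0 < \<kappa>\<^sup>2 * \<eta>" using kappa_pos eta by simp
  ultimately have "0 < 68 * sqrt (real S) * L" by (simp only: zero_less_divide_iff) linarith
  then have Lpos: "0 < L" using S_pos by (simp add: zero_less_mult_iff)
  \<comment> \<open>For \<open>lam = 0\<close> the quotient inside the logarithm is 0 and
    \<open>ln 0 = 0\<close>, contradicting \<open>0 < L\<close>.\<close>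
  have lam0: "0 < lam"
  proof (rule ccontr)
    assume "\<not> 0 < lam"
    then have "lam = 0" using lam_nonneg by simp
    then show False using Lpos by (simp add: L_def)
  qed
  have low: "\<eta> * (\<Sum>j\<in>J. (v j)\<^sup>2) \<le> (norm (\<Sum>j\<in>J. v j *\<^sub>R \<Phi> j))\<^sup>2" if "card J \<le> S" for J v
    unfolding \<eta>_def by (rule lower_isometry_bound[OF that])
  have Sd: "real S \<le> d"
  proof -
    obtain I :: "'k set" where I: "card I = S" using supports_pos by (auto simp: card_gt_0_iff)
    then have "dim (span (\<Phi> ` I)) = S" using dim_span_atoms[of I] by simp
    moreover have "dim (span (\<Phi> ` I)) \<le> DIM(real^'d)" by (rule dim_subset_UNIV)
    ultimately show ?thesis by (simp add: d_def)
  qed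
  interpret num: recovery_constants "real S" K d A \<eta> \<kappa> \<epsilon> L lam
  proof
    show "real S + 1 \<le> L" "5 * K / lam \<le> exp L"
      using log_term_ge[OF lam0] by (simp_all add: L_def K_def)
    show "real S + 1 \<le> K" using S_less by (simp add: K_def)
  qed (use S_pos Sd A_ge_1 eta eta1 kappa_pos kappa_bound eta0 lam0 lam_le eps in \<open>auto simp: L_def\<close>)
  define \<theta> where "\<theta> = num.theta"
  \<comment> \<open>The value that \<open>residual_sum_ge\<close> guarantees for the average
    residual at radius \<open>2 * \<epsilon>\<close>.\<close>
  define D0 where "D0 = 4 * \<epsilon>\<^sup>2 * \<kappa>\<^sup>2 / (K * (real S + 3))"
  \<comment> \<open>With this \<open>s\<close> the quadratic term is \<open>5 / 12\<close> of the
    linear gain. The tail takes at most another quarter, so a third remains and a quarter is claimed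
    in \<open>mgf\<close>. The threshold \<open>t\<close> spends half of that quarter, leaving
    \<open>s * lam * D0 / 8\<close> per sample in the exponent.\<close>
  define s where "s = lam * \<eta> / 256"
  define t where "t = lam * D0 / 8"
  have K0: "0 < K" "1 \<le> K" using S_less by (auto simp: K_def)
  have D0: "0 < D0" using eps kappa_pos K0 by (simp add: D0_def)
  have t0: "0 < t" using lam0 D0 by (simp add: t_def)
  have s0: "0 < s" using lam0 eta by (simp add: s_def)
  have th: "0 < \<theta>" "\<theta> < 1" unfolding \<theta>_def by (rule num.theta_pos num.theta_less)+
  have thr: "real S * (2 * \<epsilon>)\<^sup>2 \<le> \<eta> * \<theta>\<^sup>2"
    unfolding \<theta>_def num.theta_sq using eta by (simp add: power_mult_distrib mult_ac)
  have sth: "s * \<theta> \<le> 1 / 8"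
  proof -
    have "lam * \<eta> * \<theta> \<le> 1 * 1 * 1"
      using num.lam_le_1 eta1 th lam0 eta by (intro mult_mono) auto
    then have "lam * \<eta> * \<theta> / 256 \<le> 1 / 8" by linarith
    then show ?thesis by (simp add: s_def)
  qed
  define T where "T = {\<Psi> \<in> dict_set. (\<forall>j. norm (\<Psi> j - \<Phi> j) \<le> 2 * \<epsilon>) \<and> (\<exists>k. norm (\<Psi> k - \<Phi> k) = 2 * \<epsilon>)}"

  have mgf: "(\<integral>x. exp (- s * loss_diff \<Psi> x) \<partial>\<nu>) \<le> 1 - s * lam * D0 / 4" if PsiT: "\<Psi> \<in> T" for \<Psi>
  proof -
    obtain k where psi: "\<And>j. norm (\<Phi> j - \<Psi> j) \<le> 2 * \<epsilon>" "norm (\<Psi> k - \<Phi> k) = 2 * \<epsilon>" "norm (\<Psi> k) = 1"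
      using PsiT by (auto simp: T_def dict_set_def norm_minus_commute)
    define R where "R = (\<Sum>I\<in>supports. residual \<Psi> I)"
    define n where "n = real (card supports)"
    have n0: "0 < n" unfolding n_def using supports_pos by linarith
    let ?c = "8 * \<kappa>\<^sup>2 / (real S * (real S + 3))"
    have "(2 * \<epsilon>)\<^sup>2 * ?c / 8 * real S * n \<le> K * R"
      unfolding n_def R_def K_def
    proof (rule residual_sum_ge[where \<theta>=\<theta> and \<Psi>=\<Psi> and k=k, OF psi(3,2)])
      show "8 * \<theta>\<^sup>2 \<le> ?c" using num.theta_sq_le by (simp add: \<theta>_def)
      show "2 * \<epsilon> \<le> 1" using num.eps_small by simp
      show "norm (proj_I \<Phi> I y - proj_I \<Psi> I y) \<le> \<theta> * norm y" if "card I = S" for I y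
        using that th thr psi(1) low eps eta by (intro proj_I_close[of I \<eta> \<theta> S "2 * \<epsilon>"]) auto
    qed (use th eps in auto)
    moreover have "(2 * \<epsilon>)\<^sup>2 * ?c / 8 * real S * n = K * D0 * n"
      using S_pos K0 by (simp add: D0_def power_mult_distrib)
    ultimately have "K * (D0 * n) \<le> K * R" by (simp only: mult.assoc)
    then have "D0 * n \<le> R" using K0(1) by (simp only: mult_le_cancel_left_pos)
    then have D: "D0 \<le> R / n" using n0 by (simp add: pos_le_divide_eq)
    have 1: "(\<integral>x. exp (- s * loss_diff \<Psi> x) \<partial>\<nu>) \<le>
      1 - s * lam * (R / n) + 320 / 3 * s\<^sup>2 * (R / n) / \<eta> + 5 / 3 * exp (- \<kappa>\<^sup>2 / (8 * \<theta>\<^sup>2))"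
      unfolding R_def n_def
      by (rule integral_exp_loss_diff[where \<Psi>=\<Psi> and r="2 * \<epsilon>", OF th s0 sth eta low _ thr psi(1)])
        (use eps in auto)
    have 2: "320 / 3 * s\<^sup>2 * (R / n) / \<eta> = 5 / 12 * (s * lam * (R / n))"
      using eta by (simp add: s_def power2_eq_square)
    have 3: "5 / 3 * exp (- \<kappa>\<^sup>2 / (8 * \<theta>\<^sup>2)) \<le> s * lam * D0 / 4"
      using num.exp_tail_le by (simp add: \<theta>_def s_def D0_def)
    have 4: "s * lam * D0 \<le> s * lam * (R / n)" using D s0 lam0 by (intro mult_left_mono) auto
    have 5: "0 < s * lam * D0" using D0 s0 lam0 by simp
    have "e \<le> 1 - y / 4" if "e \<le> 1 - x + z + w" "z = 5 / 12 * x" "w \<le> y / 4" "y \<le> x" "0 < y"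
      for e x y z w :: real using that by linarith
    from this[OF 1 2 3 4 5] show ?thesis .
  qed

  define Bad where "Bad \<Psi> = {X \<in> space M. (\<Sum>n=1..N. loss_diff \<Psi> (X n)) \<le> real N * t}" for \<Psi>
  have Bad: "Bad \<Psi> \<in> sets M" "measure M (Bad \<Psi>) \<le> exp (- (real N * (s * lam * D0 / 8)))" if "\<Psi> \<in> T" for \<Psi>
  proof -
    have meas: "loss_diff \<Psi> \<in> borel_measurable \<nu>"
      using borel_measurable_continuous_onI[OF continuous_loss_diff[of \<Psi>]] by simp
    have int: "integrable \<nu> (\<lambda>x. exp (- s * loss_diff \<Psi> x))"
      by (intro integrable_continuous continuous_on_exp continuous_on_mult continuous_on_const continuous_loss_diff)
    note ch = chernoff_product[OF prob_space_axioms meas int mgf[OF that] s0, of N t]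
    show "Bad \<Psi> \<in> sets M" unfolding Bad_def M_def by (rule ch(1))
    have "s * t - s * lam * D0 / 4 = - (s * lam * D0 / 8)" by (simp add: t_def)
    then show "measure M (Bad \<Psi>) \<le> exp (- (real N * (s * lam * D0 / 8)))"
      using ch(2) unfolding Bad_def M_def by simp
  qed

  \<comment> \<open>Samples satisfy \<open>(norm (synth \<Phi> x))\<^sup>2 \<le> A\<close>, so
    moving to the nearest net point costs at most \<open>\<theta>' * A = t / 2\<close> each. The
    mesh \<open>\<rho>\<close> is the largest one that achieves \<open>\<theta>'\<close>.\<close>
  define \<theta>' where "\<theta>' = lam * D0 / (16 * A)"
  define \<rho> where "\<rho> = \<theta>' * sqrt \<eta> / (2 * sqrt (real S))"
  have th': "0 < \<theta>'" using lam0 D0 A_ge_1 by (simp add: \<theta>'_def)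
  have "\<theta>' < 1"
  proof -
    have "D0 \<le> 4 * \<epsilon>\<^sup>2 * \<kappa>\<^sup>2 / 1"
      unfolding D0_def using K0 mult_mono[of 1 K 1 "real S + 3"] by (intro divide_left_mono) auto
    also have "\<dots> \<le> 4 * 1 * (1 / 4) / 1"
      using num.eps_small eps num.kappa_le(1)
      by (intro divide_right_mono mult_mono mult_left_mono power_le_one) auto
    finally have "D0 \<le> 1" by simp
    then have "lam * D0 \<le> 1 * 1" using num.lam_le_1 lam0 D0 by (intro mult_mono) auto
    then have "lam * D0 < 16 * A" using A_ge_1 by linarith
    then show ?thesis using A_ge_1 by (simp add: \<theta>'_def)
  qed
  have rho0: "0 < \<rho>" using th' eta S_pos by (simp add: \<rho>_def)
  have rho: "real S * \<rho>\<^sup>2 \<le> \<eta> / 4 * \<theta>'\<^sup>2"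
    using eta S_pos by (simp add: \<rho>_def power_mult_distrib power_divide)
  have d0: "0 < d" by (simp add: d_def)
  obtain T0 where T0: "T0 \<subseteq> T" "finite T0"
      "real (card T0) \<le> (2 * (2 * \<epsilon>) / (\<rho> / d) + 2) ^ (CARD('k) * CARD('d))"
      "\<And>\<Psi>. \<Psi> \<in> T \<Longrightarrow> \<exists>\<Psi>'\<in>T0. \<forall>k. norm (\<Psi> k - \<Psi>' k) \<le> \<rho>"
  proof (rule grid_net[of T \<Phi> "2 * \<epsilon>" "\<rho> / d"])
    fix T0 assume "T0 \<subseteq> T" "finite T0"
      "real (card T0) \<le> (2 * (2 * \<epsilon>) / (\<rho> / d) + 2) ^ (CARD('k) * CARD('d))"
      "\<And>\<Psi>. \<Psi> \<in> T \<Longrightarrow> \<exists>\<Psi>'\<in>T0. \<forall>k. norm (\<Psi> k - \<Psi>' k) \<le> real CARD('d) * (\<rho> / d)"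
    moreover have "real CARD('d) * (\<rho> / d) = \<rho>" by (simp add: d_def)
    ultimately show thesis using that by simp
  qed (use eps rho0 d0 in \<open>auto simp: T_def\<close>)
  let ?G = "real N * K * A / (lam * real S)"
  have G0: "0 < ?G" using N K0 A_ge_1 lam0 S_pos by simp
  have "2 * (2 * \<epsilon>) / (\<rho> / d) + 2 \<le> ?G"
    using num.grid_size_le[of "real N"] N dom by (simp add: \<rho>_def \<theta>'_def D0_def E_def)
  then have "(2 * (2 * \<epsilon>) / (\<rho> / d) + 2) ^ (CARD('k) * CARD('d)) \<le> ?G ^ (CARD('k) * CARD('d))"
    using eps rho0 d0 by (intro power_mono) auto
  also have "\<dots> = exp (K * d * ln ?G)"
  proof -
    have "g ^ m = exp (real m * ln g)" if "0 < g" for g :: real and m using that by (simp add: exp_of_nat_mult)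
    from this[OF G0] show ?thesis by (simp only: K_def d_def of_nat_mult)
  qed
  finally have cardT0: "real (card T0) \<le> exp (K * d * ln ?G)" using T0(3) by simp

  define Z where "Z = {X \<in> space M. \<exists>n\<in>{1..N}. norm (X n) \<noteq> 1}"
  have Z: "Z \<in> null_sets M" unfolding Z_def M_def by (rule AE_sphere_product)
  define B where "B = (\<Union>\<Psi>\<in>T0. Bad \<Psi>) \<union> Z"
  interpret PM: prob_space M unfolding M_def by (rule prob_space_PiM) (rule prob_space_axioms)
  have U: "(\<Union>\<Psi>\<in>T0. Bad \<Psi>) \<in> sets M" using T0(1,2) Bad(1) by (intro sets.finite_UN) auto
  have "measure M B = measure M (\<Union>\<Psi>\<in>T0. Bad \<Psi>)"
    unfolding B_def using U Z by (rule measure_Un_null_set)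
  also have "\<dots> \<le> (\<Sum>\<Psi>\<in>T0. measure M (Bad \<Psi>))"
    using T0 Bad(1) by (intro PM.finite_measure_subadditive_finite) auto
  also have "\<dots> \<le> (\<Sum>\<Psi>\<in>T0. exp (- (real N * (s * lam * D0 / 8))))"
    using T0(1) Bad(2) by (intro sum_mono) auto
  also have "\<dots> = real (card T0) * exp (- (real N * (s * lam * D0 / 8)))" by simp
  also have "\<dots> \<le> exp (K * d * ln ?G) * exp (- E)"
  proof (intro mult_mono cardT0)
    have "E \<le> real N * (s * lam * D0 / 8)"
      using num.exponent_le[of "real N"] N by (simp add: E_def s_def D0_def)
    then show "exp (- (real N * (s * lam * D0 / 8))) \<le> exp (- E)" by simp
  qed auto
  also have "\<dots> = exp (- E + K * d * ln ?G)" by (simp flip: exp_add)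
  finally have PB: "measure M B \<le> exp (- E + K * d * ln ?G)" .
  have BM: "B \<in> sets M" unfolding B_def using U Z by auto

  have "\<exists>\<Psi>. local_max_on dict_set (obj S N (\<lambda>n. synth \<Phi> (X n))) \<Psi> \<and> (\<forall>k. norm (\<Psi> k - \<Phi> k) \<le> 2 * \<epsilon>)"
    if X: "X \<in> space M - B" for X
  proof (rule local_max_from_boundary[OF low eta])
    show "sqrt (real S) * (2 * \<epsilon>) \<le> sqrt \<eta> / 2" by (rule num.radius_le)
    show "\<Phi> \<in> dict_set" using unit by (simp add: dict_set_def)
    fix \<Psi> k
    assume psi: "\<Psi> \<in> dict_set" "\<And>j. norm (\<Psi> j - \<Phi> j) \<le> 2 * \<epsilon>" "norm (\<Psi> k - \<Phi> k) = 2 * \<epsilon>"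
    then have "\<Psi> \<in> T" by (auto simp: T_def)
    then obtain \<Psi>' where psi': "\<Psi>' \<in> T0" "\<And>k. norm (\<Psi> k - \<Psi>' k) \<le> \<rho>" using T0(4) by blast
    have "X \<notin> Bad \<Psi>'" using X psi'(1) by (auto simp: B_def)
    then have gt: "real N * t < (\<Sum>n=1..N. loss_diff \<Psi>' (X n))" using X by (auto simp: Bad_def)
    have "loss_diff \<Psi>' (X n) - t / 2 \<le> loss_diff \<Psi> (X n)" if n: "n \<in> {1..N}" for n
    proof -
      let ?y = "synth \<Phi> (X n)"
      have "norm (X n) = 1" using X n by (auto simp: B_def Z_def)
      then have y: "(norm ?y)\<^sup>2 \<le> A" by (rule norm_sq_synth_le)
      have "\<bar>max_proj S \<Psi> ?y - max_proj S \<Psi>' ?y\<bar> \<le> \<theta>' * (norm ?y)\<^sup>2"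
        using psi(2) psi'(2) eps rho0 rho th' \<open>\<theta>' < 1\<close> num.radius_le
        by (intro max_proj_close_perturb[where r="2 * \<epsilon>" and \<rho>=\<rho>, OF low eta]) (auto simp: norm_minus_commute)
      also have "\<dots> \<le> \<theta>' * A" using y th' by (intro mult_left_mono) auto
      also have "\<dots> = t / 2" using A_ge_1 by (simp add: \<theta>'_def t_def)
      finally show ?thesis unfolding loss_diff_def by linarith
    qed
    then have "(\<Sum>n=1..N. loss_diff \<Psi>' (X n) - t / 2) \<le> (\<Sum>n=1..N. loss_diff \<Psi> (X n))"
      by (rule sum_mono)
    moreover have "(\<Sum>n=1..N. loss_diff \<Psi>' (X n) - t / 2) = (\<Sum>n=1..N. loss_diff \<Psi>' (X n)) - real N * (t / 2)"
      by (simp add: sum_subtractf)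
    moreover have "real N * (t / 2) < real N * t" using N t0 by simp
    ultimately have "0 < (\<Sum>n=1..N. loss_diff \<Psi> (X n))" using gt by linarith
    also have "\<dots> = (\<Sum>n=1..N. max_proj S \<Phi> (synth \<Phi> (X n))) - (\<Sum>n=1..N. max_proj S \<Psi> (synth \<Phi> (X n)))"
      by (simp add: loss_diff_def sum_subtractf)
    finally show "obj S N (\<lambda>n. synth \<Phi> (X n)) \<Psi> < obj S N (\<lambda>n. synth \<Phi> (X n)) \<Phi>"
      unfolding obj_max_proj using N by (intro mult_strict_left_mono) auto
  qed (use eps(1) in auto)
  then show ?thesis using BM PB by blast
qed

end

section \<open>The complete case and the final statement\<close>

lemma complete_tight_frame_orthonormal:
  fixes \<Phi> :: "'k::finite \<Rightarrow> real^'d"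
  assumes frame: "unit_norm_tight_frame \<Phi> (real CARD('k) / real CARD('d))"
    and pos: "lower_isometry_const \<Phi> CARD('k) < 1"
  shows "CARD('k) = CARD('d)" "lower_isometry_const \<Phi> CARD('k) = 0"
proof -
  have unit: "norm (\<Phi> i) = 1" for i using frame by (simp add: unit_norm_tight_frame_def)
  have K1: "1 \<le> CARD('k)" by (simp add: Suc_leI)
  have "dim (span (range \<Phi>)) = CARD('k)"
    using lower_isometry_bound[of UNIV "CARD('k)" \<Phi>] pos
    by (intro dim_span_image_eq_card[of _ "1 - lower_isometry_const \<Phi> CARD('k)"]) auto
  moreover have "dim (span (range \<Phi>)) \<le> DIM(real^'d)" by (rule dim_subset_UNIV)
  ultimately have "CARD('k) \<le> CARD('d)" by simp
  moreover have "CARD('d) \<le> CARD('k)"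
    using tight_frame_const_ge_1[OF frame] by (simp add: pos_le_divide_eq)
  ultimately show Kd: "CARD('k) = CARD('d)" by simp
  \<comment> \<open>With frame constant 1 an atom's own term exhausts the frame identity, so all
    other inner products vanish.\<close>
  have orth: "\<Phi> i \<bullet> \<Phi> j = 0" if "i \<noteq> j" for i j
  proof -
    have "(\<Sum>l\<in>UNIV. (\<Phi> l \<bullet> \<Phi> j)\<^sup>2) = 1"
      using frame Kd unit by (simp add: unit_norm_tight_frame_def)
    moreover have "(\<Sum>l\<in>UNIV. (\<Phi> l \<bullet> \<Phi> j)\<^sup>2) = (\<Phi> j \<bullet> \<Phi> j)\<^sup>2 + (\<Sum>l\<in>UNIV - {j}. (\<Phi> l \<bullet> \<Phi> j)\<^sup>2)"
      by (simp add: sum.remove)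
    moreover have "\<Phi> j \<bullet> \<Phi> j = 1" using unit[of j] by (simp add: norm_eq_1)
    ultimately have "(\<Sum>l\<in>UNIV - {j}. (\<Phi> l \<bullet> \<Phi> j)\<^sup>2) = 0" by simp
    then show ?thesis using that by (simp add: sum_nonneg_eq_0_iff)
  qed
  have "1 \<le> 1 - lower_isometry_const \<Phi> CARD('k)"
  proof (rule lower_isometry_const_le[OF K1])
    fix J :: "'k set" and v :: "'k \<Rightarrow> real"
    have "(norm (\<Sum>j\<in>J. v j *\<^sub>R \<Phi> j))\<^sup>2 = (\<Sum>j\<in>J. (norm (v j *\<^sub>R \<Phi> j))\<^sup>2)"
      by (rule norm_sum_Pythagorean) (auto simp: pairwise_def orthogonal_def orth)
    then show "1 * (\<Sum>j\<in>J. (v j)\<^sup>2) \<le> (norm (\<Sum>j\<in>J. v j *\<^sub>R \<Phi> j))\<^sup>2" by (simp add: unit)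
  qed
  then show "lower_isometry_const \<Phi> CARD('k) = 0"
    using lower_isometry_const_bounds(1)[OF K1, of \<Phi>] unit by simp
qed

theorem theorem8:
  fixes \<Phi> :: "'k::finite \<Rightarrow> real^'d"
    and \<nu> :: "(real^'k) measure"
    and S N :: nat and \<kappa> q :: real
  defines "K \<equiv> real CARD('k)" and "d \<equiv> real CARD('d)"
  defines "A \<equiv> K / d"
  defines "\<mu> \<equiv> coherence \<Phi>" and "\<delta> \<equiv> lower_isometry_const \<Phi> S"
  defines "\<gamma>2 \<equiv> (\<integral>x. (\<Sum>j=1..S. (rearr x j)^2) \<partial>\<nu>)"
  defines "lam \<equiv> \<gamma>2 / real S - (1 - \<gamma>2) / (K - real S)"
  defines "C \<equiv> (1 - real S / (d * (1 - \<delta>)))^2"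
  assumes frame: "unit_norm_tight_frame \<Phi> A"
    and delta_mu: "\<delta> \<le> \<mu> * real S"
    and S_bounds: "1 \<le> S" "S \<le> CARD('k)"
    and sym: "symmetric_sphere_measure \<nu>"
    and kappa_pos: "\<kappa> > 0"
    and gap: "AE x in \<nu>. \<forall>p \<sigma>. bij_betw p (UNIV::'k set) {1..CARD('k)} \<and> (\<forall>i. \<sigma> i \<in> {-1, 1}) \<longrightarrow>
               (\<forall>I. card I \<le> S \<and> I \<noteq> {i. p i \<le> S} \<longrightarrow>
                  norm (proj_I \<Phi> {i. p i \<le> S} (synth \<Phi> (rearr_ps p \<sigma> x)))
                  - norm (proj_I \<Phi> I (synth \<Phi> (rearr_ps p \<sigma> x))) \<ge> 2 * \<kappa>)"
    and q: "0 < q" "q < 1/4"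
    and N_cond: "real N powr (-q) + real N powr (-2*q) / K
                 \<le> \<kappa>^2 * (1 - \<delta>) / (68 * sqrt (real S) * ln (5 * A * K ^ S / lam))"
  shows "\<exists>B \<in> sets (PiM {1..N} (\<lambda>_. \<nu>)).
           measure (PiM {1..N} (\<lambda>_. \<nu>)) B
             \<le> exp (- (real N powr (1 - 4*q) * lam^2 * (real S)^2 * C) / (4 * K^2 * A)
                    + K * d * ln (real N * K * A / (lam * real S))) \<and>
           (\<forall>X \<in> space (PiM {1..N} (\<lambda>_. \<nu>)) - B.
              \<exists>\<Psi>. local_max_on dict_set (obj S N (\<lambda>n. synth \<Phi> (X n))) \<Psi> \<and>
                   (\<forall>k. norm (\<Psi> k - \<Phi> k) \<le> 2 * real N powr (-q)))"
proof (cases "N = 0")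
  case True
  let ?M = "PiM {1..N} (\<lambda>_. \<nu>)"
  \<comment> \<open>Without samples the objective is constantly 0, so \<open>\<Phi>\<close> itself
    is a local maximum.\<close>
  have "local_max_on dict_set (obj S N y) \<Phi>" for y :: "nat \<Rightarrow> real^'d"
    using frame True by (auto simp: local_max_on_def obj_def dict_set_def unit_norm_tight_frame_def intro!: exI[of _ 1])
  then show ?thesis by (intro bexI[of _ "{}"] conjI ballI exI[of _ \<Phi>]) auto
next
  case False
  let ?M = "PiM {1..N} (\<lambda>_. \<nu>)"
  let ?\<epsilon> = "real N powr (- q)" and ?\<eta> = "1 - \<delta>"
  \<comment> \<open>A nonnegative exponent makes the probability bound at least 1, and the whole
    space can be discarded.\<close>
  have trivial: ?thesis
    if le: "0 \<le> - (real N powr (1 - 4*q) * lam^2 * (real S)^2 * C) / (4 * K^2 * A)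
        + K * d * ln (real N * K * A / (lam * real S))"
  proof -
    have "prob_space ?M"
      using sym by (intro prob_space_PiM) (simp add: symmetric_sphere_measure_def)
    then have "measure ?M (space ?M) \<le> exp (- (real N powr (1 - 4*q) * lam^2 * (real S)^2 * C) / (4 * K^2 * A)
        + K * d * ln (real N * K * A / (lam * real S)))"
      using le by (simp add: prob_space.prob_space)
    then show ?thesis by (intro bexI[of _ "space ?M"] conjI) auto
  qed
  have unit: "norm (\<Phi> i) = 1" for i using frame by (simp add: unit_norm_tight_frame_def)
  have eps: "0 < ?\<epsilon>" using False by simp
  have K0: "0 < K" and d0: "0 < d" by (simp_all add: K_def d_def)
  have "0 \<le> real N powr (-2*q) / K" using K0 by simp
  then have eps_le: "?\<epsilon> \<le> \<kappa>^2 * ?\<eta> / (68 * sqrt (real S) * ln (5 * A * K ^ S / lam))"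
    using N_cond by linarith
  show ?thesis
  proof (cases "S = CARD('k)")
    case True
    \<comment> \<open>\<open>\<delta> = 1\<close> would turn the upper bound on the positive radius
      into 0.\<close>
    have "?\<eta> \<noteq> 0" using eps eps_le by auto
    then have "\<delta> < 1"
      using lower_isometry_const_bounds(2)[OF S_bounds(1), of \<Phi>] unit by (simp add: \<delta>_def)
    then have Kd: "CARD('k) = CARD('d)" and delta: "\<delta> = 0"
      using complete_tight_frame_orthonormal[of \<Phi>] frame True by (simp_all add: \<delta>_def A_def K_def d_def)
    have "C = 0" using Kd delta True by (simp add: C_def d_def)
    moreover have "\<gamma>2 = 1"
    proof -
      have "\<gamma>2 = (\<integral>x. (norm x)\<^sup>2 \<partial>\<nu>)" unfolding \<gamma>2_def True sum_rearr_sq ..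
      also have "\<dots> = (\<integral>x. 1 \<partial>\<nu>)"
      proof (rule integral_cong_AE)
        have p: "prob_space \<nu>" "sets \<nu> = sets borel" "emeasure \<nu> (sphere 0 1) = 1"
          using sym by (auto simp: symmetric_sphere_measure_def)
        then have "AE x in \<nu>. x \<in> sphere 0 1"
          by (intro prob_space.AE_prob_1) (auto simp: measure_def)
        then show "AE x in \<nu>. (norm x)\<^sup>2 = 1" by eventually_elim auto
        show "(\<lambda>x. (norm x)\<^sup>2) \<in> borel_measurable \<nu>"
          unfolding measurable_cong_sets[OF p(2) refl] by measurable
      qed simp
      also have "\<dots> = 1" using sym prob_space.prob_space[of \<nu>] by (simp add: symmetric_sphere_measure_def)
      finally show ?thesis .
    qed
    \<comment> \<open>The second fraction in \<open>lam\<close> is \<open>0 / 0 = 0\<close>. With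
      \<open>C = 0\<close> the exponent is then a positive multiple of the logarithm of
      \<open>N * K * A\<close>, which is at least 1.\<close>
    then have "lam * real S = 1" using True S_bounds by (simp add: lam_def K_def)
    moreover have "1 \<le> real N * K * A"
    proof -
      have "1 * 1 * 1 \<le> real N * K * A"
        using False tight_frame_const_ge_1[OF frame] by (intro mult_mono) (auto simp: K_def Suc_leI)
      then show ?thesis by simp
    qed
    ultimately show ?thesis using K0 d0 by (intro trivial) simp
  next
    case S_neq: False
    interpret G: gap_model \<Phi> A \<nu> S \<kappa>
      using frame sym kappa_pos S_bounds S_neq gap
      by unfold_locales (auto simp: gap_at_def)
    have lam_eq: "lam = G.lam"
      by (simp add: lam_def G.lam_def \<gamma>2_def G.gamma2_def K_def)
    have pow: "real N powr (1 - 4*q) = real N * ?\<epsilon> ^ 4"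
    proof -
      have "?\<epsilon> ^ 4 = real N powr (- 4 * q)" using False by (simp add: powr_power)
      then show ?thesis using False by (simp add: powr_diff powr_minus_divide)
    qed
    \<comment> \<open>The case distinction is whether the claimed probability bound is below 1;
      exactly then the grid can be counted.\<close>
    show ?thesis
    proof (cases "K * d * ln (real N * K * A / (lam * real S)) <
        real N * ?\<epsilon> ^ 4 * lam^2 * (real S)^2 * C / (4 * K^2 * A)")
      case True
      show ?thesis
        using G.recovery[of N ?\<epsilon>] False eps eps_le True
        by (simp add: pow C_def K_def d_def \<delta>_def lam_eq)
    next
      case False
      then show ?thesis by (intro trivial) (simp add: pow)
    qed
  qed
qed

end
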